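(* Assume that $\nu$ is symmetric (i.e. $\nu(B)=\nu(-B)$ for all Borel $B\subset\mathbb{S}^{d-1}$) and that the Lévy measure $\mu$ is a $\gamma$-measure for some $\gamma\in[1,d]$ with $\gamma>d-\alpha$. Let $\tau_1,\tau_2,\dots$ be i.i.d. $\nu$-Paretian random vectors, set $$\zeta_{n,i}=\Big(\frac{\alpha}{d_\alpha}\Big)^{-1/\alpha}\frac{\tau_i}{n^{1/\alpha}},\qquad 1\le i\le n,$$ and $$S_n=\begin{cases}\sum_{i=1}^n(\zeta_{n,i}-\mathbb{E}\zeta_{n,i}),&\alpha\in(1,2),\\ \sum_{i=1}^n\big(\zeta_{n,i}-\mathbb{E}[\zeta_{n,i}\mathbf 1_{(0,1]}(|\zeta_{n,i}|)]\big),&\alpha=1,\\ \sum_{i=1}^n\zeta_{n,i},&\alpha\in(0,1).\end{cases}$$ Then there is a finite constant $C>0$, not depending on $n$, such that for all $n$ (with $n\ge2$ when $\alpha=1$): $$d_W(\mathcal{L}(S_n),\pi)\le Cn^{\frac{\alpha-2}\alpha},\qquad\alpha\in(1,2),$$ and, for any $\beta\in(0,\alpha)$ (with $C$ allowed to depend on $\beta$), $$d_{W_\beta}(\mathcal{L}(S_n),\pi)\le C\begin{cases}n^{-1}(\log n)^2,&\alpha=1,\\ n^{-1}+\Big|\int_{\mathbb{S}^{d-1}}\theta\,\nu(d\theta)\Big|n^{\frac{\alpha-1}\alpha},&\alpha\in(\frac12,1),\end{cases}$$ $$\sup_{h\in\mathcal{H}_\beta\cap\mathcal{F}_\beta}\big|\mathbb{E}h(S_n)-\pi(h)\big|\le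 C\Big(n^{-1}+\Big|\int_{\mathbb{S}^{d-1}}\theta\,\nu(d\theta)\Big|n^{\frac{\alpha-1}\alpha}\Big),\qquad\alpha\in(0,\tfrac12].$$
   Context: Let $d\ge2$, $\alpha\in(0,2)$, and let $\nu$ be a Borel probability measure on the unit sphere $\mathbb{S}^{d-1}\subset\mathbb{R}^d$; if $\alpha=1$ it is assumed that $\int_{\mathbb{S}^{d-1}}\theta\,\nu(d\theta)=0$. $|\cdot|$ is the Euclidean norm and $a\wedge b=\min(a,b)$. A random vector $\tau$ is $\nu$-Paretian if $\tau=\xi\varepsilon$ in law with $\xi,\varepsilon$ independent, $\xi$ having density $\alpha u^{-1-\alpha}\mathbf 1_{\{u\ge1\}}$ on $\mathbb{R}$, and $\varepsilon$ a random unit vector with $P(\varepsilon\in E)=\nu(E)$ for Borel $E\subset\mathbb{S}^{d-1}$. Put $k_\alpha(r)=\mathbf 1_{\{\alpha=1,\,r\in(0,1]\}}+\mathbf 1_{\{\alpha\in(1,2)\}}$ and $d_\alpha^{-1}=\int_0^\infty(1-\cos y)y^{-1-\alpha}dy=\alpha^{-1}\Gamma(1-\alpha)\cos\frac{\pi\alpha}{2}$ for $\alpha\ne1$, $d_1=2/\pi$. Let $\pi$ be the strictly $\alpha$-stable law on $\mathbb{R}^d$ with characteristic function $$\widehat\pi(\lambda)=\exp\Big[d_\alpha\int_{\mathbb{S}^{d-1}}\nu(d\theta)\int_0^\infty\big(e^{\mathrm{i}\langle\lambda,r\theta\rangle}-1-\mathrm{i}\langle\lambda,r\theta\rangle k_\alpha(r)\big)\frac{dr}{r^{1+\alpha}}\Big],$$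 and write $\pi(h)=\int h\,d\pi$. It is assumed that $\pi$ has a density. The Lévy measure is $\mu(A)=\int_{\mathbb{S}^{d-1}}\nu(d\theta)\int_0^\infty\mathbf 1_A(r\theta)\frac{dr}{r^{1+\alpha}}$. It is called a $\gamma$-measure if there is a finite $c>0$ with $\mu(B(x,r))\le cr^\gamma$ for all $x\in\mathbb{S}^{d-1}$ and $0<r<1/2$, where $B(x,r)$ is the Euclidean ball. $\mathcal{L}(S_n)$ denotes the law of $S_n$. $\mathrm{Lip}_1$ is the set of $h:\mathbb{R}^d\to\mathbb{R}$ with Lipschitz constant at most $1$; for $0<\beta<\alpha\le1$, $\mathcal{H}_\beta$ is the set of $h:\mathbb{R}^d\to\mathbb{R}$ with $|h(x)-h(y)|\le|x-y|\wedge|x-y|^\beta$ for all $x,y$; $\mathcal{F}_\beta$ is the set of differentiable $h:\mathbb{R}^d\to\mathbb{R}$ with $|\nabla h(x)|\le\frac1{1+|x|^{1-\beta}}$ for all $x$. The distances are $d_W(\mu_1,\mu_2)=\sup_{h\in\mathrm{Lip}_1}|\mu_1(h)-\mu_2(h)|$ and $d_{W_\beta}(\mu_1,\mu_2)=\sup_{h\in\mathcal{H}_\beta}|\mu_1(h)-\mu_2(h)|$. *)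

theory Defs
  imports "HOL-Probability.Probability"
begin

definition sphere_borel :: "'a::euclidean_space measure" where
  "sphere_borel = restrict_space borel (sphere 0 1)"

definition sphere_symmetric :: "'a::euclidean_space measure \<Rightarrow> bool" where
  "sphere_symmetric \<nu> \<longleftrightarrow> (\<forall>B\<in>sets sphere_borel. emeasure \<nu> B = emeasure \<nu> (uminus ` B))"

(* Only the law of \<tau> is constrained. The pair (\<xi>, \<epsilon>) lives on an auxiliary probability space;
   the type real \<times> 'a is no restriction, as it can carry the joint law of any such pair. Independence is that of the generated \<sigma>-algebras,
   since indep_var needs both variables to have the same type. *)
definition paretian ::
  "real \<Rightarrow> 'a::euclidean_space measure \<Rightarrow> 'b measure \<Rightarrow> ('b \<Rightarrow> 'a) \<Rightarrow> bool" where
  "paretian \<alpha> \<nu> M \<tau> \<longleftrightarrow>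
     \<tau> \<in> borel_measurable M \<and>
     (\<exists>(N :: (real \<times> 'a) measure) \<xi> \<epsilon>.
        prob_space N \<and>
        distributed N lborel \<xi> (\<lambda>u. ennreal (\<alpha> * u powr (-1 - \<alpha>) * indicator {1..} u)) \<and>
        \<epsilon> \<in> measurable N sphere_borel \<and>
        distr N sphere_borel \<epsilon> = \<nu> \<and>
        prob_space.indep_set N (sets (vimage_algebra (space N) \<xi> borel))
          (sets (vimage_algebra (space N) \<epsilon> sphere_borel)) \<and>
        distr M borel \<tau> = distr N borel (\<lambda>\<omega>. \<xi> \<omega> *\<^sub>R \<epsilon> \<omega>))"

definition k_trunc :: "real \<Rightarrow> real \<Rightarrow> real" where
  "k_trunc \<alpha> r = of_bool (\<alpha> = 1 \<and> r \<in> {0<..1}) + of_bool (\<alpha> \<in> {1<..<2})"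

(* The value 2 / pi is also the reciprocal of the integral at \<alpha> = 1. *)
definition d_const :: "real \<Rightarrow> real" where
  "d_const \<alpha> =
     (if \<alpha> = 1 then 2 / pi
      else inverse (LINT y:{0<..}|lborel. (1 - cos y) * y powr (-1 - \<alpha>)))"

definition stable_law ::
  "real \<Rightarrow> 'a::euclidean_space measure \<Rightarrow> 'a measure \<Rightarrow> bool" where
  "stable_law \<alpha> \<nu> \<pi> \<longleftrightarrow>
     prob_space \<pi> \<and> sets \<pi> = sets borel \<and>
     (\<forall>l. (LINT x|\<pi>. exp (\<i> * complex_of_real (l \<bullet> x))) =
       exp (complex_of_real (d_const \<alpha>) *
         (LINT \<theta>|\<nu>. (LINT r:{0<..}|lborel.
            (exp (\<i> * complex_of_real (l \<bullet> (r *\<^sub>R \<theta>))) - 1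
              - \<i> * complex_of_real ((l \<bullet> (r *\<^sub>R \<theta>)) * k_trunc \<alpha> r))
            / complex_of_real (r powr (1 + \<alpha>))))))"

definition has_density :: "'a::euclidean_space measure \<Rightarrow> bool" where
  "has_density \<pi> \<longleftrightarrow> (\<exists>p\<in>borel_measurable lborel. \<pi> = density lborel p)"

definition levy_measure ::
  "real \<Rightarrow> 'a::euclidean_space measure \<Rightarrow> 'a set \<Rightarrow> ennreal" where
  "levy_measure \<alpha> \<nu> A =
     (\<integral>\<^sup>+\<theta>. (\<integral>\<^sup>+r\<in>{0<..}. indicator A (r *\<^sub>R \<theta>) * ennreal (1 / r powr (1 + \<alpha>)) \<partial>lborel) \<partial>\<nu>)"

definition gamma_measure :: "real \<Rightarrow> ('a::euclidean_space set \<Rightarrow> ennreal) \<Rightarrow> bool" where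
  "gamma_measure \<gamma> \<mu> \<longleftrightarrow>
     (\<exists>c>0. \<forall>x\<in>sphere 0 1. \<forall>r. 0 < r \<and> r < 1 / 2 \<longrightarrow> \<mu> (ball x r) \<le> ennreal (c * r powr \<gamma>))"

definition zeta ::
  "real \<Rightarrow> (nat \<Rightarrow> 'b \<Rightarrow> 'a::euclidean_space) \<Rightarrow> nat \<Rightarrow> nat \<Rightarrow> 'b \<Rightarrow> 'a" where
  "zeta \<alpha> \<tau> n i \<omega> =
     ((\<alpha> / d_const \<alpha>) powr (- 1 / \<alpha>)) *\<^sub>R (\<tau> i \<omega> /\<^sub>R (real n powr (1 / \<alpha>)))"

definition S_sum ::
  "real \<Rightarrow> 'b measure \<Rightarrow> (nat \<Rightarrow> 'b \<Rightarrow> 'a::euclidean_space) \<Rightarrow> nat \<Rightarrow> 'b \<Rightarrow> 'a" where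
  "S_sum \<alpha> M \<tau> n \<omega> =
     (if \<alpha> > 1 then
        \<Sum>i=1..n. zeta \<alpha> \<tau> n i \<omega> - (LINT \<omega>'|M. zeta \<alpha> \<tau> n i \<omega>')
      else if \<alpha> = 1 then
        \<Sum>i=1..n. zeta \<alpha> \<tau> n i \<omega>
          - (LINT \<omega>'|M. indicator {0<..1} (norm (zeta \<alpha> \<tau> n i \<omega>')) *\<^sub>R zeta \<alpha> \<tau> n i \<omega>')
      else
        \<Sum>i=1..n. zeta \<alpha> \<tau> n i \<omega>)"

definition Lip1 :: "('a::euclidean_space \<Rightarrow> real) set" where
  "Lip1 = {h. 1-lipschitz_on UNIV h}"

definition H_class :: "real \<Rightarrow> ('a::euclidean_space \<Rightarrow> real) set" where
  "H_class \<beta> = {h. \<forall>x y. \<bar>h x - h y\<bar> \<le> min (norm (x - y)) (norm (x - y) powr \<beta>)}"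

definition F_class :: "real \<Rightarrow> ('a::euclidean_space \<Rightarrow> real) set" where
  "F_class \<beta> =
     {h. \<forall>x. \<exists>D. (GDERIV h x :> D) \<and> norm D \<le> 1 / (1 + norm x powr (1 - \<beta>))}"

(* The Bochner integral of a non-integrable function is 0, so such a test function is made to
   contribute the value \<infinity>: an upper bound then never holds for want of integrability. *)
definition ipm :: "('a::euclidean_space \<Rightarrow> real) set \<Rightarrow> 'a measure \<Rightarrow> 'a measure \<Rightarrow> ennreal" where
  "ipm H \<mu>1 \<mu>2 =
     (SUP h\<in>H. if integrable \<mu>1 h \<and> integrable \<mu>2 h
              then ennreal \<bar>(LINT x|\<mu>1. h x) - (LINT x|\<mu>2. h x)\<bar> else \<infinity>)"

definition d_W :: "'a::euclidean_space measure \<Rightarrow> 'a measure \<Rightarrow> ennreal" where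
  "d_W = ipm Lip1"

definition d_W_beta :: "real \<Rightarrow> 'a::euclidean_space measure \<Rightarrow> 'a measure \<Rightarrow> ennreal" where
  "d_W_beta \<beta> = ipm (H_class \<beta>)"

end

theory Submission
  imports Defs
begin

text \<open>
  Let \<open>X\<close> be Paretian and \<open>\<kappa> = 2 powr (-1 / \<alpha>)\<close>. The law of \<open>\<kappa> X\<close> outside the unit ball is half of the law of
  \<open>X\<close>, and inside the unit ball it is symmetric. Hence replacing one jump \<open>a X\<close> by two jumps \<open>\<kappa> a X\<close> changes the
  expectation of a test function only by second differences of it over jumps. Exchanging the \<open>n\<close>
  jumps of \<open>S\<^sub>n\<close> one at a time turns \<open>S\<^sub>n\<close> into \<open>S\<close> with index \<open>2n\<close>, and at each stage at least about half
  of the remaining jumps are available for smoothing: they make up for one of the two differences, which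
  then costs only \<open>min (norm x) 1\<close>. So \<open>S\<^sub>n\<close> and its double differ by a constant times
  \<open>n (E (min (norm (a X)) (norm (a X) powr \<beta>)))\<^sup>2 + n a\<^sup>2\<close>, and summing over \<open>n, 2n, 4n, \<dots>\<close> gives the rates; characteristic
  functions identify the limit. Symmetry of \<open>\<nu>\<close> makes all centerings vanish.

  The smoothing only uses that \<open>\<nu>\<close> is not carried by a hyperplane, which follows from the density
  of \<open>\<pi>\<close>: there are neighbourhoods of \<open>d\<close> linearly independent directions that \<open>\<nu>\<close> charges, a large jump in each of them occurs with
  high probability, and a fixed shift splits into shifts along the \<open>d\<close> jump directions, each of which is
  absorbed by the Pareto density of the corresponding radius.
\<close>

subsection \<open>Averaging operators\<close>

text \<open>In \<open>jump_law\<close> the law of \<open>X\<close> may be singular, and a single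
  jump absorbs only shifts along its own direction; one large jump near each of \<open>d\<close>
  directions is needed. Demanding all of them with a failure probability as small as
  \<open>n powr (-1 / \<alpha>)\<close> would lose a power of the logarithm. Instead the failure
  probability is kept at a small constant, and upon failure the other half of the jumps is used by
  induction. This gives the sharp factor \<open>n powr (-1 / \<alpha>)\<close>, the order of the
  jump size \<open>a\<close> in the normalised sum.

  Smoothing bounds a difference over \<open>x\<close> by a constant times \<open>norm x + a\<close>.

  Everything is phrased with convolution operators on bounded measurable functions and bounds
  uniform in the point, so that the operators commute with each other and with differences without
  integrability questions. Random variables and unbounded test functions enter only at the
  end.\<close>

definition fin_borel :: "'a::euclidean_space measure \<Rightarrow> bool" where
  "fin_borel \<kappa> \<longleftrightarrow> finite_measure \<kappa> \<and> sets \<kappa> = sets borel"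

definition bmf :: "('a::euclidean_space \<Rightarrow> real) \<Rightarrow> bool" where
  "bmf F \<longleftrightarrow> F \<in> borel_measurable borel \<and> (\<exists>B. \<forall>x. \<bar>F x\<bar> \<le> B)"

text \<open>The convolution operator of \<open>\<kappa>\<close>; its powers give the expectation of
  \<open>F\<close> at \<open>z\<close> plus independent \<open>\<kappa>\<close>-distributed jumps.
  \<open>fin_borel\<close> asks only for finite mass because conditioning is done by restricting
  \<open>\<kappa>\<close> without renormalising.\<close>

definition avg :: "'a::euclidean_space measure \<Rightarrow> ('a \<Rightarrow> real) \<Rightarrow> 'a \<Rightarrow> real" where
  "avg \<kappa> F z = (\<integral>y. F (z + y) \<partial>\<kappa>)"

definition shift_diff :: "'a::euclidean_space \<Rightarrow> ('a \<Rightarrow> real) \<Rightarrow> 'a \<Rightarrow> real" where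
  "shift_diff x F z = F (z + x) - F z"

lemma integral_abs_le_const:
  fixes f :: "'b \<Rightarrow> real"
  assumes "finite_measure \<kappa>" "0 \<le> c" "\<And>y. y \<in> space \<kappa> \<Longrightarrow> \<bar>f y\<bar> \<le> c"
  shows "\<bar>\<integral>y. f y \<partial>\<kappa>\<bar> \<le> c * measure \<kappa> (space \<kappa>)"
proof (cases "integrable \<kappa> f")
  case True
  interpret finite_measure \<kappa> by fact
  have "\<bar>\<integral>y. f y \<partial>\<kappa>\<bar> \<le> (\<integral>y. \<bar>f y\<bar> \<partial>\<kappa>)" by (rule integral_abs_bound)
  also have "\<dots> \<le> (\<integral>y. c \<partial>\<kappa>)"
    using True assms by (intro integral_mono) auto
  finally show ?thesis by (simp add: mult.commute)
next
  \<comment> \<open>A non-integrable function has Bochner integral 0, so the bound is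
    trivial.\<close>
  case False
  then show ?thesis using assms by (simp add: not_integrable_integral_eq)
qed

lemma fin_borelD:
  assumes "fin_borel \<kappa>"
  shows "finite_measure \<kappa>" "sets \<kappa> = sets borel" "space \<kappa> = UNIV"
  using assms sets_eq_imp_space_eq[of \<kappa> borel] unfolding fin_borel_def by auto

lemma bmf_integrable:
  assumes "fin_borel \<kappa>" "bmf F" shows "integrable \<kappa> F"
proof -
  interpret finite_measure \<kappa> using fin_borelD[OF assms(1)] by simp
  obtain B where "\<And>x. \<bar>F x\<bar> \<le> B" using assms(2) unfolding bmf_def by auto
  then show ?thesis using assms fin_borelD[OF assms(1)]
    by (intro integrable_const_bound[where B=B]) (auto simp: bmf_def cong: measurable_cong_sets)
qed

lemma bmf_shift: "bmf F \<Longrightarrow> bmf (\<lambda>z. F (z + x))"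
  unfolding bmf_def by auto

lemma bmf_shift': "bmf F \<Longrightarrow> bmf (\<lambda>z. F (x + z))"
  unfolding bmf_def by auto

lemma bmf_diff: "bmf F \<Longrightarrow> bmf G \<Longrightarrow> bmf (\<lambda>z. F z - G z)"
  unfolding bmf_def
proof safe
  fix B C assume "\<forall>x. \<bar>F x\<bar> \<le> B" "\<forall>x. \<bar>G x\<bar> \<le> C"
  then show "\<exists>B. \<forall>x. \<bar>F x - G x\<bar> \<le> B"
    by (intro exI[of _ "B + C"]) (metis abs_triangle_ineq4 add_mono order_trans)
qed auto

lemma bmf_add: "bmf F \<Longrightarrow> bmf G \<Longrightarrow> bmf (\<lambda>z. F z + G z)"
  unfolding bmf_def
proof safe
  fix B C assume "\<forall>x. \<bar>F x\<bar> \<le> B" "\<forall>x. \<bar>G x\<bar> \<le> C"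
  then show "\<exists>B. \<forall>x. \<bar>F x + G x\<bar> \<le> B"
    by (intro exI[of _ "B + C"]) (metis abs_triangle_ineq add_mono order_trans)
qed auto

lemma bmf_shift_diff: "bmf F \<Longrightarrow> bmf (shift_diff x F)"
  unfolding shift_diff_def[abs_def] by (intro bmf_diff bmf_shift)

lemma avg_abs_le:
  assumes "fin_borel \<kappa>" "0 \<le> c" "\<And>y. \<bar>F y\<bar> \<le> c"
  shows "\<bar>avg \<kappa> F z\<bar> \<le> c * measure \<kappa> UNIV"
  using integral_abs_le_const[of \<kappa> c "\<lambda>y. F (z + y)"] assms fin_borelD[OF assms(1)]
  unfolding avg_def by auto

lemma bmf_avg:
  assumes "fin_borel \<kappa>" "bmf F" shows "bmf (avg \<kappa> F)"
proof -
  interpret finite_measure \<kappa> using fin_borelD[OF assms(1)] by simp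
  have [measurable]: "F \<in> borel_measurable borel" using assms unfolding bmf_def by simp
  have [measurable_cong]: "sets \<kappa> = sets borel" using fin_borelD[OF assms(1)] by simp
  obtain B where B: "\<And>x. \<bar>F x\<bar> \<le> B" using assms(2) unfolding bmf_def by auto
  then have "0 \<le> B" by (meson abs_ge_zero order_trans)
  then have "\<And>z. \<bar>avg \<kappa> F z\<bar> \<le> B * measure \<kappa> UNIV" using avg_abs_le[OF assms(1)] B by blast
  moreover have "avg \<kappa> F \<in> borel_measurable borel"
    unfolding avg_def[abs_def] by measurable
  ultimately show ?thesis unfolding bmf_def by blast
qed

lemma avg_add:
  assumes "fin_borel \<kappa>" "bmf F" "bmf G"
  shows "avg \<kappa> (\<lambda>z. F z + G z) = (\<lambda>z. avg \<kappa> F z + avg \<kappa> G z)"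
  unfolding avg_def[abs_def] using assms
  by (intro ext Bochner_Integration.integral_add bmf_integrable bmf_shift')

lemma avg_diff:
  assumes "fin_borel \<kappa>" "bmf F" "bmf G"
  shows "avg \<kappa> (\<lambda>z. F z - G z) = (\<lambda>z. avg \<kappa> F z - avg \<kappa> G z)"
  unfolding avg_def[abs_def] using assms
  by (intro ext Bochner_Integration.integral_diff bmf_integrable bmf_shift')

lemma avg_shift: "avg \<kappa> (\<lambda>z. F (z + x)) = (\<lambda>z. avg \<kappa> F (z + x))"
  unfolding avg_def by (simp add: ac_simps)

lemma avg_shift_diff:
  assumes "fin_borel \<kappa>" "bmf F"
  shows "avg \<kappa> (shift_diff x F) = shift_diff x (avg \<kappa> F)"
  unfolding shift_diff_def[abs_def] using assms by (simp add: avg_diff bmf_shift avg_shift)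

text \<open>Vector addition commutes and \<open>F\<close> is bounded, so Fubini applies. This is
  used throughout to move a jump next to the difference that it has to absorb.\<close>

lemma avg_comm:
  assumes k: "fin_borel \<kappa>" and l: "fin_borel \<mu>" and F: "bmf F"
  shows "avg \<kappa> (avg \<mu> F) = avg \<mu> (avg \<kappa> F)"
proof
  fix z
  interpret k: finite_measure \<kappa> using fin_borelD[OF k] by simp
  interpret l: finite_measure \<mu> using fin_borelD[OF l] by simp
  interpret pair_sigma_finite \<kappa> \<mu> ..
  interpret P: finite_measure "\<kappa> \<Otimes>\<^sub>M \<mu>" by (rule finite_measure_pair_measure) unfold_locales
  have [measurable]: "F \<in> borel_measurable borel" using F unfolding bmf_def by simp
  have [measurable_cong]: "sets \<kappa> = sets borel" "sets \<mu> = sets borel"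
    using fin_borelD[OF k] fin_borelD[OF l] by simp_all
  obtain B where B: "\<And>x. \<bar>F x\<bar> \<le> B" using F unfolding bmf_def by auto
  have "integrable (\<kappa> \<Otimes>\<^sub>M \<mu>) (\<lambda>(x, y). F (z + x + y))"
    using B by (intro P.integrable_const_bound[where B=B]) auto
  from Fubini_integral[OF this] show "avg \<kappa> (avg \<mu> F) z = avg \<mu> (avg \<kappa> F) z"
    unfolding avg_def by (simp add: ac_simps)
qed

lemma fin_borel_density:
  assumes "fin_borel \<kappa>" "W \<in> sets borel"
  shows "fin_borel (density \<kappa> (indicator W))"
    "measure (density \<kappa> (indicator W)) UNIV = measure \<kappa> W"
proof -
  interpret finite_measure \<kappa> using fin_borelD[OF assms(1)] by simp
  have *: "emeasure (density \<kappa> (indicator W)) UNIV = emeasure \<kappa> W"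
    using assms fin_borelD[OF assms(1)] by (subst emeasure_density) (auto simp: nn_integral_indicator)
  then show "measure (density \<kappa> (indicator W)) UNIV = measure \<kappa> W" by (simp add: measure_def)
  show "fin_borel (density \<kappa> (indicator W))"
    unfolding fin_borel_def using * fin_borelD[OF assms(1)]
    by (auto intro!: finite_measureI)
qed

text \<open>Conditioning on whether the jump lies in \<open>W\<close>; the masses of the two
  restricted measures carry the probabilities of the two events.\<close>

lemma avg_split:
  assumes k: "fin_borel \<kappa>" and W: "W \<in> sets borel" and F: "bmf F"
  shows "avg \<kappa> F = (\<lambda>z. avg (density \<kappa> (indicator W)) F z + avg (density \<kappa> (indicator (- W))) F z)"
proof
  fix z
  have [measurable]: "F \<in> borel_measurable borel" using F unfolding bmf_def by simp
  have [measurable_cong]: "sets \<kappa> = sets borel"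
    using fin_borelD[OF k] by simp_all
  have i: "integrable \<kappa> (\<lambda>y. F (z + y))" using k F by (intro bmf_integrable bmf_shift')
  have d: "avg (density \<kappa> (indicator V)) F z = (\<integral>y. indicator V y * F (z + y) \<partial>\<kappa>)"
    if [measurable]: "V \<in> sets borel" for V
  proof -
    have "density \<kappa> (indicator V) = density \<kappa> (\<lambda>x. ennreal (indicator V x))"
      by (simp add: ennreal_indicator)
    then show ?thesis unfolding avg_def by (simp add: integral_density)
  qed
  have "(\<integral>y. F (z + y) \<partial>\<kappa>) = (\<integral>y. indicator W y * F (z + y) + indicator (- W) y * F (z + y) \<partial>\<kappa>)"
    by (intro Bochner_Integration.integral_cong) (auto simp: indicator_def)
  also have "\<dots> = (\<integral>y. indicator W y * F (z + y) \<partial>\<kappa>) + (\<integral>y. indicator (- W) y * F (z + y) \<partial>\<kappa>)"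
    using i W fin_borelD[OF k]
    by (intro Bochner_Integration.integral_add) (auto intro!: integrable_mult_indicator[where 'b=real, simplified])
  finally show "avg \<kappa> F z = avg (density \<kappa> (indicator W)) F z + avg (density \<kappa> (indicator (- W))) F z"
    using W by (simp add: d) (simp add: avg_def)
qed

lemma avg_pow:
  assumes "fin_borel \<kappa>" "bmf F"
  shows "bmf ((avg \<kappa> ^^ m) F)"
    "(avg \<kappa> ^^ m) (shift_diff x F) = shift_diff x ((avg \<kappa> ^^ m) F)"
    "fin_borel \<mu> \<Longrightarrow> (avg \<kappa> ^^ m) (avg \<mu> F) = avg \<mu> ((avg \<kappa> ^^ m) F)"
proof -
  show *: "bmf ((avg \<kappa> ^^ m) F)" for m
    by (induction m) (auto simp: assms bmf_avg)
  show "(avg \<kappa> ^^ m) (shift_diff x F) = shift_diff x ((avg \<kappa> ^^ m) F)"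
    by (induction m) (auto simp: assms * avg_shift_diff)
  show "fin_borel \<mu> \<Longrightarrow> (avg \<kappa> ^^ m) (avg \<mu> F) = avg \<mu> ((avg \<kappa> ^^ m) F)"
    by (induction m) (auto simp: assms * avg_comm)
qed

lemma avg_pow_comm:
  assumes "fin_borel \<kappa>" "fin_borel \<mu>" "bmf F"
  shows "(avg \<kappa> ^^ m) ((avg \<mu> ^^ n) F) = (avg \<mu> ^^ n) ((avg \<kappa> ^^ m) F)"
  by (induction n) (auto simp: assms avg_pow)

lemma avg_pow_add:
  assumes "fin_borel \<kappa>" "bmf F" "bmf G"
  shows "(avg \<kappa> ^^ m) (\<lambda>z. F z + G z) = (\<lambda>z. (avg \<kappa> ^^ m) F z + (avg \<kappa> ^^ m) G z)"
  by (induction m) (auto simp: assms avg_pow avg_add)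

lemma avg_pow_abs_le:
  assumes "fin_borel \<kappa>" "measure \<kappa> UNIV = 1" "0 \<le> c" "\<And>y. \<bar>F y\<bar> \<le> c"
  shows "\<bar>(avg \<kappa> ^^ m) F z\<bar> \<le> c"
  using assms(4)
proof (induction m arbitrary: z)
  case (Suc m)
  show ?case using avg_abs_le[OF assms(1,3), of "(avg \<kappa> ^^ m) F" z] Suc assms(2) by simp
qed simp

text \<open>Conditioning on the first of \<open>l\<close> jumps that falls into \<open>W\<close> gives the geometric series.\<close>

lemma avg_pow_le_first_hit:
  assumes k: "fin_borel \<kappa>" "measure \<kappa> UNIV = 1" and W: "W \<in> sets borel" and g: "measure \<kappa> W = g" "0 < g" "g \<le> 1"
    and F: "bmf F" "\<And>z. \<bar>F z\<bar> \<le> c0" "0 \<le> c0"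
    and c: "\<And>z. \<bar>(avg \<kappa> ^^ r) (avg (density \<kappa> (indicator W)) F) z\<bar> \<le> c" "0 \<le> c"
  shows "\<bar>(avg \<kappa> ^^ (r + l)) F z\<bar> \<le> c / g + (1 - g) ^ l * c0"
proof -
  interpret prob_space \<kappa> using fin_borelD[OF k(1)] k(2)
    by (intro prob_spaceI) (simp add: finite_measure.emeasure_eq_measure)
  let ?G = "density \<kappa> (indicator W)" and ?B = "density \<kappa> (indicator (- W))"
  have G: "fin_borel ?G" using k W by (intro fin_borel_density)
  have B: "fin_borel ?B" using k W by (intro fin_borel_density) auto
  have mB: "measure ?B UNIV = 1 - g"
    using fin_borel_density(2)[OF k(1), of "- W"] W g fin_borelD[OF k(1)] prob_compl[of W]
    by (auto simp: Compl_eq_Diff_UNIV)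
  have "\<bar>(avg \<kappa> ^^ (r + l)) F z\<bar> \<le> c * (\<Sum>j<l. (1 - g) ^ j) + (1 - g) ^ l * c0"
    using F c
  proof (induction l arbitrary: F c c0 z)
    case 0
    then show ?case using avg_pow_abs_le[OF k] by auto
  next
    case (Suc l)
    note F = Suc.prems(1)
    have "\<bar>(avg \<kappa> ^^ l) ((avg \<kappa> ^^ r) (avg ?G F)) z\<bar> \<le> c"
      by (rule avg_pow_abs_le[OF k Suc.prems(5,4)])
    then have 1: "\<bar>(avg \<kappa> ^^ (r + l)) (avg ?G F) z\<bar> \<le> c"
      by (simp add: funpow_add add.commute)
    \<comment> \<open>When the jump misses \<open>W\<close>, the hypotheses hold for
      \<open>avg ?B F\<close> with both \<open>c\<close> and \<open>c0\<close> multiplied by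
      \<open>1 - g\<close>; hence the generalisation over \<open>F\<close>, \<open>c\<close> and
      \<open>c0\<close> in the induction.\<close>
    have "\<bar>avg ?B F y\<bar> \<le> (1 - g) * c0" for y
      using avg_abs_le[OF B, of c0 F y] Suc.prems mB by (simp add: mult.commute)
    moreover have "\<bar>(avg \<kappa> ^^ r) (avg ?G (avg ?B F)) y\<bar> \<le> (1 - g) * c" for y
      using avg_abs_le[OF B, of c "(avg \<kappa> ^^ r) (avg ?G F)" y] Suc.prems mB
      by (simp add: avg_comm[OF G B F] avg_pow(3)[OF k(1) bmf_avg[OF G F] B] mult.commute)
    ultimately have 2: "\<bar>(avg \<kappa> ^^ (r + l)) (avg ?B F) z\<bar>
        \<le> (1 - g) * c * (\<Sum>j<l. (1 - g) ^ j) + (1 - g) ^ l * ((1 - g) * c0)"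
      using g Suc.prems by (intro Suc.IH bmf_avg B F) auto
    have "(avg \<kappa> ^^ (r + Suc l)) F = (avg \<kappa> ^^ (r + l)) (avg \<kappa> F)"
      by (simp add: funpow_swap1)
    also have "\<dots> = (\<lambda>z. (avg \<kappa> ^^ (r + l)) (avg ?G F) z + (avg \<kappa> ^^ (r + l)) (avg ?B F) z)"
      by (subst avg_split[OF k(1) W F]) (intro avg_pow_add k bmf_avg G B F)
    finally have "\<bar>(avg \<kappa> ^^ (r + Suc l)) F z\<bar>
        \<le> c + ((1 - g) * c * (\<Sum>j<l. (1 - g) ^ j) + (1 - g) ^ l * ((1 - g) * c0))"
      using 1 2 by (smt (verit))
    also have "\<dots> = c * (\<Sum>j<Suc l. (1 - g) ^ j) + (1 - g) ^ Suc l * c0"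
      by (subst sum.lessThan_Suc_shift) (simp add: algebra_simps sum_distrib_left)
    finally show ?case .
  qed
  also have "(\<Sum>j<l. (1 - g) ^ j) = (1 - (1 - g) ^ l) / g"
    using g by (subst sum_gp_strict) auto
  \<comment> \<open>\<open>c\<close> bounds an average over the restricted measure of mass
    \<open>g\<close>, so \<open>c / g\<close> is the bound conditional on a hit.\<close>
  also have "c * ((1 - (1 - g) ^ l) / g) \<le> c / g"
    using g c(2) by (simp add: field_simps mult_left_le)
  finally show ?thesis by simp
qed

lemma foldr_avg:
  assumes "\<And>\<kappa>. \<kappa> \<in> set \<kappa>s \<Longrightarrow> fin_borel \<kappa>" "bmf F"
  shows "bmf (foldr avg \<kappa>s F)"
    "fin_borel \<mu> \<Longrightarrow> foldr avg \<kappa>s (avg \<mu> F) = avg \<mu> (foldr avg \<kappa>s F)"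
    "bmf G \<Longrightarrow> foldr avg \<kappa>s (\<lambda>z. F z + G z) = (\<lambda>z. foldr avg \<kappa>s F z + foldr avg \<kappa>s G z)"
proof -
  have *: "bmf (foldr avg \<kappa>s F)" if "\<And>\<kappa>. \<kappa> \<in> set \<kappa>s \<Longrightarrow> fin_borel \<kappa>" "bmf F" for \<kappa>s F
    using that by (induction \<kappa>s) (auto simp: bmf_avg)
  show "bmf (foldr avg \<kappa>s F)" using * assms by blast
  show "fin_borel \<mu> \<Longrightarrow> foldr avg \<kappa>s (avg \<mu> F) = avg \<mu> (foldr avg \<kappa>s F)"
    using assms by (induction \<kappa>s) (auto simp: avg_comm *)
  show "bmf G \<Longrightarrow> foldr avg \<kappa>s (\<lambda>z. F z + G z) = (\<lambda>z. foldr avg \<kappa>s F z + foldr avg \<kappa>s G z)"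
    using assms by (induction \<kappa>s) (auto simp: avg_add *)
qed

lemma foldr_avg_abs_le:
  assumes "\<And>\<kappa>. \<kappa> \<in> set \<kappa>s \<Longrightarrow> fin_borel \<kappa> \<and> measure \<kappa> UNIV = q" "0 \<le> q" "0 \<le> c" "\<And>y. \<bar>F y\<bar> \<le> c"
  shows "\<bar>foldr avg \<kappa>s F z\<bar> \<le> q ^ length \<kappa>s * c"
  using assms(1)
proof (induction \<kappa>s arbitrary: z)
  case (Cons \<kappa> \<kappa>s)
  have "\<bar>avg \<kappa> (foldr avg \<kappa>s F) z\<bar> \<le> (q ^ length \<kappa>s * c) * measure \<kappa> UNIV"
    using Cons assms(2,3) by (intro avg_abs_le) auto
  then show ?case using Cons.prems by (simp add: ac_simps)
qed (use assms in auto)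

subsection \<open>Pareto jumps in a fixed direction\<close>

text \<open>Not normalised: for \<open>m \<ge> 1\<close> this is the Pareto law restricted to radii
  at least \<open>m\<close>, and its mass \<open>m powr - \<alpha>\<close> is the probability of
  such a radius.\<close>

definition pareto :: "real \<Rightarrow> real \<Rightarrow> real measure" where
  "pareto \<alpha> m = density lborel (\<lambda>u. ennreal (\<alpha> * u powr (-1 - \<alpha>) * indicator {m..} u))"

lemma has_integral_pareto:
  assumes "0 < \<alpha>" "0 < m"
  shows "has_bochner_integral lborel (\<lambda>u::real. \<alpha> * u powr (-1 - \<alpha>) * indicator {m..} u) (m powr - \<alpha>)"
proof (rule has_bochner_integral_nn_integral)
  have e: "- \<alpha> - 1 = - 1 - \<alpha>" by simp
  have "(\<integral>\<^sup>+u. ennreal (\<alpha> * u powr (-1 - \<alpha>) * indicator {m..} u) \<partial>lborel)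
      = (\<integral>\<^sup>+u. ennreal (\<alpha> * u powr (-1 - \<alpha>)) * indicator {m..} u \<partial>lborel)"
    by (intro nn_integral_cong) (auto simp: indicator_def)
  also have "\<dots> = ennreal (0 - (- (m powr - \<alpha>)))"
  proof (rule nn_integral_FTC_atLeast[where F="\<lambda>u. - (u powr - \<alpha>)"])
    show "((\<lambda>u. - (u powr - \<alpha>)) \<longlongrightarrow> 0) at_top"
      using tendsto_minus[OF tendsto_neg_powr[of "-\<alpha>" "\<lambda>x::real. x" at_top]] assms
      by (simp add: filterlim_ident)
    fix x assume "m \<le> x"
    then show "((\<lambda>u. - (u powr - \<alpha>)) has_real_derivative \<alpha> * x powr (-1 - \<alpha>)) (at x)"
      using assms by (auto intro!: derivative_eq_intros simp: e)
  qed (use assms in auto)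
  finally show "(\<integral>\<^sup>+u. ennreal (\<alpha> * u powr (-1 - \<alpha>) * indicator {m..} u) \<partial>lborel) = ennreal (m powr - \<alpha>)"
    by simp
qed (use assms in auto)

lemma pareto_fin_borel:
  assumes "0 < \<alpha>" "0 < m"
  shows "fin_borel (pareto \<alpha> m)" "measure (pareto \<alpha> m) UNIV = m powr - \<alpha>"
proof -
  have "emeasure (pareto \<alpha> m) UNIV = (\<integral>\<^sup>+u. ennreal (\<alpha> * u powr (-1 - \<alpha>) * indicator {m..} u) \<partial>lborel)"
    unfolding pareto_def by (subst emeasure_density) auto
  also have "\<dots> = ennreal (m powr - \<alpha>)"
    using has_integral_pareto[OF assms] assms
    by (subst nn_integral_eq_integral) (auto simp: has_bochner_integral_iff)
  finally have *: "emeasure (pareto \<alpha> m) UNIV = ennreal (m powr - \<alpha>)" .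
  then show "measure (pareto \<alpha> m) UNIV = m powr - \<alpha>" by (simp add: measure_def)
  show "fin_borel (pareto \<alpha> m)" using * unfolding fin_borel_def
    by (auto simp: pareto_def intro!: finite_measureI)
qed

lemma integral_pareto:
  assumes "0 < \<alpha>" and [measurable]: "f \<in> borel_measurable borel"
  shows "(\<integral>u. f u \<partial>pareto \<alpha> m) = (\<integral>u. \<alpha> * u powr (-1 - \<alpha>) * indicator {m..} u * f u \<partial>lborel)"
  unfolding pareto_def using assms by (subst integral_density) auto

text \<open>The shift is moved from \<open>G\<close> to the density. As the density decreases on its
  support, its L1 distance to its translate by \<open>c\<close> is twice the mass of
  \<open>{m..m + c}\<close>, and this mass is at most \<open>c\<close> times the density at
  \<open>m\<close>.\<close>

lemma pareto_shift_diff_nonneg: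
  assumes a: "0 < \<alpha>" "0 < m" and G: "bmf G" "\<And>u. \<bar>G u\<bar> \<le> B" and c: "0 \<le> (c::real)"
  shows "\<bar>\<integral>u. G (u + c) - G u \<partial>pareto \<alpha> m\<bar> \<le> 2 * \<alpha> * m powr (-1 - \<alpha>) * c * B"
proof -
  have [measurable]: "G \<in> borel_measurable borel" using G unfolding bmf_def by simp
  have B0: "0 \<le> B" using G(2)[of 0] by linarith
  let ?r = "\<lambda>u::real. \<alpha> * u powr (-1 - \<alpha>)"
  have I: "integrable lborel (\<lambda>u. ?r u * indicator {m..} u)" if "0 < m" for m
    using has_integral_pareto[OF a(1) that] by (auto simp: has_bochner_integral_iff)
  have V: "(\<integral>u. ?r u * indicator {m..} u \<partial>lborel) = m powr - \<alpha>" if "0 < m" for m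
    using has_integral_pareto[OF a(1) that] by (auto simp: has_bochner_integral_iff)
  have Ic: "integrable lborel (\<lambda>v. ?r (v - c) * indicator {m..} (v - c))"
    using lborel_integrable_real_affine[OF I[OF a(2)], of 1 "-c"] by (simp add: add.commute)
  have Vc: "(\<integral>v. ?r (v - c) * indicator {m..} (v - c) \<partial>lborel) = m powr - \<alpha>"
    using lborel_integral_real_affine[of 1 "\<lambda>u. ?r u * indicator {m..} u" "-c"] V[OF a(2)]
    by (simp add: add.commute)
  let ?p = "\<lambda>v. ?r (v - c) * indicator {m..} (v - c) - ?r v * indicator {m..} v"
  \<comment> \<open>Between \<open>m\<close> and \<open>m + c\<close> only the unshifted density is
    present; beyond \<open>m + c\<close> the shifted one is the larger.\<close>
  have abs_p: "\<bar>?p v\<bar> = ?r (v - c) * indicator {m..} (v - c) + ?r v * indicator {m..} v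
      - 2 * (?r v * indicator {m + c..} v)" for v
  proof -
    have "?r v \<le> ?r (v - c)" if "m \<le> v - c"
      using that a c by (intro mult_left_mono powr_mono2') auto
    moreover have "0 \<le> ?r v" using a by simp
    ultimately show ?thesis using c by (auto simp: indicator_def)
  qed
  have bd: "integrable lborel (\<lambda>v. f v * G v)" if "integrable lborel f" for f
  proof (rule Bochner_Integration.integrable_bound)
    show "integrable lborel (\<lambda>v. B * f v)" using that by simp
    show "AE v in lborel. norm (f v * G v) \<le> norm (B * f v)"
      using G(2) B0 by (auto simp: abs_mult mult.commute intro!: mult_right_mono)
    have "f \<in> borel_measurable lborel" using that by simp
    then show "(\<lambda>v. f v * G v) \<in> borel_measurable lborel" by measurable
  qed
  have "(\<integral>u. G (u + c) - G u \<partial>pareto \<alpha> m) = (\<integral>u. G (u + c) \<partial>pareto \<alpha> m) - (\<integral>u. G u \<partial>pareto \<alpha> m)"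
    using pareto_fin_borel[OF a] G by (intro Bochner_Integration.integral_diff bmf_integrable bmf_shift) auto
  also have "(\<integral>u. G (u + c) \<partial>pareto \<alpha> m) = (\<integral>u. ?r u * indicator {m..} u * G (u + c) \<partial>lborel)"
    using a by (subst integral_pareto) auto
  also have "\<dots> = (\<integral>v. ?r (v - c) * indicator {m..} (v - c) * G v \<partial>lborel)"
    by (subst lborel_integral_real_affine[of 1 _ "-c"]) (simp_all add: add.commute)
  also have "(\<integral>u. G u \<partial>pareto \<alpha> m) = (\<integral>v. ?r v * indicator {m..} v * G v \<partial>lborel)"
    using a by (subst integral_pareto) auto
  also have "(\<integral>v. ?r (v - c) * indicator {m..} (v - c) * G v \<partial>lborel) - (\<integral>v. ?r v * indicator {m..} v * G v \<partial>lborel)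
     = (\<integral>v. ?p v * G v \<partial>lborel)"
    by (subst Bochner_Integration.integral_diff[symmetric, OF bd[OF Ic] bd[OF I[OF a(2)]]]) (simp add: algebra_simps)
  finally have "\<bar>\<integral>u. G (u + c) - G u \<partial>pareto \<alpha> m\<bar> \<le> (\<integral>v. \<bar>?p v * G v\<bar> \<partial>lborel)"
    by (simp add: integral_abs_bound)
  also have "\<dots> \<le> (\<integral>v. \<bar>?p v\<bar> * B \<partial>lborel)"
    using G(2) by (intro integral_mono integrable_abs bd integrable_mult_left Bochner_Integration.integrable_diff I Ic a)
      (auto simp: abs_mult intro!: mult_left_mono)
  also have "\<dots> = (m powr - \<alpha> + m powr - \<alpha> - 2 * (m + c) powr - \<alpha>) * B"
  proof -
    have "(\<integral>v. \<bar>?p v\<bar> \<partial>lborel) = m powr - \<alpha> + m powr - \<alpha> - 2 * (m + c) powr - \<alpha>"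
      unfolding abs_p using I[OF a(2)] Ic I[of "m + c"] a c
      by (simp add: V Vc del: mult.assoc)
    then show ?thesis by simp
  qed
  also have "m powr - \<alpha> - (m + c) powr - \<alpha> \<le> c * (\<alpha> * m powr (-1 - \<alpha>))"
  proof (cases "c = 0")
    case False
    then have "m < m + c" using c by simp
    moreover have "((\<lambda>u. u powr - \<alpha>) has_real_derivative - \<alpha> * x powr (-1 - \<alpha>)) (at x)" if "m \<le> x" for x
    proof -
      have e: "- \<alpha> - 1 = - 1 - \<alpha>" by simp
      show ?thesis using that a by (auto intro!: derivative_eq_intros simp: e)
    qed
    ultimately obtain z where z: "m < z" "(m + c) powr - \<alpha> - m powr - \<alpha> = (m + c - m) * (- \<alpha> * z powr (-1 - \<alpha>))"
      using MVT2[of m "m + c" "\<lambda>u. u powr - \<alpha>" "\<lambda>u. - \<alpha> * u powr (-1 - \<alpha>)"] by blast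
    have "z powr (-1 - \<alpha>) \<le> m powr (-1 - \<alpha>)" using z a by (intro powr_mono2') auto
    then have "c * (\<alpha> * z powr (-1 - \<alpha>)) \<le> c * (\<alpha> * m powr (-1 - \<alpha>))"
      using c a by (intro mult_left_mono) auto
    then show ?thesis using z by simp
  qed simp
  then have "(m powr - \<alpha> + m powr - \<alpha> - 2 * (m + c) powr - \<alpha>) * B \<le> (2 * (c * (\<alpha> * m powr (-1 - \<alpha>)))) * B"
    using B0 by (intro mult_right_mono) auto
  finally show ?thesis by (simp add: algebra_simps)
qed

lemma pareto_shift_diff:
  assumes a: "0 < \<alpha>" "0 < m" and G: "bmf G" "\<And>u. \<bar>G u\<bar> \<le> B"
  shows "\<bar>\<integral>u. G (u + c) - G u \<partial>pareto \<alpha> m\<bar> \<le> 2 * \<alpha> * m powr (-1 - \<alpha>) * \<bar>c\<bar> * B"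
proof (cases "0 \<le> c")
  case True
  then show ?thesis using pareto_shift_diff_nonneg[OF a G True] by simp
next
  case False
  \<comment> \<open>A negative shift is undone by the opposite positive shift of the translated
    function.\<close>
  have "(\<integral>u. G (u + c) - G u \<partial>pareto \<alpha> m) = - (\<integral>u. G (u + - c + c) - G (u + c) \<partial>pareto \<alpha> m)"
    by (subst Bochner_Integration.integral_minus[symmetric]) simp
  moreover have "\<bar>\<integral>u. G (u + - c + c) - G (u + c) \<partial>pareto \<alpha> m\<bar> \<le> 2 * \<alpha> * m powr (-1 - \<alpha>) * (- c) * B"
    using pareto_shift_diff_nonneg[OF a bmf_shift[OF G(1), of c], of B "- c"] G(2) False by simp
  ultimately show ?thesis using False by simp
qed

definition radial :: "real \<Rightarrow> real \<Rightarrow> 'a::euclidean_space \<Rightarrow> 'a measure" where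
  "radial \<alpha> m \<theta> = distr (pareto \<alpha> m) borel (\<lambda>u. u *\<^sub>R \<theta>)"

lemma radial_fin_borel:
  assumes "0 < \<alpha>" "0 < m"
  shows "fin_borel (radial \<alpha> m \<theta>)" "measure (radial \<alpha> m \<theta>) UNIV = m powr - \<alpha>"
proof -
  note p = pareto_fin_borel[OF assms] fin_borelD[OF pareto_fin_borel(1)[OF assms]]
  have [measurable]: "(\<lambda>u. u *\<^sub>R \<theta>) \<in> pareto \<alpha> m \<rightarrow>\<^sub>M borel"
    using p by (simp cong: measurable_cong_sets)
  show "fin_borel (radial \<alpha> m \<theta>)"
    unfolding radial_def fin_borel_def using p by (auto intro!: finite_measure.finite_measure_distr)
  show "measure (radial \<alpha> m \<theta>) UNIV = m powr - \<alpha>"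
    unfolding radial_def using p by (subst measure_distr) auto
qed

lemma avg_radial:
  assumes "bmf F" "0 < \<alpha>" "0 < m"
  shows "avg (radial \<alpha> m \<theta>) F z = (\<integral>u. F (z + u *\<^sub>R \<theta>) \<partial>pareto \<alpha> m)"
proof -
  have [measurable]: "F \<in> borel_measurable borel" using assms unfolding bmf_def by simp
  have [measurable]: "(\<lambda>u. u *\<^sub>R \<theta>) \<in> pareto \<alpha> m \<rightarrow>\<^sub>M borel"
    using fin_borelD[OF pareto_fin_borel(1)[OF assms(2,3)]] by (simp cong: measurable_cong_sets)
  show ?thesis unfolding avg_def radial_def by (subst integral_distr) auto
qed

lemma radial_shift_diff:
  assumes a: "0 < \<alpha>" "0 < m" and F: "bmf F" "\<And>u. \<bar>F u\<bar> \<le> B"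
  shows "\<bar>avg (radial \<alpha> m \<theta>) (shift_diff (c *\<^sub>R \<theta>) F) z\<bar> \<le> 2 * \<alpha> * m powr (-1 - \<alpha>) * \<bar>c\<bar> * B"
proof -
  have "bmf (\<lambda>u. F (z + u *\<^sub>R \<theta>))" using F unfolding bmf_def by auto
  from pareto_shift_diff[OF a this, of B c] F show ?thesis
    by (simp add: avg_radial bmf_shift_diff a) (simp add: shift_diff_def algebra_simps)
qed

text \<open>A shift by a combination of the directions telescopes into shifts along single
  directions. Each of these is absorbed by the radial jump in its own direction, while the other
  jumps contribute only their masses \<open>m powr - \<alpha>\<close>.\<close>

lemma radials_shift_diff:
  fixes ps :: "(real \<times> 'a::euclidean_space) list"
  assumes a: "0 < \<alpha>" "0 < m" and F: "bmf F" "\<And>u. \<bar>F u\<bar> \<le> B"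
  shows "\<bar>foldr avg (map (\<lambda>p. radial \<alpha> m (snd p)) ps) (shift_diff (\<Sum>p\<leftarrow>ps. fst p *\<^sub>R snd p) F) z\<bar>
     \<le> (\<Sum>p\<leftarrow>ps. \<bar>fst p\<bar>) * (2 * \<alpha> / m) * (m powr - \<alpha>) ^ length ps * B"
  using F
proof (induction ps arbitrary: F z)
  case Nil
  then show ?case by (simp add: shift_diff_def)
next
  case (Cons p ps)
  note F = Cons.prems
  have B0: "0 \<le> B" using F(2)[of 0] by linarith
  let ?R = "radial \<alpha> m (snd p)" and ?Rs = "map (\<lambda>p. radial \<alpha> m (snd p)) ps"
  define y where "y = (\<Sum>p\<leftarrow>ps. fst p *\<^sub>R snd p)"
  define x where "x = fst p *\<^sub>R snd p"
  define q where "q = m powr - \<alpha>"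
  have q0: "0 \<le> q" by (simp add: q_def)
  have Rs: "fin_borel \<kappa> \<and> measure \<kappa> UNIV = q" if "\<kappa> \<in> set ?Rs" for \<kappa>
    using that radial_fin_borel[OF a] by (auto simp: q_def)
  have R: "fin_borel ?R" "measure ?R UNIV = q" using radial_fin_borel[OF a] by (auto simp: q_def)
  define F' where "F' = (\<lambda>z. F (z + y))"
  have F': "bmf F'" "\<And>u. \<bar>F' u\<bar> \<le> B" using F by (auto simp: F'_def bmf_shift)
  have b1: "bmf (shift_diff x F')" and b2: "bmf (shift_diff y F)" using F F' by (auto intro: bmf_shift_diff)
  have *: "shift_diff (x + y) F = (\<lambda>z. shift_diff x F' z + shift_diff y F z)"
    by (auto simp: shift_diff_def F'_def ac_simps)
  have "foldr avg (?R # ?Rs) (shift_diff (x + y) F) z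
      = avg ?R (foldr avg ?Rs (shift_diff x F')) z + avg ?R (foldr avg ?Rs (shift_diff y F)) z"
    using foldr_avg(3)[of ?Rs, OF _ b1 b2] foldr_avg(1)[of ?Rs, OF _ b1] foldr_avg(1)[of ?Rs, OF _ b2] Rs
    by (simp add: * avg_add[OF R(1)])
  also have "avg ?R (foldr avg ?Rs (shift_diff x F')) z = foldr avg ?Rs (avg ?R (shift_diff x F')) z"
    using foldr_avg(2)[of ?Rs, OF _ b1 R(1)] Rs by metis
  finally have eq: "foldr avg (?R # ?Rs) (shift_diff (x + y) F) z
     = foldr avg ?Rs (avg ?R (shift_diff x F')) z + avg ?R (foldr avg ?Rs (shift_diff y F)) z" .
  have 1: "\<bar>foldr avg ?Rs (avg ?R (shift_diff x F')) z\<bar>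
      \<le> q ^ length ?Rs * (2 * \<alpha> * m powr (-1 - \<alpha>) * \<bar>fst p\<bar> * B)"
    using Rs q0 B0 a radial_shift_diff[OF a F'] unfolding x_def
    by (intro foldr_avg_abs_le) auto
  have s0: "0 \<le> (\<Sum>p\<leftarrow>ps. \<bar>fst p\<bar>)" by (rule sum_list_nonneg) auto
  have 2: "\<bar>avg ?R (foldr avg ?Rs (shift_diff y F)) z\<bar>
      \<le> ((\<Sum>p\<leftarrow>ps. \<bar>fst p\<bar>) * (2 * \<alpha> / m) * q ^ length ps * B) * measure ?R UNIV"
    using Cons.IH[OF F] a B0 s0 unfolding y_def q_def
    by (intro avg_abs_le radial_fin_borel mult_nonneg_nonneg) auto
  \<comment> \<open>Relative to its mass \<open>q\<close>, a radial jump beyond \<open>m\<close>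
    absorbs a shift at a cost of order \<open>1 / m\<close>.\<close>
  have m: "m powr (-1 - \<alpha>) = q / m" using a by (simp add: q_def powr_diff powr_minus field_simps)
  have "\<bar>foldr avg (?R # ?Rs) (shift_diff (x + y) F) z\<bar>
    \<le> q ^ length ?Rs * (2 * \<alpha> * m powr (-1 - \<alpha>) * \<bar>fst p\<bar> * B) +
      ((\<Sum>p\<leftarrow>ps. \<bar>fst p\<bar>) * (2 * \<alpha> / m) * q ^ length ps * B) * measure ?R UNIV"
    unfolding eq using 1 2 by linarith
  also have "\<dots> = (\<Sum>p\<leftarrow>p # ps. \<bar>fst p\<bar>) * (2 * \<alpha> / m) * q ^ length (p # ps) * B"
    unfolding R m using a by (simp add: field_simps)
  finally show ?case unfolding x_def y_def q_def by simp
qed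

subsection \<open>Smoothing by the jumps\<close>

text \<open>\<open>\<nu>\<close> is a measure on the whole space concentrated on the sphere, so that
  all laws involved have the same Borel sets and can be convolved. The assumption
  \<open>nondegenerate\<close> is the form in which the density of \<open>\<pi>\<close> enters the
  smoothing.\<close>

locale jump_law =
  fixes \<alpha> :: real and \<nu> :: "'a::euclidean_space measure"
  assumes alpha: "0 < \<alpha>" "\<alpha> < 2"
    and nu: "fin_borel \<nu>" "measure \<nu> UNIV = 1" "AE \<theta> in \<nu>. norm \<theta> = 1"
    and nu_sym: "distr \<nu> borel uminus = \<nu>"
    and nondegenerate: "\<And>l. l \<noteq> 0 \<Longrightarrow> \<not> (AE \<theta> in \<nu>. l \<bullet> \<theta> = 0)"
begin

definition jump :: "'a measure" where
  "jump = distr (pareto \<alpha> 1 \<Otimes>\<^sub>M \<nu>) borel (\<lambda>(u, \<theta>). u *\<^sub>R \<theta>)"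

lemma prob_pareto: "prob_space (pareto \<alpha> 1)"
proof -
  interpret finite_measure "pareto \<alpha> 1" by (intro fin_borelD pareto_fin_borel alpha) simp
  show ?thesis
    using pareto_fin_borel[OF alpha(1), of 1] fin_borelD[of "pareto \<alpha> 1"]
    by (intro prob_spaceI) (simp add: emeasure_eq_measure)
qed

lemma prob_nu: "prob_space \<nu>"
proof -
  interpret finite_measure \<nu> by (rule fin_borelD(1)[OF nu(1)])
  show ?thesis
    using nu fin_borelD[of \<nu>] by (intro prob_spaceI) (simp add: emeasure_eq_measure)
qed

lemma sets_pareto_nu[measurable_cong]: "sets (pareto \<alpha> 1) = sets borel" "sets \<nu> = sets borel"
  using pareto_fin_borel[OF alpha(1), of 1] nu fin_borelD by auto

lemma prob_jump: "prob_space jump"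
proof -
  interpret p: prob_space "pareto \<alpha> 1" by (rule prob_pareto)
  interpret n: prob_space \<nu> by (rule prob_nu)
  interpret pair_prob_space "pareto \<alpha> 1" \<nu> ..
  show ?thesis unfolding jump_def by (rule prob_space_distr) measurable
qed

lemma jump_fin_borel: "fin_borel jump" "measure jump UNIV = 1"
proof -
  interpret prob_space jump by (rule prob_jump)
  show *: "fin_borel jump" unfolding fin_borel_def
    by (rule conjI[OF finite_measure_axioms]) (simp add: jump_def)
  show "measure jump UNIV = 1" using prob_space unfolding fin_borelD(3)[OF *] .
qed

lemma integral_jump:
  assumes "bmf F"
  shows "(\<integral>y. F y \<partial>jump) = (\<integral>\<theta>. (\<integral>u. F (u *\<^sub>R \<theta>) \<partial>pareto \<alpha> 1) \<partial>\<nu>)"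
proof -
  interpret p: prob_space "pareto \<alpha> 1" by (rule prob_pareto)
  interpret n: prob_space \<nu> by (rule prob_nu)
  interpret pair_prob_space "pareto \<alpha> 1" \<nu> ..
  have [measurable]: "F \<in> borel_measurable borel" using assms unfolding bmf_def by simp
  obtain B where B: "\<And>x. \<bar>F x\<bar> \<le> B" using assms unfolding bmf_def by auto
  have "(\<integral>y. F y \<partial>jump) = (\<integral>x. (case x of (u, \<theta>) \<Rightarrow> F (u *\<^sub>R \<theta>)) \<partial>(pareto \<alpha> 1 \<Otimes>\<^sub>M \<nu>))"
    unfolding jump_def by (subst integral_distr) (auto simp: split_def)
  also have "\<dots> = (\<integral>\<theta>. (\<integral>u. F (u *\<^sub>R \<theta>) \<partial>pareto \<alpha> 1) \<partial>\<nu>)"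
    using B by (subst integral_snd) (auto intro!: integrable_const_bound[where B=B])
  finally show ?thesis .
qed

lemma nn_integral_jump:
  assumes [measurable]: "F \<in> borel_measurable borel"
  shows "(\<integral>\<^sup>+y. F y \<partial>jump) = (\<integral>\<^sup>+\<theta>. (\<integral>\<^sup>+u. F (u *\<^sub>R \<theta>) \<partial>pareto \<alpha> 1) \<partial>\<nu>)"
proof -
  interpret p: prob_space "pareto \<alpha> 1" by (rule prob_pareto)
  interpret n: prob_space \<nu> by (rule prob_nu)
  interpret pair_prob_space "pareto \<alpha> 1" \<nu> ..
  have "(\<integral>\<^sup>+y. F y \<partial>jump) = (\<integral>\<^sup>+x. (case x of (u, \<theta>) \<Rightarrow> F (u *\<^sub>R \<theta>)) \<partial>(pareto \<alpha> 1 \<Otimes>\<^sub>M \<nu>))"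
    unfolding jump_def by (subst nn_integral_distr) (auto simp: split_def)
  also have "\<dots> = (\<integral>\<^sup>+\<theta>. (\<integral>\<^sup>+u. F (u *\<^sub>R \<theta>) \<partial>pareto \<alpha> 1) \<partial>\<nu>)"
    by (subst nn_integral_snd[symmetric]) auto
  finally show ?thesis .
qed

definition far :: "real \<Rightarrow> 'a set \<Rightarrow> 'a set" where
  "far m U = {y. m \<le> norm y \<and> y /\<^sub>R norm y \<in> U}"

definition far_jump :: "real \<Rightarrow> 'a set \<Rightarrow> 'a measure" where
  "far_jump m U = density jump (indicator (far m U))"

lemma far_borel[measurable]:
  assumes [measurable]: "U \<in> sets borel"
  shows "far m U \<in> sets borel"
proof -
  have "far m U = {y. m \<le> norm y} \<inter> (\<lambda>y. y /\<^sub>R norm y) -` U" unfolding far_def by auto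
  moreover have "(\<lambda>y::'a. y /\<^sub>R norm y) -` U \<inter> space borel \<in> sets borel"
    by (rule measurable_sets[OF _ assms]) measurable
  ultimately show ?thesis by simp
qed

lemma far_jump_fin_borel: "U \<in> sets borel \<Longrightarrow> fin_borel (far_jump m U)"
  unfolding far_jump_def by (intro fin_borel_density jump_fin_borel far_borel)

text \<open>Almost every direction has norm 1, so membership in \<open>far m U\<close> separates
  into \<open>m \<le> u\<close> for the radius and \<open>\<theta> \<in> U\<close> for the
  direction; the restricted jump is a mixture of radial laws.\<close>

lemma avg_far_jump:
  assumes F: "bmf F" and U[measurable]: "U \<in> sets borel" and m: "1 \<le> m"
  shows "avg (far_jump m U) F z = (\<integral>\<theta>. indicator U \<theta> * avg (radial \<alpha> m \<theta>) F z \<partial>\<nu>)"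
proof -
  have [measurable]: "F \<in> borel_measurable borel" using F unfolding bmf_def by simp
  have [measurable_cong]: "sets jump = sets borel" using jump_fin_borel fin_borelD by auto
  obtain B where B: "\<And>x. \<bar>F x\<bar> \<le> B" using F unfolding bmf_def by auto
  have "0 \<le> B" using B[of 0] by linarith
  then have "\<bar>indicator (far m U) y * F (z + y)\<bar> \<le> B" for y using B by (simp add: indicator_def)
  then have b: "bmf (\<lambda>y. indicator (far m U) y * F (z + y))"
    unfolding bmf_def by (intro conjI exI[of _ B] allI) measurable
  have "far_jump m U = density jump (\<lambda>x. ennreal (indicator (far m U) x))"
    by (simp add: far_jump_def ennreal_indicator)
  then have "avg (far_jump m U) F z = (\<integral>y. indicator (far m U) y * F (z + y) \<partial>jump)"
    unfolding avg_def by (simp add: integral_density)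
  also have "\<dots> = (\<integral>\<theta>. (\<integral>u. indicator (far m U) (u *\<^sub>R \<theta>) * F (z + u *\<^sub>R \<theta>) \<partial>pareto \<alpha> 1) \<partial>\<nu>)"
    by (rule integral_jump[OF b])
  also have "\<dots> = (\<integral>\<theta>. indicator U \<theta> * avg (radial \<alpha> m \<theta>) F z \<partial>\<nu>)"
  proof (rule integral_cong_AE)
    have "(\<lambda>\<theta>. \<integral>u. F (z + u *\<^sub>R \<theta>) \<partial>pareto \<alpha> m) \<in> borel_measurable \<nu>"
    proof -
      interpret finite_measure "pareto \<alpha> m" using m by (intro fin_borelD pareto_fin_borel alpha) simp
      have [measurable_cong]: "sets (pareto \<alpha> m) = sets borel" by (simp add: pareto_def)
      show ?thesis by measurable
    qed
    then show "(\<lambda>\<theta>. indicat_real U \<theta> * avg (radial \<alpha> m \<theta>) F z) \<in> borel_measurable \<nu>"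
      using m alpha by (simp add: avg_radial[OF F])
    interpret prob_space "pareto \<alpha> 1" by (rule prob_pareto)
    show "(\<lambda>\<theta>. \<integral>u. indicat_real (far m U) (u *\<^sub>R \<theta>) * F (z + u *\<^sub>R \<theta>) \<partial>pareto \<alpha> 1) \<in> borel_measurable \<nu>"
      by measurable
    show "AE \<theta> in \<nu>. (\<integral>u. indicat_real (far m U) (u *\<^sub>R \<theta>) * F (z + u *\<^sub>R \<theta>) \<partial>pareto \<alpha> 1)
        = indicat_real U \<theta> * avg (radial \<alpha> m \<theta>) F z"
      using nu(3)
    proof eventually_elim
      case (elim \<theta>)
      have "\<alpha> * u powr (-1 - \<alpha>) * indicator {1..} u * (indicat_real (far m U) (u *\<^sub>R \<theta>) * F (z + u *\<^sub>R \<theta>))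
        = indicat_real U \<theta> * (\<alpha> * u powr (-1 - \<alpha>) * indicator {m..} u * F (z + u *\<^sub>R \<theta>))" for u
        using elim m by (auto simp: indicator_def far_def)
      then have "(\<integral>u. \<alpha> * u powr (-1 - \<alpha>) * indicator {1..} u * (indicat_real (far m U) (u *\<^sub>R \<theta>) * F (z + u *\<^sub>R \<theta>)) \<partial>lborel)
        = (\<integral>u. indicat_real U \<theta> * (\<alpha> * u powr (-1 - \<alpha>) * indicator {m..} u * F (z + u *\<^sub>R \<theta>)) \<partial>lborel)"
        by (rule Bochner_Integration.integral_cong[OF refl])
      also have "\<dots> = indicat_real U \<theta> * (\<integral>u. \<alpha> * u powr (-1 - \<alpha>) * indicator {m..} u * F (z + u *\<^sub>R \<theta>) \<partial>lborel)"
        by (rule integral_mult_right_zero)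
      finally show ?case using alpha m
        by (simp add: avg_radial[OF F] integral_pareto del: mult_cancel_left)
    qed
  qed
  finally show ?thesis .
qed

lemma measure_far:
  assumes U: "U \<in> sets borel" and m: "1 \<le> m"
  shows "measure jump (far m U) = measure \<nu> U * m powr - \<alpha>"
proof -
  have c: "avg \<kappa> (\<lambda>_. 1) z = measure \<kappa> UNIV" if "fin_borel \<kappa>" for \<kappa> and z :: 'a
    using fin_borelD[OF that] by (simp add: avg_def finite_measure.finite_emeasure_space)
  have "measure jump (far m U) = avg (far_jump m U) (\<lambda>_. 1) 0"
    using fin_borel_density[OF jump_fin_borel(1) far_borel[OF U, of m]] c far_jump_def by simp
  also have "\<dots> = (\<integral>\<theta>. indicator U \<theta> * m powr - \<alpha> \<partial>\<nu>)"
    using U m alpha by (subst avg_far_jump) (auto simp: c radial_fin_borel bmf_def)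
  also have "\<dots> = measure \<nu> U * m powr - \<alpha>"
    using U nu fin_borelD[OF nu(1)] by simp
  finally show ?thesis .
qed

lemma avg_far_jump_le:
  assumes F: "bmf F" and U[measurable]: "U \<in> sets borel" and m: "1 \<le> m" and c: "0 \<le> c"
    and bd: "\<And>\<theta>. \<theta> \<in> U \<Longrightarrow> \<bar>avg (radial \<alpha> m \<theta>) F z\<bar> \<le> c"
  shows "\<bar>avg (far_jump m U) F z\<bar> \<le> c * measure \<nu> U"
proof -
  interpret finite_measure \<nu> by (rule fin_borelD(1)[OF nu(1)])
  let ?f = "\<lambda>\<theta>. indicator U \<theta> * avg (radial \<alpha> m \<theta>) F z"
  have "\<bar>\<integral>\<theta>. ?f \<theta> \<partial>\<nu>\<bar> \<le> (\<integral>\<theta>. c * indicator U \<theta> \<partial>\<nu>)"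
  proof (cases "integrable \<nu> ?f")
    case True
    have "\<bar>\<integral>\<theta>. ?f \<theta> \<partial>\<nu>\<bar> \<le> (\<integral>\<theta>. \<bar>?f \<theta>\<bar> \<partial>\<nu>)" by (rule integral_abs_bound)
    also have "\<dots> \<le> (\<integral>\<theta>. c * indicator U \<theta> \<partial>\<nu>)"
    proof (intro integral_mono integrable_abs True)
      show "integrable \<nu> (\<lambda>\<theta>. c * indicator U \<theta>)" by (simp add: emeasure_eq_measure)
    qed (use bd in \<open>auto simp: indicator_def\<close>)
    finally show ?thesis .
  qed (use c in \<open>auto simp: not_integrable_integral_eq\<close>)
  then show ?thesis using fin_borelD[OF nu(1)] by (simp add: avg_far_jump[OF F U m])
qed

text \<open>Bounds for fixed directions integrate to bounds for directions restricted to the sets in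
  \<open>Us\<close>. A fixed radial average is commuted inwards to \<open>F\<close>, so that the
  induction hypothesis applies to \<open>avg (radial \<alpha> m \<theta>) F\<close>.\<close>

lemma foldr_far_jump_le:
  assumes "bmf F" "\<And>U. U \<in> set Us \<Longrightarrow> U \<in> sets borel" "1 \<le> m" "0 \<le> c"
    and "\<And>\<theta>s z. list_all2 (\<in>) \<theta>s Us \<Longrightarrow> \<bar>foldr avg (map (radial \<alpha> m) \<theta>s) F z\<bar> \<le> c"
  shows "\<bar>foldr avg (map (far_jump m) Us) F z\<bar> \<le> c * (\<Prod>U\<leftarrow>Us. measure \<nu> U)"
  using assms
proof (induction Us arbitrary: F z)
  case Nil
  then show ?case by simp
next
  case (Cons U Us)
  have G: "fin_borel \<kappa>" if "\<kappa> \<in> set (map (far_jump m) Us)" for \<kappa>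
    using that Cons.prems(2) by (auto intro!: far_jump_fin_borel)
  have R: "fin_borel (radial \<alpha> m \<theta>)" for \<theta> :: 'a
    using alpha Cons.prems(3) by (intro radial_fin_borel) auto
  have "\<bar>avg (radial \<alpha> m \<theta>) (foldr avg (map (far_jump m) Us) F) z\<bar> \<le> c * (\<Prod>U\<leftarrow>Us. measure \<nu> U)"
    if "\<theta> \<in> U" for \<theta>
  proof -
    have "\<bar>foldr avg (map (radial \<alpha> m) \<theta>s) (avg (radial \<alpha> m \<theta>) F) z\<bar> \<le> c"
      if "list_all2 (\<in>) \<theta>s Us" for \<theta>s z
    proof -
      have "foldr avg (map (radial \<alpha> m) \<theta>s) (avg (radial \<alpha> m \<theta>) F)
          = avg (radial \<alpha> m \<theta>) (foldr avg (map (radial \<alpha> m) \<theta>s) F)"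
        using R Cons.prems(1) by (intro foldr_avg) auto
      then show ?thesis using Cons.prems(5)[of "\<theta> # \<theta>s" z] that \<open>\<theta> \<in> U\<close> by simp
    qed
    then have "\<bar>foldr avg (map (far_jump m) Us) (avg (radial \<alpha> m \<theta>) F) z\<bar> \<le> c * (\<Prod>U\<leftarrow>Us. measure \<nu> U)"
      using Cons.prems by (intro Cons.IH bmf_avg R) auto
    then show ?thesis using foldr_avg(2)[of "map (far_jump m) Us", OF G Cons.prems(1) R] by simp
  qed
  then have "\<bar>avg (far_jump m U) (foldr avg (map (far_jump m) Us) F) z\<bar>
      \<le> (c * (\<Prod>U\<leftarrow>Us. measure \<nu> U)) * measure \<nu> U"
    using Cons.prems by (intro avg_far_jump_le foldr_avg G mult_nonneg_nonneg prod_list_nonneg) auto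
  then show ?case by (simp add: ac_simps)
qed

text \<open>The first-hit estimate is applied once per set in \<open>Us\<close>, with
  \<open>l\<close> jumps reserved for it. The last summand accounts for missing one of the sets;
  dividing by the masses of the far jumps makes the bound \<open>c\<close> conditional on all the
  hits.\<close>

lemma avg_pow_jump_le:
  assumes "bmf F" "\<And>z. \<bar>F z\<bar> \<le> c0" "0 \<le> c0" "\<And>U. U \<in> set Us \<Longrightarrow> U \<in> sets borel \<and> p \<le> measure \<nu> U"
    and m: "1 \<le> m" and p: "0 < p"
    and "\<And>z. \<bar>foldr avg (map (far_jump m) Us) F z\<bar> \<le> c" "0 \<le> c"
  shows "\<bar>(avg jump ^^ (l * length Us)) F z\<bar>
    \<le> c / (\<Prod>U\<leftarrow>Us. measure \<nu> U * m powr - \<alpha>) + length Us * (1 - p * m powr - \<alpha>) ^ l * c0"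
  using assms(1-4,7-)
proof (induction Us arbitrary: F c0 z)
  case Nil
  then show ?case by simp
next
  case (Cons U Us)
  interpret prob_space jump by (rule prob_jump)
  let ?g = "measure \<nu> U * m powr - \<alpha>" and ?q = "p * m powr - \<alpha>"
  have U: "U \<in> sets borel" "p \<le> measure \<nu> U" using Cons.prems(4) by auto
  have gq: "?q \<le> ?g" using U by (intro mult_right_mono) auto
  have g: "0 < ?g" using U p m by auto
  have g1: "?g \<le> 1" using measure_far[OF U(1) m] prob_le_1[of "far m U"] by simp
  have G: "fin_borel \<kappa>" if "\<kappa> \<in> set (map (far_jump m) Us)" for \<kappa>
    using that Cons.prems(4) by (auto intro!: far_jump_fin_borel)
  have GU: "fin_borel (far_jump m U)" "measure (far_jump m U) UNIV = ?g"
    using far_jump_fin_borel[OF U(1)] fin_borel_density(2)[OF jump_fin_borel(1) far_borel[OF U(1), of m]]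
      measure_far[OF U(1) m] by (auto simp: far_jump_def)
  \<comment> \<open>Restricting to a hit of \<open>U\<close> scales the trivial bound
    \<open>c0\<close> by \<open>?g\<close>, and the later division by \<open>?g\<close> undoes this;
    hence every set adds the same failure term.\<close>
  define c' where "c' = c / (\<Prod>U\<leftarrow>Us. measure \<nu> U * m powr - \<alpha>) + length Us * (1 - ?q) ^ l * (?g * c0)"
  have pr: "0 < (\<Prod>U\<leftarrow>Us. measure \<nu> U * m powr - \<alpha>)"
  proof -
    have "\<And>U. U \<in> set Us \<Longrightarrow> 0 < measure \<nu> U * m powr - \<alpha>"
      using Cons.prems(4) p m by (intro mult_pos_pos) force+
    then show ?thesis by (induction Us) auto
  qed
  have c': "0 \<le> c'" unfolding c'_def using pr Cons.prems(3,6) gq g g1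
    by (intro add_nonneg_nonneg divide_nonneg_pos mult_nonneg_nonneg zero_le_power) auto
  have "\<bar>avg (far_jump m U) F y\<bar> \<le> ?g * c0" for y
    using avg_abs_le[OF GU(1), of c0 F y] Cons.prems(2,3) GU(2) by (simp add: mult.commute)
  moreover have "\<bar>foldr avg (map (far_jump m) Us) (avg (far_jump m U) F) y\<bar> \<le> c" for y
    using Cons.prems(5)[of y] foldr_avg(2)[of "map (far_jump m) Us", OF G Cons.prems(1) GU(1)] by simp
  ultimately have "\<bar>(avg jump ^^ (l * length Us)) (avg (far_jump m U) F) y\<bar> \<le> c'" for y
    unfolding c'_def using Cons.prems g by (intro Cons.IH bmf_avg GU) auto
  then have "\<bar>(avg jump ^^ (l * length Us + l)) F z\<bar> \<le> c' / ?g + (1 - ?g) ^ l * c0"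
    using Cons.prems(1-3) c' unfolding far_jump_def
    by (intro avg_pow_le_first_hit[OF jump_fin_borel far_borel[OF U(1)] measure_far[OF U(1) m] g g1]) auto
  also have "(1 - ?g) ^ l * c0 \<le> (1 - ?q) ^ l * c0"
    using Cons.prems(3) gq g1 by (intro mult_right_mono power_mono) auto
  also have "c' / ?g + (1 - ?q) ^ l * c0
     = c / (\<Prod>U\<leftarrow>U # Us. measure \<nu> U * m powr - \<alpha>) + length (U # Us) * (1 - ?q) ^ l * c0"
  proof -
    have "(c / P + e * (g * c0)) / g = c / (g * P) + e * c0" if "0 < g" "0 < P" for g P e :: real
      using that by (simp add: field_simps)
    from this[OF g pr, of "length Us * (1 - ?q) ^ l"] show ?thesis
      unfolding c'_def by (simp add: distrib_right mult.assoc)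
  qed
  finally show ?case by (simp add: add.commute)
qed

end

lemma sum_list_zip_nth:
  fixes f :: "'b \<Rightarrow> 'c \<Rightarrow> 'd::comm_monoid_add"
  assumes "length xs = n" "length ys = n"
  shows "(\<Sum>p\<leftarrow>zip xs ys. f (fst p) (snd p)) = (\<Sum>i<n. f (xs ! i) (ys ! i))"
  using assms by (simp add: sum_list_sum_nth atLeast0LessThan)

section \<open>Independent directions charged by \<open>\<nu>\<close>, and the smoothing
  estimate\<close>

context jump_law
begin

text \<open>By Lindelof the union of all open null sets is a countable union of such sets, hence
  null; its complement is the topological support.\<close>

lemma AE_nu_support: "AE \<theta> in \<nu>. \<forall>\<delta>>0. 0 < measure \<nu> (ball \<theta> \<delta>)"
proof -
  interpret finite_measure \<nu> by (rule fin_borelD(1)[OF nu(1)])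
  define \<F> where "\<F> = {V :: 'a set. open V \<and> measure \<nu> V = 0}"
  obtain \<F>' where F': "\<F>' \<subseteq> \<F>" "countable \<F>'" "\<Union>\<F>' = \<Union>\<F>"
    using Lindelof[of \<F>] unfolding \<F>_def by auto
  have "V \<in> null_sets \<nu>" if "V \<in> \<F>'" for V
    using that F'(1) fin_borelD(2)[OF nu(1)] unfolding \<F>_def
    by (auto simp: null_sets_def emeasure_eq_measure)
  then have "\<Union>\<F>' \<in> null_sets \<nu>"
    using null_sets_UN'[OF F'(2), of "\<lambda>V. V" \<nu>] by auto
  then have "AE \<theta> in \<nu>. \<theta> \<notin> \<Union>\<F>" unfolding F'(3) by (rule AE_not_in)
  then show ?thesis
  proof eventually_elim
    case (elim \<theta>)
    show ?case
    proof (intro allI impI, rule ccontr)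
      fix \<delta> :: real assume "0 < \<delta>" "\<not> 0 < measure \<nu> (ball \<theta> \<delta>)"
      then have "ball \<theta> \<delta> \<in> \<F>" "\<theta> \<in> ball \<theta> \<delta>"
        unfolding \<F>_def by (auto simp: not_less measure_le_0_iff)
      then show False using elim by blast
    qed
  qed
qed

text \<open>By nondegeneracy the support of \<open>\<nu>\<close> spans the space and so contains a
  basis. Coordinates in a basis are bounded by a multiple of the norm, and this survives small
  perturbations of the basis; one constant thus serves all choices of directions from small balls
  around the basis vectors.\<close>

lemma spanning_neighbourhoods:
  obtains Us :: "'a set list" and p C :: real
  where "length Us = DIM('a)" "0 < p" "0 \<le> C" "\<And>U. U \<in> set Us \<Longrightarrow> U \<in> sets borel \<and> p \<le> measure \<nu> U"
    "\<And>\<theta>s x. list_all2 (\<in>) \<theta>s Us \<Longrightarrow>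
      \<exists>ps. map snd ps = \<theta>s \<and> x = (\<Sum>p\<leftarrow>ps. fst p *\<^sub>R snd p) \<and> (\<Sum>p\<leftarrow>ps. \<bar>fst p\<bar>) \<le> C * norm x"
proof -
  let ?d = "DIM('a)"
  define S where "S = {\<theta>. \<forall>\<delta>>0. 0 < measure \<nu> (ball \<theta> \<delta>)}"
  have "span S = UNIV"
  proof (rule ccontr)
    assume "span S \<noteq> UNIV"
    then obtain a where "a \<noteq> 0" "\<forall>x\<in>span S. a \<bullet> x = 0" using span_not_UNIV_orthogonal by blast
    note a = this
    have "AE \<theta> in \<nu>. a \<bullet> \<theta> = 0"
      using AE_nu_support by eventually_elim (use a(2) in \<open>auto simp: S_def intro: span_base\<close>)
    then show False using nondegenerate a(1) by blast
  qed
  obtain B where B: "B \<subseteq> S" "independent B" "S \<subseteq> span B" "card B = dim S"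
    using basis_exists[of S] by blast
  have sB: "span B = UNIV"
    using B(1,3) \<open>span S = UNIV\<close> by (metis span_mono span_span subset_antisym top.extremum)
  have fB: "finite B" using B(2) independent_imp_finite by blast
  have cB: "card B = ?d" using B(4) \<open>span S = UNIV\<close> dim_eq_full by metis
  obtain us where us: "set us = B" "distinct us" using finite_distinct_list[OF fB] by blast
  obtain bs where bs: "set bs = (Basis :: 'a set)" "distinct bs" using finite_distinct_list[OF finite_Basis] by blast
  have len: "length us = ?d" "length bs = ?d"
    using us bs cB distinct_card[of us] distinct_card[of bs] by auto
  \<comment> \<open>\<open>T \<theta>s\<close> sends the standard basis to \<open>\<theta>s\<close>,
    so the coefficients of \<open>x\<close> with respect to \<open>\<theta>s\<close> are the
    coordinates of a preimage of \<open>x\<close>.\<close>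
  define T where "T = (\<lambda>(\<theta>s :: 'a list) (v :: 'a). \<Sum>i<?d. (v \<bullet> bs ! i) *\<^sub>R \<theta>s ! i)"
  have lin: "linear (T \<theta>s)" for \<theta>s
    unfolding T_def by (intro linearI) (simp_all add: inner_left_distrib scaleR_left_distrib sum.distrib scaleR_sum_right)
  have bsB: "bs ! i \<in> Basis" if "i < ?d" for i using that bs len nth_mem by metis
  have "T us (bs ! j) = us ! j" if "j < ?d" for j
  proof -
    have "T us (bs ! j) = (\<Sum>i<?d. (if i = j then us ! j else 0))"
      unfolding T_def using that bs len bsB by (intro sum.cong) (auto simp: inner_Basis nth_eq_iff_index_eq)
    then show ?thesis using that by simp
  qed
  then have "B \<subseteq> range (T us)" using us len by (metis in_set_conv_nth rangeI subsetI)
  then have "span B \<subseteq> range (T us)"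
    using span_minimal linear_subspace_image[OF lin subspace_UNIV] by blast
  then have "surj (T us)" using sB by auto
  then have "inj (T us)" using linear_surjective_imp_injective[OF lin] by simp
  then obtain c where c: "0 < c" "\<And>v. c * norm v \<le> norm (T us v)"
    using linear_inj_bounded_below_pos[OF lin] by blast
  \<comment> \<open>Moving each of the \<open>?d\<close> vectors by at most \<open>\<delta>\<close>
    changes \<open>T us v\<close> by at most \<open>?d * \<delta> * norm v\<close>, which is half of
    the lower bound \<open>c * norm v\<close>.\<close>
  define \<delta> where "\<delta> = c / (2 * ?d)"
  have d0: "0 < \<delta>" unfolding \<delta>_def using c by simp
  define Us where "Us = map (\<lambda>u. ball u \<delta>) us"
  define p where "p = Min (measure \<nu> ` set Us)"
  have ne: "set Us \<noteq> {}" unfolding Us_def using len by auto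
  have "p \<in> measure \<nu> ` set Us" unfolding p_def using ne by (intro Min_in) auto
  then have "0 < p" using us B(1) d0 by (auto simp: Us_def S_def)
  moreover have "U \<in> sets borel \<and> p \<le> measure \<nu> U" if "U \<in> set Us" for U
    using that unfolding p_def by (auto simp: Us_def)
  moreover have "\<exists>ps. map snd ps = \<theta>s \<and> x = (\<Sum>p\<leftarrow>ps. fst p *\<^sub>R snd p) \<and> (\<Sum>p\<leftarrow>ps. \<bar>fst p\<bar>) \<le> (?d * 2 / c) * norm x"
    if \<theta>: "list_all2 (\<in>) \<theta>s Us" for \<theta>s x
  proof -
    have lt: "length \<theta>s = ?d" using \<theta> len by (auto simp: Us_def dest: list_all2_lengthD)
    have near: "norm (us ! i - \<theta>s ! i) \<le> \<delta>" if "i < ?d" for i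
      using list_all2_nthD[OF \<theta>, of i] that lt len by (auto simp: Us_def dist_norm less_imp_le)
    have lower: "c / 2 * norm v \<le> norm (T \<theta>s v)" for v
    proof -
      have "norm (T us v - T \<theta>s v) = norm (\<Sum>i<?d. (v \<bullet> bs ! i) *\<^sub>R (us ! i - \<theta>s ! i))"
        unfolding T_def by (simp add: sum_subtractf scaleR_diff_right)
      also have "\<dots> \<le> (\<Sum>i<?d. norm v * \<delta>)"
        using near bsB by (intro sum_norm_le) (auto intro!: mult_mono Basis_le_norm)
      also have "\<dots> = c / 2 * norm v" by (simp add: \<delta>_def)
      finally show ?thesis using c(2)[of v] norm_triangle_ineq2[of "T us v" "T \<theta>s v"] by (simp add: field_simps)
    qed
    have "inj (T \<theta>s)"
      unfolding linear_injective_0[OF lin]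
    proof (intro allI impI)
      fix v assume "T \<theta>s v = 0"
      then show "v = 0" using lower[of v] c(1) by (simp add: mult_le_0_iff)
    qed
    then have "surj (T \<theta>s)" using linear_injective_imp_surjective[OF lin] by simp
    then obtain v where v: "x = T \<theta>s v" by (metis surjD)
    define cs where "cs = map (\<lambda>b. v \<bullet> b) bs"
    have lc: "length cs = ?d" using len by (simp add: cs_def)
    have "x = (\<Sum>p\<leftarrow>zip cs \<theta>s. fst p *\<^sub>R snd p)"
      unfolding v T_def using len by (subst sum_list_zip_nth[OF lc lt]) (auto simp: cs_def)
    moreover have "(\<Sum>p\<leftarrow>zip cs \<theta>s. \<bar>fst p\<bar>) \<le> (?d * 2 / c) * norm x"
    proof -
      have "(\<Sum>p\<leftarrow>zip cs \<theta>s. \<bar>fst p\<bar>) = (\<Sum>i<?d. \<bar>v \<bullet> bs ! i\<bar>)"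
        using sum_list_zip_nth[OF lc lt, of "\<lambda>a b. \<bar>a\<bar>"] len by (simp add: cs_def)
      also have "\<dots> \<le> (\<Sum>i<?d. norm v)" using bsB by (intro sum_mono Basis_le_norm) auto
      also have "\<dots> \<le> ?d * (2 / c * norm x)"
        using lower[of v] c(1) unfolding v by (simp add: field_simps)
      finally show ?thesis by simp
    qed
    ultimately show ?thesis using lc lt by (intro exI[of _ "zip cs \<theta>s"]) auto
  qed
  moreover have "length Us = ?d" by (simp add: Us_def len)
  moreover have "0 \<le> ?d * 2 / c" using c by simp
  ultimately show ?thesis using that by blast
qed

text \<open>With \<open>l\<close> jumps reserved for each of the neighbourhoods, far jumps into all
  of them absorb the shift at a cost of order \<open>norm x / m\<close>. On failure the other
  \<open>r\<close> jumps still give \<open>\<Phi>\<close>, weighted by the probability of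
  failure.\<close>

lemma avg_pow_shift_diff_step:
  obtains p C :: real where "0 < p" "p \<le> 1" "0 \<le> C"
    "\<And>m f c x l r \<Phi> z. 1 \<le> m \<Longrightarrow> bmf f \<Longrightarrow> (\<And>z. \<bar>f z\<bar> \<le> c) \<Longrightarrow> (\<And>z. \<bar>(avg jump ^^ r) (shift_diff x f) z\<bar> \<le> \<Phi>) \<Longrightarrow>
      \<bar>(avg jump ^^ (l * DIM('a) + r)) (shift_diff x f) z\<bar>
        \<le> C * norm x / m * c + DIM('a) * (1 - p * m powr - \<alpha>) ^ l * \<Phi>"
proof -
  obtain Us :: "'a set list" and p C :: real where
    Us: "length Us = DIM('a)" "0 < p" "0 \<le> C" "\<And>U. U \<in> set Us \<Longrightarrow> U \<in> sets borel \<and> p \<le> measure \<nu> U"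
    and rep: "\<And>\<theta>s x. list_all2 (\<in>) \<theta>s Us \<Longrightarrow>
      \<exists>ps. map snd ps = \<theta>s \<and> x = (\<Sum>p\<leftarrow>ps. fst p *\<^sub>R snd p) \<and> (\<Sum>p\<leftarrow>ps. \<bar>fst p\<bar>) \<le> C * norm x"
    by (rule spanning_neighbourhoods) blast
  have main: "\<bar>(avg jump ^^ (l * DIM('a) + r)) (shift_diff x f) z\<bar>
        \<le> (C * (2 * \<alpha>)) * norm x / m * c + DIM('a) * (1 - p * m powr - \<alpha>) ^ l * \<Phi>"
    if m: "1 \<le> m" and f: "bmf f" "\<And>z. \<bar>f z\<bar> \<le> c"
      and \<Phi>: "\<And>z. \<bar>(avg jump ^^ r) (shift_diff x f) z\<bar> \<le> \<Phi>"
    for m f c x l r \<Phi> z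
  proof -
    have c0: "0 \<le> c" using f(2)[of 0] by linarith
    have P0: "0 \<le> \<Phi>" using \<Phi>[of 0] by linarith
    define q where "q = m powr - \<alpha>"
    have q: "0 < q" unfolding q_def using m by simp
    define F where "F = shift_diff x f"
    have F: "bmf F" unfolding F_def by (intro bmf_shift_diff f)
    define b where "b = (C * norm x) * (2 * \<alpha> / m) * q ^ DIM('a) * c"
    have b0: "0 \<le> b" unfolding b_def using Us(3) alpha m q c0 by simp
    have G: "fin_borel \<kappa>" if "\<kappa> \<in> set (map (far_jump m) Us)" for \<kappa>
      using that Us(4) by (auto intro!: far_jump_fin_borel)
    have "\<bar>foldr avg (map (radial \<alpha> m) \<theta>s) F y\<bar> \<le> b" if \<theta>: "list_all2 (\<in>) \<theta>s Us" for \<theta>s y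
    proof -
      from rep[OF \<theta>, of x] obtain ps where ps: "map snd ps = \<theta>s" "x = (\<Sum>p\<leftarrow>ps. fst p *\<^sub>R snd p)"
        "(\<Sum>p\<leftarrow>ps. \<bar>fst p\<bar>) \<le> C * norm x" by blast
      have len: "length ps = DIM('a)" using ps(1) list_all2_lengthD[OF \<theta>] Us(1) by (metis length_map)
      have "map (radial \<alpha> m) \<theta>s = map (\<lambda>p. radial \<alpha> m (snd p)) ps"
        unfolding ps(1)[symmetric] by simp
      then have "\<bar>foldr avg (map (radial \<alpha> m) \<theta>s) F y\<bar> \<le> (\<Sum>p\<leftarrow>ps. \<bar>fst p\<bar>) * (2 * \<alpha> / m) * q ^ length ps * c"
        using radials_shift_diff[OF alpha(1) _ f, of m ps y] m ps(2) by (simp add: F_def q_def)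
      also have "\<dots> \<le> b"
        unfolding b_def len using ps(3) alpha m q c0 by (intro mult_right_mono) auto
      finally show ?thesis .
    qed
    then have "\<bar>foldr avg (map (far_jump m) Us) F y\<bar> \<le> b * (\<Prod>U\<leftarrow>Us. measure \<nu> U)" for y
      using F Us(4) m b0 by (intro foldr_far_jump_le) auto
    moreover have "0 \<le> b * (\<Prod>U\<leftarrow>Us. measure \<nu> U)"
      using b0 by (intro mult_nonneg_nonneg prod_list_nonneg) auto
    \<comment> \<open>On success the \<open>r\<close> other jumps are commuted outside, where
      averaging cannot increase the bound.\<close>
    moreover have "foldr avg (map (far_jump m) Us) ((avg jump ^^ r) F) = (avg jump ^^ r) (foldr avg (map (far_jump m) Us) F)"
    proof (induction r)
      case (Suc r)
      have "bmf ((avg jump ^^ r) F)" by (intro avg_pow jump_fin_borel F)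
      from foldr_avg(2)[of "map (far_jump m) Us", OF G this jump_fin_borel(1)] Suc show ?case by simp
    qed simp
    ultimately have b: "\<bar>foldr avg (map (far_jump m) Us) ((avg jump ^^ r) F) y\<bar> \<le> b * (\<Prod>U\<leftarrow>Us. measure \<nu> U)" for y
      using avg_pow_abs_le[OF jump_fin_borel] by simp
    have "\<bar>(avg jump ^^ (l * length Us)) ((avg jump ^^ r) F) z\<bar>
      \<le> (b * (\<Prod>U\<leftarrow>Us. measure \<nu> U)) / (\<Prod>U\<leftarrow>Us. measure \<nu> U * m powr - \<alpha>)
        + length Us * (1 - p * m powr - \<alpha>) ^ l * \<Phi>"
      using \<Phi> F P0 Us m b b0 unfolding F_def
      by (intro avg_pow_jump_le avg_pow jump_fin_borel) (auto intro!: mult_nonneg_nonneg prod_list_nonneg)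
    \<comment> \<open>The masses of the neighbourhoods and of the radial tails cancel; what remains
      is the cost \<open>1 / m\<close> of conditioned far jumps.\<close>
    also have "(b * (\<Prod>U\<leftarrow>Us. measure \<nu> U)) / (\<Prod>U\<leftarrow>Us. measure \<nu> U * m powr - \<alpha>) = C * (2 * \<alpha>) * norm x / m * c"
    proof -
      have "\<And>U. U \<in> set Us \<Longrightarrow> 0 < measure \<nu> U" using Us(2,4) by (meson less_le_trans)
      then have "(\<Prod>U\<leftarrow>Us. measure \<nu> U) \<noteq> 0" by (force simp: prod_list_zero_iff)
      moreover have "(\<Prod>U\<leftarrow>Us. measure \<nu> U * m powr - \<alpha>) = (\<Prod>U\<leftarrow>Us. measure \<nu> U) * q ^ length Us"
        unfolding q_def by (induction Us) auto
      ultimately show ?thesis using q by (simp add: b_def Us(1))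
    qed
    finally show ?thesis by (simp add: funpow_add F_def Us(1))
  qed
  have "Us \<noteq> []" using Us(1) by auto
  then have "p \<le> measure \<nu> (hd Us)" using Us(4) by simp
  also have "\<dots> \<le> 1" using prob_space.prob_le_1[OF prob_nu] .
  finally show ?thesis
    by (rule that[OF Us(2) _ _ main]) (use Us(3) alpha in auto)
qed

text \<open>Strong induction on \<open>m\<close>. At most half of the jumps is spent on one
  smoothing attempt; the bound for the rest is worse by at most
  \<open>2 powr (1 / \<alpha>)\<close>, and the failure probability is small enough to compensate
  for this, so that the same \<open>K\<close> is reproduced.\<close>

lemma avg_pow_shift_diff_le:
  obtains K :: real where "0 < K"
    "\<And>f c m x z. bmf f \<Longrightarrow> (\<And>z. \<bar>f z\<bar> \<le> c) \<Longrightarrow>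
      \<bar>(avg jump ^^ m) (shift_diff x f) z\<bar> \<le> K * (norm x + 1) * real (m + 1) powr (-1 / \<alpha>) * c"
proof -
  let ?d = "DIM('a)"
  define D where "D = real ?d"
  have D: "1 \<le> D" unfolding D_def using DIM_positive[where 'a='a] by linarith
  define a where "a = 1 / \<alpha>"
  have a: "0 < a" unfolding a_def using alpha by simp
  obtain p C :: real where p: "0 < p" "p \<le> 1" and C: "0 \<le> C"
    and step: "\<And>m f c x l r \<Phi> z. 1 \<le> m \<Longrightarrow> bmf f \<Longrightarrow> (\<And>z. \<bar>f z\<bar> \<le> c) \<Longrightarrow> (\<And>z. \<bar>(avg jump ^^ r) (shift_diff x f) z\<bar> \<le> \<Phi>) \<Longrightarrow>
      \<bar>(avg jump ^^ (l * ?d + r)) (shift_diff x f) z\<bar>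
        \<le> C * norm x / m * c + ?d * (1 - p * m powr - \<alpha>) ^ l * \<Phi>"
    by (rule avg_pow_shift_diff_step) blast
  \<comment> \<open>Chosen so that the failure bound \<open>D * exp (- (p * L))\<close> times the
    loss \<open>2 powr a\<close> from halving the number of jumps is at most 1/2.\<close>
  define L where "L = max 1 (ln (2 * D * 2 powr a) / p)"
  have L1: "1 \<le> L" by (simp add: L_def)
  have "ln (2 * D * 2 powr a) \<le> p * L"
  proof -
    have "ln (2 * D * 2 powr a) / p \<le> L" by (simp add: L_def)
    then show ?thesis using p by (simp add: field_simps)
  qed
  then have "exp (ln (2 * D * 2 powr a)) \<le> exp (p * L)" by simp
  then have "2 * D * 2 powr a \<le> exp (p * L)" using D by simp
  then have L: "D * exp (- (p * L)) * 2 powr a \<le> 1 / 2"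
    by (simp add: exp_minus field_simps)
  \<comment> \<open>From \<open>N\<close> on, \<open>l\<close> below is at least \<open>L\<close>
    and the threshold \<open>M\<close> at least 1. Fewer jumps are covered by the trivial bound
    \<open>2 * c\<close>, for which the first summand of \<open>K\<close> pays.\<close>
  define N where "N = 4 * D * L"
  have N: "4 \<le> N" unfolding N_def using mult_mono[OF D L1] D by simp
  define K where "K = 2 * N powr a + 2 * C * N powr a"
  have K: "2 * N powr a \<le> K" "2 * C * N powr a \<le> K" unfolding K_def using C by auto
  have K0: "0 < K" using K(1) N by (smt (verit) powr_gt_zero)
  have "\<bar>(avg jump ^^ m) (shift_diff x f) z\<bar> \<le> K * (norm x + 1) * real (m + 1) powr (- a) * c"
    if f: "bmf f" "\<And>z. \<bar>f z\<bar> \<le> c" for f c m x z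
  proof (induction m arbitrary: z rule: less_induct)
    case (less m)
    have c0: "0 \<le> c" using f(2)[of 0] by linarith
    show ?case
    proof (cases "real (m + 1) < N")
      case True
      have sd: "\<bar>shift_diff x f y\<bar> \<le> 2 * c" for y
        using f(2)[of "y + x"] f(2)[of y] unfolding shift_diff_def by linarith
      have "\<bar>(avg jump ^^ m) (shift_diff x f) z\<bar> \<le> 2 * c"
        using c0 sd by (intro avg_pow_abs_le[OF jump_fin_borel]) auto
      also have "2 * c = (2 * N powr a) * N powr (- a) * c" using N by (simp add: powr_minus)
      also have "\<dots> \<le> (K * (norm x + 1)) * real (m + 1) powr (- a) * c"
      proof -
        have "K * 1 \<le> K * (norm x + 1)" using K0 by (intro mult_left_mono) auto
        then have "2 * N powr a \<le> K * (norm x + 1)" using K(1) by linarith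
        moreover have "N powr (- a) \<le> real (m + 1) powr (- a)" using a True by (intro powr_mono2') auto
        ultimately show ?thesis using c0 K0 by (intro mult_right_mono[OF mult_mono]) auto
      qed
      finally show ?thesis .
    next
      case False
      \<comment> \<open>\<open>l\<close> jumps for each of \<open>?d\<close> sets are at most half
        of all \<open>m\<close> jumps, and \<open>r\<close> is what remains.\<close>
      define l where "l = m div (2 * ?d)"
      define r where "r = m - l * ?d"
      have "m = 2 * ?d * l + m mod (2 * ?d)" by (simp add: l_def)
      moreover have "m mod (2 * ?d) + 1 \<le> 2 * ?d" using mod_less_divisor[of "2 * ?d" m] DIM_positive[where 'a='a] by linarith
      ultimately have "m + 1 \<le> 2 * ?d * (l + 1)" by (simp add: algebra_simps)
      then have "real (m + 1) \<le> real (2 * ?d * (l + 1))" by (rule of_nat_mono)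
      then have l1: "real (m + 1) \<le> 2 * D * (real l + 1)" by (simp add: D_def algebra_simps)
      have "4 * D * 1 \<le> N" unfolding N_def using D L1 by (intro mult_left_mono) auto
      then have "4 * D \<le> real (m + 1)" using False by linarith
      then have l2: "real (m + 1) \<le> 4 * D * real l" using l1 by (simp add: algebra_simps)
      have "4 * D * L \<le> 4 * D * real l" using l2 False unfolding N_def by linarith
      then have lL: "L \<le> real l" using D by simp
      have "m = 2 * (l * ?d) + m mod (2 * ?d)"
        using div_mult_mod_eq[of m "2 * ?d"] unfolding l_def by (simp only: ac_simps)
      then have ld: "2 * (l * ?d) \<le> m" by linarith
      have r: "r < m" "real (m + 1) \<le> 2 * real (r + 1)" "l * ?d + r = m"
      proof -
        have "0 < l * ?d" using lL L1 by (auto intro!: Nat.gr0I)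
        then show "r < m" unfolding r_def using ld by linarith
        show e: "l * ?d + r = m" unfolding r_def using ld by linarith
        have "m' + 1 \<le> 2 * (r + 1)" if "2 * k \<le> m'" "k + r = m'" for k m' :: nat
          using that by presburger
        from this[OF ld e] have "m + 1 \<le> 2 * (r + 1)" .
        then show "real (m + 1) \<le> 2 * real (r + 1)" by linarith
      qed
      \<comment> \<open>The largest threshold that \<open>l\<close> trials allow:
        \<open>M powr - \<alpha> = L / real l\<close> keeps the failure probability below a
        constant, and \<open>1 / M\<close> has the required order
        \<open>m powr (- a)\<close>.\<close>
      define M where "M = (real l / L) powr a"
      have M1: "1 \<le> M" unfolding M_def using lL L1 a by (intro ge_one_powr_ge_zero) auto
      have Ma: "M powr - \<alpha> = L / real l"
        unfolding M_def powr_powr a_def using lL L1 alpha by (simp add: powr_minus)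
      define \<Phi> where "\<Phi> = K * (norm x + 1) * real (r + 1) powr (- a) * c"
      have \<Phi>0: "0 \<le> \<Phi>" unfolding \<Phi>_def using K0 c0 by simp
      have "\<bar>(avg jump ^^ (l * ?d + r)) (shift_diff x f) z\<bar>
          \<le> C * norm x / M * c + ?d * (1 - p * M powr - \<alpha>) ^ l * \<Phi>"
        using less.IH[OF r(1)] f unfolding \<Phi>_def by (intro step M1) auto
      also have "(1 - p * M powr - \<alpha>) ^ l \<le> exp (- (p * L / real l)) ^ l"
      proof (rule power_mono)
        show "1 - p * M powr - \<alpha> \<le> exp (- (p * L / real l))"
          unfolding Ma using exp_ge_add_one_self[of "- (p * L / real l)"] by simp
        have "p * L \<le> 1 * real l" using p lL L1 by (intro mult_mono) auto
        then show "0 \<le> 1 - p * M powr - \<alpha>"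
          unfolding Ma using lL L1 by (simp add: field_simps)
      qed
      also have "exp (- (p * L / real l)) ^ l = exp (- (p * L))"
        using lL L1 by (simp add: exp_of_nat_mult[symmetric])
      also have "\<Phi> \<le> K * (norm x + 1) * (2 powr a * real (m + 1) powr (- a)) * c"
      proof -
        have "real (r + 1) powr (- a) \<le> (real (m + 1) / 2) powr (- a)"
          using r(2) a by (intro powr_mono2') auto
        also have "\<dots> = 2 powr a * real (m + 1) powr (- a)"
          by (simp add: powr_divide powr_minus field_simps)
        finally show ?thesis unfolding \<Phi>_def using K0 c0 by (intro mult_right_mono mult_left_mono) auto
      qed
      also have "C * norm x / M * c \<le> C * norm x * (N powr a * real (m + 1) powr (- a)) * c"
      proof -
        have "1 / M = (L / real l) powr a" unfolding M_def using lL L1 by (simp add: powr_divide)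
        also have "\<dots> \<le> (N / real (m + 1)) powr a"
        proof (rule powr_mono2)
          have "L * real (m + 1) \<le> L * (4 * D * real l)" using l2 L1 by (intro mult_left_mono) auto
          also have "\<dots> = N * real l" by (simp add: N_def)
          finally show "L / real l \<le> N / real (m + 1)"
            using lL L1 by (simp add: divide_simps mult.commute del: of_nat_Suc of_nat_add)
        qed (use lL L1 a in auto)
        also have "\<dots> = N powr a * real (m + 1) powr (- a)"
          using N by (simp add: powr_divide powr_minus field_simps)
        finally have "1 / M \<le> N powr a * real (m + 1) powr (- a)" .
        then have "C * norm x * (1 / M) * c \<le> C * norm x * (N powr a * real (m + 1) powr (- a)) * c"
          using C c0 by (intro mult_right_mono mult_left_mono) auto
        then show ?thesis by simp
      qed
      finally have "\<bar>(avg jump ^^ m) (shift_diff x f) z\<bar> \<le> C * norm x * (N powr a * real (m + 1) powr (- a)) * c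
         + D * exp (- (p * L)) * (K * (norm x + 1) * (2 powr a * real (m + 1) powr (- a)) * c)"
        using \<Phi>0 D by (simp add: r(3) D_def mult_left_mono mult_right_mono)
      also have "\<dots> = (C * N powr a * norm x + (D * exp (- (p * L)) * 2 powr a) * (K * (norm x + 1))) * (real (m + 1) powr (- a) * c)"
        by (simp add: algebra_simps)
      also have "\<dots> \<le> (K / 2 * (norm x + 1) + 1 / 2 * (K * (norm x + 1))) * (real (m + 1) powr (- a) * c)"
      proof -
        have "C * N powr a * norm x \<le> K / 2 * norm x" using K(2) by (intro mult_right_mono) auto
        also have "\<dots> \<le> K / 2 * (norm x + 1)" using K0 by (intro mult_left_mono) auto
        finally have "C * N powr a * norm x \<le> K / 2 * (norm x + 1)" .
        moreover have "D * exp (- (p * L)) * 2 powr a * (K * (norm x + 1)) \<le> 1 / 2 * (K * (norm x + 1))"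
          using K0 by (intro mult_right_mono L) auto
        ultimately show ?thesis using c0 by (intro mult_right_mono[OF add_mono]) auto
      qed
      finally show ?thesis by (simp add: field_simps)
    qed
  qed
  then show ?thesis by (intro that[OF K0]) (simp add: a_def)
qed

end

subsection \<open>Doubling the number of jumps\<close>

text \<open>The modulus of continuity shared by all of \<open>H_class b\<close>. For
  \<open>b = 1\<close> it is the norm, which brings the Lipschitz class under the same
  treatment.\<close>

definition hmod :: "real \<Rightarrow> 'a::euclidean_space \<Rightarrow> real" where
  "hmod b y = min (norm y) (norm y powr b)"

lemma hmod_borel[measurable]: "hmod b \<in> borel_measurable borel"
  unfolding hmod_def[abs_def] by measurable

lemma hmod_nonneg: "0 \<le> hmod b y"
  unfolding hmod_def by simp

lemma hmod_le_norm: "hmod b y \<le> norm y"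
  unfolding hmod_def by simp

lemma hmod_uminus: "hmod b (- y) = hmod b y"
  unfolding hmod_def by simp

lemma min_norm_le_hmod:
  assumes "0 < b" "b \<le> 1"
  shows "min (norm x) 1 \<le> hmod b x"
proof (cases "norm x \<le> 1")
  case True
  then have "norm x \<le> norm x powr b"
    using powr_mono'[of b 1 "norm x"] assms by (cases "x = 0") auto
  then show ?thesis by (simp add: hmod_def)
next
  case False
  then show ?thesis using assms by (simp add: hmod_def ge_one_powr_ge_zero)
qed

lemma H_class_shift_diff:
  assumes "h \<in> H_class b"
  shows "\<bar>shift_diff y h z\<bar> \<le> hmod b y"
proof -
  have "\<bar>h (z + y) - h z\<bar> \<le> min (norm (z + y - z)) (norm (z + y - z) powr b)"
    using assms unfolding H_class_def by blast
  then show ?thesis by (simp add: shift_diff_def hmod_def)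
qed

context jump_law
begin

definition sjump :: "real \<Rightarrow> 'a measure" where
  "sjump a = distr jump borel (\<lambda>y. a *\<^sub>R y)"

lemma sets_jump[measurable_cong]: "sets jump = sets borel"
  by (simp add: jump_def)

lemma sjump_fin_borel: "fin_borel (sjump a)" "measure (sjump a) UNIV = 1"
proof -
  interpret prob_space jump by (rule prob_jump)
  interpret s: prob_space "sjump a" unfolding sjump_def by (rule prob_space_distr) measurable
  show *: "fin_borel (sjump a)" unfolding fin_borel_def
    by (rule conjI[OF s.finite_measure_axioms]) (simp add: sjump_def)
  show "measure (sjump a) UNIV = 1" using s.prob_space unfolding fin_borelD(3)[OF *] .
qed

lemma integral_sjump:
  assumes [measurable]: "F \<in> borel_measurable borel"
  shows "(\<integral>y. F y \<partial>sjump a) = (\<integral>y. (F (a *\<^sub>R y) :: real) \<partial>jump)"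
  unfolding sjump_def by (subst integral_distr) auto

lemma avg_sjump:
  assumes "bmf F"
  shows "avg (sjump a) F z = (\<integral>y. F (z + a *\<^sub>R y) \<partial>jump)"
  unfolding avg_def using assms by (subst integral_sjump) (auto simp: bmf_def)

lemma bmf_scale: "bmf F \<Longrightarrow> bmf (\<lambda>w. F (a *\<^sub>R w))"
  unfolding bmf_def by auto

lemma bmf_uminus: "bmf F \<Longrightarrow> bmf (\<lambda>w. F (- w))"
  unfolding bmf_def by auto

lemma bmf_indicator_mult:
  assumes F: "bmf F" and [measurable]: "A \<in> sets borel"
  shows "bmf (\<lambda>y. indicator A y * F y)"
proof -
  have [measurable]: "F \<in> borel_measurable borel" using F unfolding bmf_def by simp
  obtain B where B: "\<And>x. \<bar>F x\<bar> \<le> B" using F unfolding bmf_def by auto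
  have "0 \<le> B" using B[of 0] by linarith
  then have "\<bar>indicator A y * F y\<bar> \<le> B" for y using B by (simp add: indicator_def)
  then show ?thesis unfolding bmf_def by (intro conjI exI[of _ B] allI) measurable
qed

lemma avg_sjump_scale:
  assumes "bmf F"
  shows "avg (sjump (a * c)) F (a *\<^sub>R z) = avg (sjump c) (\<lambda>w. F (a *\<^sub>R w)) z"
  using assms by (simp add: avg_sjump bmf_scale algebra_simps)

lemma sjump_1: "sjump 1 = jump"
  unfolding sjump_def using distr_id2[OF sets_jump[symmetric]] by (simp only: scaleR_one cong: distr_cong)

lemma avg_pow_sjump_scale:
  assumes "bmf F"
  shows "(avg (sjump a) ^^ m) F (a *\<^sub>R z) = (avg jump ^^ m) (\<lambda>w. F (a *\<^sub>R w)) z"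
proof (induction m arbitrary: z)
  case (Suc m)
  have "bmf ((avg (sjump a) ^^ m) F)" by (intro avg_pow sjump_fin_borel assms)
  from avg_sjump_scale[OF this, of a 1 z] Suc show ?case by (simp add: sjump_1)
qed simp

text \<open>Dilating space by \<open>a\<close> turns the shift by \<open>x\<close> into a shift by
  \<open>x / a\<close> and leaves the supremum bound on \<open>f\<close> unchanged.\<close>

lemma avg_pow_sjump_shift_diff_le:
  obtains K :: real where "0 < K"
    "\<And>a f c m x z. 0 < a \<Longrightarrow> bmf f \<Longrightarrow> (\<And>z. \<bar>f z\<bar> \<le> c) \<Longrightarrow>
      \<bar>(avg (sjump a) ^^ m) (shift_diff x f) z\<bar> \<le> K * (norm x / a + 1) * real (m + 1) powr (-1 / \<alpha>) * c"
proof -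
  obtain K :: real where K: "0 < K"
    "\<And>f c m x z. bmf f \<Longrightarrow> (\<And>z. \<bar>f z\<bar> \<le> c) \<Longrightarrow>
      \<bar>(avg jump ^^ m) (shift_diff x f) z\<bar> \<le> K * (norm x + 1) * real (m + 1) powr (-1 / \<alpha>) * c"
    by (rule avg_pow_shift_diff_le) blast
  show ?thesis
  proof (rule that[OF K(1)])
    fix a c :: real and f :: "'a \<Rightarrow> real" and m x z
    assume a: "0 < a" and f: "bmf f" "\<And>z. \<bar>f z\<bar> \<le> c"
    have "(avg (sjump a) ^^ m) (shift_diff x f) z = (avg (sjump a) ^^ m) (shift_diff x f) (a *\<^sub>R (z /\<^sub>R a))"
      using a by simp
    also have "\<dots> = (avg jump ^^ m) (\<lambda>w. shift_diff x f (a *\<^sub>R w)) (z /\<^sub>R a)"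
      by (rule avg_pow_sjump_scale) (intro bmf_shift_diff f)
    also have "(\<lambda>w. shift_diff x f (a *\<^sub>R w)) = shift_diff (x /\<^sub>R a) (\<lambda>w. f (a *\<^sub>R w))"
      using a by (auto simp: shift_diff_def algebra_simps)
    finally show "\<bar>(avg (sjump a) ^^ m) (shift_diff x f) z\<bar> \<le> K * (norm x / a + 1) * real (m + 1) powr (-1 / \<alpha>) * c"
      using K(2)[OF bmf_scale[OF f(1)] f(2), where m=m and x="x /\<^sub>R a" and z="z /\<^sub>R a"] a
      by (simp add: divide_inverse mult.commute)
  qed
qed

lemma AE_jump: "AE y in jump. 1 \<le> norm y"
proof -
  interpret prob_space jump by (rule prob_jump)
  have "prob (far 1 UNIV) = 1" using measure_far[of UNIV 1] nu(2) by simp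
  then have "AE y in jump. y \<in> far 1 UNIV" by (rule AE_prob_1)
  then show ?thesis by eventually_elim (auto simp: far_def)
qed

lemma integral_jump_uminus:
  assumes F: "bmf F"
  shows "(\<integral>y. F (- y) \<partial>jump) = (\<integral>y. F y \<partial>jump)"
proof -
  have [measurable]: "F \<in> borel_measurable borel" using F unfolding bmf_def by simp
  interpret p: prob_space "pareto \<alpha> 1" by (rule prob_pareto)
  have Fm: "bmf (\<lambda>y. F (- y))" using F unfolding bmf_def by auto
  have "(\<integral>y. F y \<partial>jump) = (\<integral>\<theta>. (\<integral>u. F (u *\<^sub>R \<theta>) \<partial>pareto \<alpha> 1) \<partial>distr \<nu> borel uminus)"
    unfolding nu_sym by (rule integral_jump[OF F])
  also have "\<dots> = (\<integral>\<theta>. (\<integral>u. F (u *\<^sub>R (- \<theta>)) \<partial>pareto \<alpha> 1) \<partial>\<nu>)"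
    by (subst integral_distr) auto
  also have "\<dots> = (\<integral>y. F (- y) \<partial>jump)" by (simp add: integral_jump[OF Fm])
  finally show ?thesis by simp
qed

definition halving :: real where "halving = 2 powr (-1 / \<alpha>)"

lemma halving: "0 < halving" "halving < 1" "halving powr \<alpha> = 1 / 2"
proof -
  show "halving < 1" unfolding halving_def using powr_less_mono[of "-1/\<alpha>" 0 2] alpha by simp
  show "halving powr \<alpha> = 1 / 2" unfolding halving_def powr_powr using alpha by (simp add: powr_minus_divide)
qed (simp add: halving_def)

text \<open>Substituting \<open>u / halving\<close> for the radius multiplies the Pareto density by
  \<open>halving powr \<alpha>\<close>, which is 1/2; this is what fixes the value of
  \<open>halving\<close>.\<close>

lemma integral_sjump_halving:
  assumes F: "bmf F"
  shows "(\<integral>y. indicator (- ball 0 1) y * F y \<partial>sjump halving) = (\<integral>y. F y \<partial>jump) / 2"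
proof -
  have [measurable]: "F \<in> borel_measurable borel" using F unfolding bmf_def by simp
  interpret p: prob_space "pareto \<alpha> 1" by (rule prob_pareto)
  have b: "bmf (\<lambda>y. indicator (- ball 0 1) (halving *\<^sub>R y) * F (halving *\<^sub>R y))"
    by (rule bmf_scale[OF bmf_indicator_mult[OF F]]) simp
  have "(\<integral>y. indicator (- ball 0 1) y * F y \<partial>sjump halving)
     = (\<integral>y. indicator (- ball 0 1) (halving *\<^sub>R y) * F (halving *\<^sub>R y) \<partial>jump)"
    by (subst integral_sjump) auto
  also have "\<dots> = (\<integral>\<theta>. (\<integral>u. indicator (- ball 0 1) (halving *\<^sub>R u *\<^sub>R \<theta>) * F (halving *\<^sub>R u *\<^sub>R \<theta>) \<partial>pareto \<alpha> 1) \<partial>\<nu>)"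
    using integral_jump[OF b] by simp
  also have "\<dots> = (\<integral>\<theta>. (\<integral>u. F (u *\<^sub>R \<theta>) \<partial>pareto \<alpha> 1) / 2 \<partial>\<nu>)"
  proof (rule integral_cong_AE)
    show "AE \<theta> in \<nu>. (\<integral>u. indicat_real (- ball 0 1) (halving *\<^sub>R u *\<^sub>R \<theta>) * F (halving *\<^sub>R u *\<^sub>R \<theta>) \<partial>pareto \<alpha> 1)
      = (\<integral>u. F (u *\<^sub>R \<theta>) \<partial>pareto \<alpha> 1) / 2"
      using nu(3)
    proof eventually_elim
      case (elim \<theta>)
      have pw: "\<alpha> * (u / halving) powr (-1 - \<alpha>) = halving * (\<alpha> * u powr (-1 - \<alpha>)) / 2" if "1 \<le> u" for u
      proof -
        have "halving powr (-1 - \<alpha>) * (halving powr 1 * halving powr \<alpha>) = 1"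
          unfolding powr_add[symmetric] using halving by simp
        note e = inverse_unique[OF this]
        have "(u / halving) powr (-1 - \<alpha>) = u powr (-1 - \<alpha>) / halving powr (-1 - \<alpha>)"
          by (rule powr_divide)
        also have "\<dots> = u powr (-1 - \<alpha>) * (halving powr 1 * halving powr \<alpha>)"
          by (simp only: divide_inverse e)
        finally show ?thesis using halving by simp
      qed
      have "(\<integral>u. indicat_real (- ball 0 1) (halving *\<^sub>R u *\<^sub>R \<theta>) * F (halving *\<^sub>R u *\<^sub>R \<theta>) \<partial>pareto \<alpha> 1)
        = (\<integral>u. \<alpha> * u powr (-1 - \<alpha>) * indicator {1..} u * (indicator (- ball 0 1) (halving *\<^sub>R u *\<^sub>R \<theta>) * F (halving *\<^sub>R u *\<^sub>R \<theta>)) \<partial>lborel)"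
        using alpha by (subst integral_pareto) auto
      also have "\<dots> = (\<integral>u. \<alpha> * (u / halving) powr (-1 - \<alpha>) * indicator {1..} (u / halving) * (indicator (- ball 0 1) (u *\<^sub>R \<theta>) * F (u *\<^sub>R \<theta>)) / halving \<partial>lborel)"
        using halving by (subst lborel_integral_real_affine[of "1 / halving" _ 0]) (auto simp: abs_if)
      also have "\<dots> = (\<integral>u. (\<alpha> * u powr (-1 - \<alpha>) * indicator {1..} u * F (u *\<^sub>R \<theta>)) / 2 \<partial>lborel)"
      proof (rule Bochner_Integration.integral_cong[OF refl])
        fix u :: real
        show "\<alpha> * (u / halving) powr (-1 - \<alpha>) * indicat_real {1..} (u / halving) * (indicat_real (- ball 0 1) (u *\<^sub>R \<theta>) * F (u *\<^sub>R \<theta>)) / halving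
          = (\<alpha> * u powr (-1 - \<alpha>) * indicat_real {1..} u * F (u *\<^sub>R \<theta>)) / 2"
        proof (cases "1 \<le> u")
          case True
          then have "1 \<le> u / halving" using halving by (simp add: field_simps)
          then show ?thesis unfolding pw[OF True] using True elim halving by (simp add: indicator_def)
        next
          case False
          then have "u *\<^sub>R \<theta> \<in> ball 0 1 \<or> u / halving < 1"
            using elim halving by (cases "0 \<le> u") (auto simp: field_simps)
          then show ?thesis using False by (auto simp: indicator_def)
        qed
      qed
      also have "\<dots> = (\<integral>u. F (u *\<^sub>R \<theta>) \<partial>pareto \<alpha> 1) / 2"
        using alpha by (subst integral_pareto) auto
      finally show ?case .
    qed
  qed measurable
  also have "\<dots> = (\<integral>y. F y \<partial>jump) / 2" by (simp add: integral_jump[OF F])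
  finally show ?thesis .
qed

end

lemma integral_abs_le:
  fixes f g :: "'b \<Rightarrow> real"
  assumes g: "integrable M g" and le: "AE x in M. \<bar>f x\<bar> \<le> g x"
  shows "\<bar>\<integral>x. f x \<partial>M\<bar> \<le> (\<integral>x. g x \<partial>M)"
proof (cases "integrable M f")
  case True
  have "\<bar>\<integral>x. f x \<partial>M\<bar> \<le> (\<integral>x. \<bar>f x\<bar> \<partial>M)" by (rule integral_abs_bound)
  also have "\<dots> \<le> (\<integral>x. g x \<partial>M)" using True g le by (intro integral_mono_AE) auto
  finally show ?thesis .
next
  case False
  have "0 \<le> (\<integral>x. g x \<partial>M)"
    using le by (intro integral_nonneg_AE, eventually_elim) (meson abs_ge_zero order_trans)
  then show ?thesis using False by (simp add: not_integrable_integral_eq)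
qed

context jump_law
begin

lemma avg_minus_id:
  assumes F: "bmf F"
  shows "avg (sjump a) F z - F z = (\<integral>y. shift_diff (a *\<^sub>R y) F z \<partial>jump)"
proof -
  interpret prob_space jump by (rule prob_jump)
  have "integrable jump (\<lambda>y. F (z + a *\<^sub>R y))"
    using bmf_integrable[OF jump_fin_borel(1) bmf_scale[OF bmf_shift'[OF F]]] .
  then show ?thesis unfolding shift_diff_def avg_sjump[OF F] by (simp add: prob_space)
qed

text \<open>Write \<open>S\<close> and \<open>J\<close> for the averages over the halved and the
  full jump. Then \<open>S S - J\<close> is the square of \<open>S - 1\<close> plus
  \<open>2 S - J - 1\<close>. The square is a second difference over two jumps. By the previous
  identity, \<open>2 S - J\<close> is twice the part of \<open>S\<close> inside the unit ball, which
  is symmetric of mass 1/2; so the rest is an average of symmetric second differences over short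
  jumps.\<close>

lemma halving_doubling:
  assumes G: "bmf G" and w[measurable]: "w \<in> borel_measurable borel" "\<And>y. 0 \<le> w y" "\<And>y. w (- y) = w y"
    and wi: "integrable jump (\<lambda>y. w (halving *\<^sub>R y))"
    and C: "0 \<le> C" and bd: "\<And>x y z. halving \<le> norm x \<Longrightarrow> \<bar>shift_diff x (shift_diff y G) z\<bar> \<le> C * w x * w y"
    and s: "\<And>y. norm y \<le> 1 \<Longrightarrow> w y \<le> s"
  shows "\<bar>avg (sjump halving) (avg (sjump halving) G) z - avg jump G z\<bar>
    \<le> C * ((\<integral>y. w (halving *\<^sub>R y) \<partial>jump)\<^sup>2 + s\<^sup>2)"
proof -
  interpret prob_space jump by (rule prob_jump)
  let ?S = "sjump halving"
  interpret S: finite_measure ?S by (rule fin_borelD(1)[OF sjump_fin_borel(1)])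
  have [measurable]: "G \<in> borel_measurable borel" using G unfolding bmf_def by simp
  have [measurable_cong]: "sets ?S = sets borel" by (simp add: sjump_def)
  note h = halving
  define J where "J = (\<integral>y. w (halving *\<^sub>R y) \<partial>jump)"
  define D where "D = (\<lambda>F z. avg ?S F z - F z)"
  have bD: "bmf (D F)" if "bmf F" for F
    unfolding D_def using that by (intro bmf_diff bmf_avg sjump_fin_borel)
  have AEh: "AE y in jump. halving \<le> norm (halving *\<^sub>R y)"
    using AE_jump by eventually_elim (use h in simp)
  have sdc: "shift_diff x (shift_diff y F) = shift_diff y (shift_diff x F)" for x y :: 'a and F :: "'a \<Rightarrow> real"
    by (auto simp: shift_diff_def ac_simps)
  \<comment> \<open>Only one of the two increments has to be at least \<open>halving\<close> in
    \<open>bd\<close>. Since differences commute, the jump takes that place and \<open>x\<close>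
    stays arbitrary.\<close>
  have inner: "\<bar>shift_diff x (D G) z\<bar> \<le> C * J * w x" for x z
  proof -
    have "shift_diff x (D G) z = D (shift_diff x G) z"
      unfolding D_def avg_shift_diff[OF sjump_fin_borel(1) G] by (simp add: shift_diff_def)
    also have "\<dots> = (\<integral>y. shift_diff (halving *\<^sub>R y) (shift_diff x G) z \<partial>jump)"
      unfolding D_def by (intro avg_minus_id bmf_shift_diff G)
    finally have "\<bar>shift_diff x (D G) z\<bar> \<le> (\<integral>y. C * w x * w (halving *\<^sub>R y) \<partial>jump)"
    proof (simp only:, intro integral_abs_le)
      show "AE y in jump. \<bar>shift_diff (halving *\<^sub>R y) (shift_diff x G) z\<bar> \<le> C * w x * w (halving *\<^sub>R y)"
        using AEh
      proof eventually_elim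
        case (elim y)
        then show ?case using bd[of "halving *\<^sub>R y" x z] by (simp add: ac_simps)
      qed
    qed (use wi in simp)
    then show ?thesis by (simp add: J_def ac_simps)
  qed
  have 1: "\<bar>D (D G) z\<bar> \<le> C * J\<^sup>2"
  proof -
    have "\<bar>D (D G) z\<bar> \<le> (\<integral>x. C * J * w (halving *\<^sub>R x) \<partial>jump)"
    proof -
      have "D (D G) z = (\<integral>x. shift_diff (halving *\<^sub>R x) (D G) z \<partial>jump)"
        using avg_minus_id[OF bD[OF G]] by (simp add: D_def)
      then show ?thesis using inner wi by (simp only:, intro integral_abs_le) auto
    qed
    then show ?thesis by (simp add: J_def power2_eq_square ac_simps)
  qed
  define near :: "('a \<Rightarrow> real) \<Rightarrow> real" where "near = (\<lambda>F. \<integral>y. indicator (ball 0 1) y * F y \<partial>?S)"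
  have ib: "integrable ?S (\<lambda>y. indicator A y * F y)" if "bmf F" and [measurable]: "A \<in> sets borel" for F A
    using bmf_integrable[OF sjump_fin_borel(1)[of halving] that(1)] that(2)
    by (intro integrable_mult_indicator[where 'b=real, simplified]) auto
  have split: "(\<integral>y. F y \<partial>?S) = near F + (\<integral>y. F y \<partial>jump) / 2" if "bmf F" for F
  proof -
    have "(\<integral>y. F y \<partial>?S) = (\<integral>y. indicator (ball 0 1) y * F y + indicator (- ball 0 1) y * F y \<partial>?S)"
      by (intro Bochner_Integration.integral_cong) (auto simp: indicator_def)
    also have "\<dots> = near F + (\<integral>y. indicator (- ball 0 1) y * F y \<partial>?S)"
      unfolding near_def using that by (intro Bochner_Integration.integral_add ib) auto
    finally show ?thesis using integral_sjump_halving[OF that] by simp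
  qed
  have near_lin: "near (\<lambda>y. F y + F' y) = near F + near F'" if "bmf F" "bmf F'" for F F'
  proof -
    have "near (\<lambda>y. F y + F' y) = (\<integral>y. indicator (ball 0 1) y * F y + indicator (ball 0 1) y * F' y \<partial>?S)"
      unfolding near_def by (simp add: distrib_left)
    also have "\<dots> = near F + near F'"
      unfolding near_def by (intro Bochner_Integration.integral_add ib that) auto
    finally show ?thesis .
  qed
  have bc: "bmf (\<lambda>y. c)" for c by (auto simp: bmf_def)
  \<comment> \<open>The splitting identity for constants shows that the inner part has mass
    1/2.\<close>
  have near_const: "near (\<lambda>y. c) = c / 2" for c
    using split[OF bc, of c] sjump_fin_borel fin_borelD(3)[OF sjump_fin_borel(1)] prob_space by simp
  have near_sym: "near (\<lambda>y. F (- y)) = near F" if F: "bmf F" for F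
  proof -
    have [measurable]: "F \<in> borel_measurable borel" using F unfolding bmf_def by simp
    have b: "bmf (\<lambda>y. indicator (ball 0 1) (halving *\<^sub>R y) * F (halving *\<^sub>R y))"
      by (rule bmf_scale[OF bmf_indicator_mult[OF F]]) simp
    have i: "indicat_real (ball 0 1) (- y) = indicator (ball 0 1) y" for y :: 'a
      by (auto simp: indicator_def)
    have Fm: "bmf (\<lambda>y. F (- y))" by (rule bmf_uminus[OF F])
    have "near (\<lambda>y. F (- y)) = (\<integral>y. indicator (ball 0 1) (halving *\<^sub>R y) * F (- (halving *\<^sub>R y)) \<partial>jump)"
      unfolding near_def using bmf_indicator_mult[OF Fm, of "ball 0 1"]
      by (intro integral_sjump) (simp add: bmf_def)
    moreover have "near F = (\<integral>y. indicator (ball 0 1) (halving *\<^sub>R y) * F (halving *\<^sub>R y) \<partial>jump)"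
      unfolding near_def using bmf_indicator_mult[OF F, of "ball 0 1"]
      by (intro integral_sjump) (simp add: bmf_def)
    ultimately show ?thesis
      using integral_jump_uminus[OF b] i by simp
  qed
  have 2: "\<bar>2 * avg ?S G z - avg jump G z - G z\<bar> \<le> C * s\<^sup>2"
  proof -
    have Gz: "bmf (\<lambda>y. G (z + y))" by (intro bmf_shift' G)
    then have Gz': "bmf (\<lambda>y. G (z - y))" using bmf_uminus by fastforce
    have "2 * avg ?S G z - avg jump G z - G z = 2 * near (\<lambda>y. G (z + y)) - G z"
      unfolding avg_def split[OF Gz] by simp
    also have "\<dots> = near (\<lambda>y. G (z + y)) + near (\<lambda>y. G (z - y)) + near (\<lambda>y. - 2 * G z)"
      using near_sym[OF Gz] near_const[of "- 2 * G z"] by simp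
    also have "\<dots> = near (\<lambda>y. G (z + y) + G (z - y) + - 2 * G z)"
      using near_lin[OF bmf_add[OF Gz Gz'] bc, of "- 2 * G z"] near_lin[OF Gz Gz'] by simp
    finally have "\<bar>2 * avg ?S G z - avg jump G z - G z\<bar> \<le> (\<integral>y. C * s\<^sup>2 \<partial>?S)"
      unfolding near_def
    proof (simp only:, intro integral_abs_le)
      have "AE y in ?S. halving \<le> norm y"
        unfolding sjump_def using AEh by (subst AE_distr_iff) auto
      then show "AE y in ?S. \<bar>indicator (ball 0 1) y * (G (z + y) + G (z - y) + - 2 * G z)\<bar> \<le> C * s\<^sup>2"
      proof eventually_elim
        case (elim y)
        show ?case
        proof (cases "y \<in> ball 0 1")
          case True
          \<comment> \<open>Up to sign, the symmetric second difference is the iterated difference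
            over \<open>- y\<close> and \<open>y\<close>, so \<open>bd\<close> applies to
            it.\<close>
          have "G (z + y) + G (z - y) + - 2 * G z = - shift_diff y (shift_diff (- y) G) z"
            by (simp add: shift_diff_def)
          then have "\<bar>G (z + y) + G (z - y) + - 2 * G z\<bar> \<le> C * w y * w (- y)"
            using bd[OF elim, of "- y" z] by simp
          also have "\<dots> \<le> C * (s * s)"
            unfolding w(3) mult.assoc using True C w(2)[of y] s[of y] by (intro mult_left_mono mult_mono) auto
          finally show ?thesis using True by (simp add: power2_eq_square)
        qed (use C in simp)
      qed
    qed simp
    then show ?thesis using sjump_fin_borel fin_borelD(3)[OF sjump_fin_borel(1)] by simp
  qed
  have "D (D G) z = avg ?S (avg ?S G) z - 2 * avg ?S G z + G z"
    unfolding D_def by (subst avg_diff[OF sjump_fin_borel(1) bmf_avg[OF sjump_fin_borel(1) G] G]) simp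
  then have "avg ?S (avg ?S G) z - avg jump G z = D (D G) z + (2 * avg ?S G z - avg jump G z - G z)"
    by simp
  then show ?thesis using 1 2 unfolding J_def distrib_left by linarith
qed

lemma doubling_step:
  assumes G: "bmf G" and a: "0 < a" and b: "0 < b" "b \<le> 1"
    and ji: "integrable jump (\<lambda>y. hmod b ((halving * a) *\<^sub>R y))"
    and C: "0 \<le> C"
    and bd: "\<And>x y z. halving * a \<le> norm x \<Longrightarrow> \<bar>shift_diff x (shift_diff y G) z\<bar> \<le> C * hmod b x * hmod b y"
  shows "\<bar>avg (sjump (halving * a)) (avg (sjump (halving * a)) G) z - avg (sjump a) G z\<bar>
    \<le> C * ((\<integral>y. hmod b ((halving * a) *\<^sub>R y) \<partial>jump)\<^sup>2 + a\<^sup>2)"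
proof -
  let ?G = "\<lambda>w. G (a *\<^sub>R w)"
  let ?S = "sjump halving" and ?S' = "sjump (halving * a)"
  have sd: "shift_diff x (shift_diff y ?G) u = shift_diff (a *\<^sub>R x) (shift_diff (a *\<^sub>R y) G) (a *\<^sub>R u)" for x y u
    by (simp add: shift_diff_def algebra_simps)
  have sc: "avg ?S' F (a *\<^sub>R w) = avg ?S (\<lambda>w. F (a *\<^sub>R w)) w" if "bmf F" for F w
    using avg_sjump_scale[OF that, of a halving w] by (simp add: mult.commute)
  have "\<bar>avg ?S (avg ?S ?G) (z /\<^sub>R a) - avg jump ?G (z /\<^sub>R a)\<bar>
    \<le> C * ((\<integral>y. hmod b (a *\<^sub>R halving *\<^sub>R y) \<partial>jump)\<^sup>2 + a\<^sup>2)"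
  proof (rule halving_doubling)
    show "\<bar>shift_diff x (shift_diff y ?G) u\<bar> \<le> C * hmod b (a *\<^sub>R x) * hmod b (a *\<^sub>R y)" if "halving \<le> norm x" for x y u
      unfolding sd using that a by (intro bd) (simp add: mult.commute)
    show "hmod b (a *\<^sub>R y) \<le> a" if "norm y \<le> 1" for y :: 'a
      using hmod_le_norm[of b "a *\<^sub>R y"] mult_left_mono[OF that less_imp_le[OF a]] a
      by (simp add: order_trans)
  qed (use ji C in \<open>auto simp: hmod_nonneg hmod_uminus mult.commute intro!: bmf_scale G\<close>)
  moreover have "avg ?S (avg ?S ?G) (z /\<^sub>R a) = avg ?S' (avg ?S' G) z"
    using a by (subst sc[symmetric, OF G, abs_def], subst sc[symmetric, OF bmf_avg[OF sjump_fin_borel(1) G]]) simp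
  moreover have "avg jump ?G (z /\<^sub>R a) = avg (sjump a) G z"
    using avg_sjump_scale[OF G, of a 1 "z /\<^sub>R a"] a by (simp add: sjump_1)
  ultimately show ?thesis by (simp add: mult.commute)
qed

definition step_size :: "real \<Rightarrow> nat \<Rightarrow> real" where
  "step_size c n = c * real n powr (-1 / \<alpha>)"

lemma step_size_pos: "0 < c \<Longrightarrow> 1 \<le> n \<Longrightarrow> 0 < step_size c n"
  by (simp add: step_size_def)

lemma step_size_double: "step_size c (2 * n) = halving * step_size c n"
  by (simp add: step_size_def halving_def powr_mult)

definition mean_hmod :: "real \<Rightarrow> real \<Rightarrow> real" where
  "mean_hmod b a = (\<integral>y. hmod b (a *\<^sub>R y) \<partial>jump)"

text \<open>One of the two kinds of jumps is always numerous, about \<open>n / 2\<close> of them at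
  least, and absorbs the difference over \<open>x\<close>; the difference over \<open>y\<close> is
  spent on the modulus of \<open>h\<close>. The lower bound on \<open>norm x\<close> swallows the
  jump size in the smoothing estimate, and for large \<open>x\<close> the trivial bound takes over,
  so that \<open>min (norm x) 1\<close> appears, which \<open>hmod b x\<close> dominates.\<close>

lemma shift_diff_shift_diff_le:
  assumes b: "0 < b" "b \<le> 1" and c: "0 < c"
  obtains C :: real where "0 < C"
    "\<And>h n k x y z. bmf h \<Longrightarrow> h \<in> H_class b \<Longrightarrow> k < n \<Longrightarrow> step_size c (2 * n) \<le> norm x \<Longrightarrow>
      \<bar>shift_diff x (shift_diff y ((avg (sjump (step_size c n)) ^^ k)
          ((avg (sjump (step_size c (2 * n))) ^^ (2 * (n - 1 - k))) h))) z\<bar> \<le> C * hmod b x * hmod b y"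
proof -
  obtain K :: real where K: "0 < K"
    "\<And>a f c m x z. 0 < a \<Longrightarrow> bmf f \<Longrightarrow> (\<And>z. \<bar>f z\<bar> \<le> c) \<Longrightarrow>
      \<bar>(avg (sjump a) ^^ m) (shift_diff x f) z\<bar> \<le> K * (norm x / a + 1) * real (m + 1) powr (-1 / \<alpha>) * c"
    by (rule avg_pow_sjump_shift_diff_le) blast
  \<comment> \<open>The inverse of \<open>halving\<close>, that is, the ratio of the full to the
    halved step size.\<close>
  define t :: real where "t = 2 powr (1 / \<alpha>)"
  have t1: "1 \<le> t" unfolding t_def using alpha by (intro ge_one_powr_ge_zero) auto
  define C1 where "C1 = K * t * (1 + t) / c"
  have C1: "0 < C1" unfolding C1_def using K(1) t1 c by simp
  have key: "\<bar>shift_diff x (shift_diff y ((avg (sjump (step_size c n)) ^^ k)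
          ((avg (sjump (step_size c (2 * n))) ^^ (2 * (n - 1 - k))) h))) z\<bar> \<le> (C1 + 2) * hmod b x * hmod b y"
    if h: "bmf h" "h \<in> H_class b" and kn: "k < n" and x: "step_size c (2 * n) \<le> norm x" for h n k x y z
  proof -
    let ?a = "step_size c n" and ?a' = "step_size c (2 * n)"
    let ?A = "sjump ?a" and ?B = "sjump ?a'"
    let ?j = "2 * (n - 1 - k)"
    define f where "f = shift_diff y h"
    have f: "bmf f" "\<And>z. \<bar>f z\<bar> \<le> hmod b y"
      unfolding f_def using h by (auto intro: bmf_shift_diff H_class_shift_diff)
    have n1: "1 \<le> n" using kn by simp
    have a: "0 < ?a" "0 < ?a'" using step_size_pos[OF c] n1 by auto
    have at: "?a = t * ?a'"
      unfolding step_size_double t_def halving_def by (simp add: powr_minus_divide)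
    note S = sjump_fin_borel
    have sh: "bmf (shift_diff y F)" if "bmf F" for F y using that by (rule bmf_shift_diff)
    have bB: "bmf ((avg ?B ^^ ?j) F)" "bmf ((avg ?A ^^ k) F)" if "bmf F" for F
      using that by (auto intro: avg_pow S)
    have eq: "shift_diff x (shift_diff y ((avg ?A ^^ k) ((avg ?B ^^ ?j) h))) = (avg ?A ^^ k) ((avg ?B ^^ ?j) (shift_diff x f))"
      unfolding f_def by (simp only: avg_pow(2)[OF S(1)] h(1) sh bB)
    have bdB: "\<bar>(avg ?B ^^ i) f w\<bar> \<le> hmod b y" for i w
      by (intro avg_pow_abs_le S hmod_nonneg f)
    have bdA: "\<bar>(avg ?A ^^ i) f w\<bar> \<le> hmod b y" for i w
      by (intro avg_pow_abs_le S hmod_nonneg f)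
    have dx: "\<bar>shift_diff x f w\<bar> \<le> 2 * hmod b y" for w
      using f(2)[of "w + x"] f(2)[of w] unfolding shift_diff_def by linarith
    have triv: "\<bar>(avg ?A ^^ k) ((avg ?B ^^ ?j) (shift_diff x f)) z\<bar> \<le> 2 * hmod b y"
      using dx by (intro avg_pow_abs_le[OF S] avg_pow_abs_le[OF S]) (auto simp: hmod_nonneg)
    have alg: "K * (p / q + 1) * (t * q / c) * w = K * t / c * (p + q) * w" if "0 < q" for p q w :: real
      using that c by (simp add: field_simps)
    have pw: "real (m + 1) powr (-1 / \<alpha>) \<le> t * ?a / c" if "n \<le> 2 * (m + 1)" for m
    proof -
      have "real n \<le> real (2 * (m + 1))" using that by (rule of_nat_mono)
      then have "real n / 2 \<le> real (m + 1)" by simp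
      then have "real (m + 1) powr (-1 / \<alpha>) \<le> (real n / 2) powr (-1 / \<alpha>)"
        using n1 alpha by (intro powr_mono2') auto
      also have "\<dots> = t * ?a / c"
        using c n1 by (simp add: powr_divide step_size_def t_def powr_minus_divide)
      finally show ?thesis .
    qed
    have "\<bar>(avg ?A ^^ k) ((avg ?B ^^ ?j) (shift_diff x f)) z\<bar> \<le> C1 * norm x * hmod b y"
    proof (cases "n \<le> 2 * (k + 1)")
      case True
      have "\<bar>(avg ?A ^^ k) (shift_diff x ((avg ?B ^^ ?j) f)) z\<bar>
          \<le> K * (norm x / ?a + 1) * real (k + 1) powr (-1 / \<alpha>) * hmod b y"
        by (intro K(2) a bB f bdB)
      also have "\<dots> \<le> K * (norm x / ?a + 1) * (t * ?a / c) * hmod b y"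
        using K(1) a by (intro mult_right_mono mult_left_mono pw True hmod_nonneg) auto
      also have "\<dots> = K * t / c * (norm x + ?a) * hmod b y"
        using alg a by blast
      also have "\<dots> \<le> K * t / c * (norm x + t * norm x) * hmod b y"
        unfolding at using K(1) t1 c x
        by (intro mult_right_mono mult_left_mono add_left_mono hmod_nonneg) auto
      also have "\<dots> = C1 * norm x * hmod b y" by (simp add: C1_def field_simps)
      finally show ?thesis by (simp only: avg_pow(2)[OF S(1) f(1)])
    next
      \<comment> \<open>Here \<open>2 * (k + 1) < n\<close>, so more than \<open>n\<close> halved
        jumps are present and do the smoothing.\<close>
      case False
      have "\<bar>(avg ?B ^^ ?j) (shift_diff x ((avg ?A ^^ k) f)) z\<bar>
          \<le> K * (norm x / ?a' + 1) * real (?j + 1) powr (-1 / \<alpha>) * hmod b y"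
        by (intro K(2) a bB f bdA)
      also have "\<dots> \<le> K * (norm x / ?a' + 1) * (t * ?a' / c) * hmod b y"
      proof -
        have "real n \<le> real (?j + 1)" using False kn by (intro of_nat_mono) auto
        then have "real (?j + 1) powr (-1 / \<alpha>) \<le> real n powr (-1 / \<alpha>)"
          using n1 alpha by (intro powr_mono2') auto
        also have "\<dots> = t * ?a' / c" unfolding at[symmetric] using c by (simp add: step_size_def)
        finally show ?thesis using K(1) a
          by (intro mult_right_mono mult_left_mono hmod_nonneg) auto
      qed
      also have "\<dots> = K * t / c * (norm x + ?a') * hmod b y"
        using alg a by blast
      also have "\<dots> \<le> K * t / c * (norm x + t * norm x) * hmod b y"
      proof -
        have "1 * ?a' \<le> t * norm x" using t1 x a by (intro mult_mono) auto
        then show ?thesis using K(1) t1 c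
          by (intro mult_right_mono mult_left_mono add_left_mono hmod_nonneg) auto
      qed
      also have "\<dots> = C1 * norm x * hmod b y" by (simp add: C1_def field_simps)
      finally have "\<bar>(avg ?B ^^ ?j) ((avg ?A ^^ k) (shift_diff x f)) z\<bar> \<le> C1 * norm x * hmod b y"
        by (simp only: avg_pow(2)[OF S(1) f(1)])
      then show ?thesis by (simp only: avg_pow_comm[OF S(1) S(1) sh[OF f(1)]])
    qed
    then have "\<bar>shift_diff x (shift_diff y ((avg ?A ^^ k) ((avg ?B ^^ ?j) h))) z\<bar> \<le> min (C1 * norm x) 2 * hmod b y"
      unfolding eq using triv by (simp add: min_def)
    also have "\<dots> \<le> ((C1 + 2) * hmod b x) * hmod b y"
    proof (intro mult_right_mono hmod_nonneg)
      have "min (C1 * norm x) 2 \<le> (C1 + 2) * min (norm x) 1"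
      proof (cases "norm x \<le> 1")
        case True
        have "C1 * norm x \<le> (C1 + 2) * norm x" by (intro mult_right_mono) auto
        then show ?thesis using True by (simp add: min_le_iff_disj)
      next
        case False
        then show ?thesis using C1 by (simp add: min_le_iff_disj)
      qed
      also have "\<dots> \<le> (C1 + 2) * hmod b x"
        using C1 by (intro mult_left_mono min_norm_le_hmod b) auto
      finally show "min (C1 * norm x) 2 \<le> (C1 + 2) * hmod b x" .
    qed
    finally show ?thesis .
  qed
  show ?thesis by (rule that[of "C1 + 2"]) (use C1 key in auto)
qed

text \<open>Lindeberg exchange: \<open>T k\<close> belongs to a sum of \<open>k\<close> full and
  \<open>2 * (n - k)\<close> halved jumps, so consecutive terms differ by one doubling step and the
  differences telescope.\<close>

lemma avg_pow_double_diff: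
  assumes b: "0 < b" "b \<le> 1" and c: "0 < c"
    and ji: "\<And>a. integrable jump (\<lambda>y. hmod b (a *\<^sub>R y))"
  obtains C :: real where "0 < C"
    "\<And>h n z. bmf h \<Longrightarrow> h \<in> H_class b \<Longrightarrow> 1 \<le> n \<Longrightarrow>
      \<bar>(avg (sjump (step_size c n)) ^^ n) h z - (avg (sjump (step_size c (2 * n))) ^^ (2 * n)) h z\<bar>
        \<le> C * (real n * ((mean_hmod b (step_size c (2 * n)))\<^sup>2 + (step_size c n)\<^sup>2))"
proof -
  obtain C :: real where C: "0 < C"
    "\<And>h n k x y z. bmf h \<Longrightarrow> h \<in> H_class b \<Longrightarrow> k < n \<Longrightarrow> step_size c (2 * n) \<le> norm x \<Longrightarrow>
      \<bar>shift_diff x (shift_diff y ((avg (sjump (step_size c n)) ^^ k)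
          ((avg (sjump (step_size c (2 * n))) ^^ (2 * (n - 1 - k))) h))) z\<bar> \<le> C * hmod b x * hmod b y"
    by (rule shift_diff_shift_diff_le[OF b c]) blast
  have key: "\<bar>(avg (sjump (step_size c n)) ^^ n) h z - (avg (sjump (step_size c (2 * n))) ^^ (2 * n)) h z\<bar>
        \<le> C * (real n * ((mean_hmod b (step_size c (2 * n)))\<^sup>2 + (step_size c n)\<^sup>2))"
    if h: "bmf h" "h \<in> H_class b" and n: "1 \<le> n" for h n z
  proof -
    let ?a = "step_size c n" and ?a' = "step_size c (2 * n)"
    let ?A = "sjump ?a" and ?B = "sjump ?a'"
    have a: "0 < ?a" using step_size_pos[OF c n] .
    have a': "halving * ?a = ?a'" by (simp add: step_size_double)
    note S = sjump_fin_borel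
    define e where "e = C * ((mean_hmod b ?a')\<^sup>2 + ?a\<^sup>2)"
    define T where "T = (\<lambda>k. (avg ?A ^^ k) ((avg ?B ^^ (2 * (n - k))) h))"
    have "\<bar>T (Suc k) z - T k z\<bar> \<le> e" if "k < n" for k
    proof -
      define g where "g = (avg ?A ^^ k) ((avg ?B ^^ (2 * (n - 1 - k))) h)"
      have bB: "bmf ((avg ?B ^^ m) h)" for m by (intro avg_pow S h)
      have g: "bmf g" unfolding g_def by (intro avg_pow S h)
      have 1: "T (Suc k) = avg ?A g" unfolding T_def g_def using that by (simp add: Suc_diff_Suc)
      have "2 * (n - k) = Suc (Suc (2 * (n - 1 - k)))" using that by linarith
      then have 2: "T k = avg ?B (avg ?B g)"
        unfolding T_def g_def by (simp add: avg_pow(3)[OF S(1) _ S(1)] bB bmf_avg S)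
      have "\<bar>avg ?B (avg ?B g) z - avg ?A g z\<bar> \<le> e"
        unfolding e_def mean_hmod_def
        by (rule doubling_step[OF g a b, unfolded a'])
          (use C ji h that in \<open>auto simp: g_def\<close>)
      then show ?thesis unfolding 1 2 by linarith
    qed
    then have "\<bar>\<Sum>k<n. T (Suc k) z - T k z\<bar> \<le> (\<Sum>k<n. e)"
      by (intro order_trans[OF sum_abs] sum_mono) auto
    then show ?thesis
      unfolding sum_lessThan_telescope[of "\<lambda>k. T k z"] by (simp add: T_def e_def algebra_simps)
  qed
  show ?thesis by (rule that[OF C(1) key])
qed

end

subsection \<open>Continuity theorem for characteristic functions\<close>

lemma has_bochner_integral_prod_Basis:
  fixes g :: "'a::euclidean_space \<Rightarrow> real \<Rightarrow> 'b::{real_normed_field,banach,second_countable_topology}"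
  assumes g: "\<And>b. b \<in> Basis \<Longrightarrow> integrable lborel (g b)"
  shows "has_bochner_integral lborel (\<lambda>x. \<Prod>b\<in>Basis. g b (x \<bullet> b)) (\<Prod>b\<in>Basis. \<integral>u. g b u \<partial>lborel)"
proof -
  interpret product_sigma_finite "\<lambda>b::'a. lborel :: real measure" by standard
  let ?T = "\<lambda>f::'a \<Rightarrow> real. \<Sum>b\<in>Basis. f b *\<^sub>R b"
  have [measurable]: "\<And>b. b \<in> Basis \<Longrightarrow> g b \<in> borel_measurable borel"
    using borel_measurable_integrable[OF g] by simp
  have m: "(\<lambda>x. \<Prod>b\<in>Basis. g b (x \<bullet> b)) \<in> borel_measurable borel"
    by (intro borel_measurable_prod measurable_compose[OF _ \<open>_ \<Longrightarrow> g _ \<in> borel_measurable borel\<close>]) auto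
  have T: "?T \<in> (\<Pi>\<^sub>M b\<in>Basis. lborel) \<rightarrow>\<^sub>M borel" by measurable
  have eq: "(\<Prod>b\<in>Basis. g b (?T f \<bullet> b)) = (\<Prod>b\<in>Basis. g b (f b))" for f
    by (intro prod.cong refl) (simp add: inner_sum_left inner_Basis if_distrib sum.delta cong: if_cong)
  have "integrable (\<Pi>\<^sub>M b\<in>Basis. lborel) (\<lambda>f. \<Prod>b\<in>Basis. g b (f b))"
    by (rule product_integrable_prod) (auto intro: g)
  moreover have "(\<integral>f. (\<Prod>b\<in>Basis. g b (f b)) \<partial>(\<Pi>\<^sub>M b\<in>Basis. lborel)) = (\<Prod>b\<in>Basis. \<integral>u. g b u \<partial>lborel)"
    by (rule product_integral_prod) (auto intro: g)
  ultimately show ?thesis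
    unfolding has_bochner_integral_iff
    by (subst lborel_eq, subst integrable_distr_eq[OF T m], subst lborel_eq, subst integral_distr[OF T m]) (simp add: eq)
qed

definition gauss :: "'a::euclidean_space \<Rightarrow> real" where
  "gauss x = (\<Prod>b\<in>Basis. std_normal_density (x \<bullet> b))"

lemma gauss_nonneg: "0 \<le> gauss x"
  unfolding gauss_def by (intro prod_nonneg) simp

lemma gauss_borel[measurable]: "gauss \<in> borel_measurable borel"
  unfolding gauss_def[abs_def] by measurable

lemma has_integral_gauss: "has_bochner_integral lborel (gauss :: 'a::euclidean_space \<Rightarrow> real) 1"
proof -
  have "has_bochner_integral lborel (\<lambda>x::'a. \<Prod>b\<in>Basis. std_normal_density (x \<bullet> b)) (\<Prod>b\<in>(Basis :: 'a set). \<integral>u. std_normal_density u \<partial>lborel)"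
    by (rule has_bochner_integral_prod_Basis) simp
  then show ?thesis unfolding gauss_def[abs_def] by simp
qed

text \<open>The standard Gaussian is its own Fourier transform up to a constant, by the
  one-dimensional normal characteristic function in each coordinate. This is the only inversion
  formula that the continuity theorem needs.\<close>

lemma gauss_eq_integral_iexp:
  fixes x :: "'a::euclidean_space"
  shows "complex_of_real (gauss x) = (\<integral>l. gauss l *\<^sub>R iexp (l \<bullet> x) \<partial>lborel) / of_real (sqrt (2 * pi) ^ DIM('a))"
proof -
  define g where "g = (\<lambda>b u. std_normal_density u *\<^sub>R iexp (u * (x \<bullet> b)))"
  have ig: "integrable lborel (g b)" for b
    unfolding g_def
  proof (rule Bochner_Integration.integrable_bound)
    show "integrable lborel std_normal_density" by simp
  qed auto
  have "(\<integral>u. g b u \<partial>lborel) = of_real (sqrt (2 * pi) * std_normal_density (x \<bullet> b))" for b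
  proof -
    have "(\<integral>u. g b u \<partial>lborel) = char std_normal_distribution (x \<bullet> b)"
      unfolding char_def g_def by (subst integral_density) (auto simp: mult.commute)
    also have "\<dots> = of_real (sqrt (2 * pi) * std_normal_density (x \<bullet> b))"
      unfolding char_std_normal_distribution by (simp add: std_normal_density_def)
    finally show ?thesis .
  qed
  moreover have "(\<Prod>b\<in>Basis. g b (l \<bullet> b)) = gauss l *\<^sub>R iexp (l \<bullet> x)" for l
  proof -
    have "(\<Prod>b\<in>Basis. g b (l \<bullet> b)) = complex_of_real (gauss l) * (\<Prod>b\<in>Basis. iexp ((l \<bullet> b) * (x \<bullet> b)))"
      unfolding g_def gauss_def by (simp add: prod.distrib scaleR_conv_of_real)
    also have "(\<Prod>b\<in>Basis. iexp ((l \<bullet> b) * (x \<bullet> b))) = iexp (l \<bullet> x)"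
      by (subst euclidean_inner[of l x]) (simp add: exp_sum[symmetric] sum_distrib_left)
    finally show ?thesis by (simp add: scaleR_conv_of_real)
  qed
  ultimately have "(\<integral>l. gauss l *\<^sub>R iexp (l \<bullet> x) \<partial>lborel) = (\<Prod>b\<in>(Basis :: 'a set). of_real (sqrt (2 * pi) * std_normal_density (x \<bullet> b)))"
    using has_bochner_integral_prod_Basis[of g, OF ig] by (simp add: has_bochner_integral_iff)
  also have "\<dots> = of_real (sqrt (2 * pi) ^ DIM('a)) * complex_of_real (gauss x)"
    unfolding gauss_def by (simp add: prod.distrib)
  finally show ?thesis by (simp add: field_simps)
qed

lemma integral_gauss_shift:
  fixes k :: "'a::euclidean_space \<Rightarrow> real"
  assumes [measurable]: "k \<in> borel_measurable borel"
  shows "(\<integral>w. k w * gauss (w - y) \<partial>lborel) = (\<integral>v. k (y + v) * gauss v \<partial>lborel)"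
proof -
  have "(\<integral>w. k w * gauss (w - y) \<partial>lborel) = (\<integral>w. k w * gauss (w - y) \<partial>distr lborel borel ((+) y))"
    by (simp add: lborel_distr_plus)
  also have "\<dots> = (\<integral>v. k (y + v) * gauss v \<partial>lborel)"
    by (subst integral_distr) auto
  finally show ?thesis .
qed

lemma nn_integral_gauss_shift:
  fixes y :: "'a::euclidean_space"
  shows "(\<integral>\<^sup>+w. ennreal (gauss (w - y)) \<partial>lborel) = 1"
proof -
  have "(\<integral>\<^sup>+w. ennreal (gauss (w - y)) \<partial>lborel) = (\<integral>\<^sup>+w. ennreal (gauss (w - y)) \<partial>distr lborel borel ((+) y))"
    by (simp add: lborel_distr_plus)
  also have "\<dots> = (\<integral>\<^sup>+v. ennreal (gauss (v :: 'a)) \<partial>lborel)"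
    by (subst nn_integral_distr) auto
  also have "\<dots> = 1"
    using has_integral_gauss by (subst nn_integral_eq_integral) (auto simp: has_bochner_integral_iff gauss_nonneg)
  finally show ?thesis .
qed

text \<open>The density of the convolution of \<open>\<mu>\<close> with the standard normal
  law.\<close>

definition gauss_smooth :: "'a::euclidean_space measure \<Rightarrow> 'a \<Rightarrow> real" where
  "gauss_smooth \<mu> w = (\<integral>y. gauss (w - y) \<partial>\<mu>)"

lemma gauss_bounded: "\<exists>B. \<forall>x::'a::euclidean_space. \<bar>gauss x\<bar> \<le> B"
proof (intro exI allI)
  fix x :: 'a
  have "gauss x \<le> (\<Prod>b\<in>(Basis :: 'a set). 1 / sqrt (2 * pi))"
    unfolding gauss_def by (intro prod_mono) (auto simp: std_normal_density_def divide_right_mono)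
  then show "\<bar>gauss x\<bar> \<le> (\<Prod>b\<in>(Basis :: 'a set). 1 / sqrt (2 * pi))" using gauss_nonneg[of x] by simp
qed

context
  fixes \<mu> :: "'a::euclidean_space measure"
  assumes mu: "prob_space \<mu>" and sets_mu[measurable_cong]: "sets \<mu> = sets borel"
begin

interpretation prob_space \<mu> by (rule mu)
interpretation pair_sigma_finite lborel \<mu> ..

lemma gauss_smooth_borel[measurable]: "gauss_smooth \<mu> \<in> borel_measurable borel"
  unfolding gauss_smooth_def[abs_def] by measurable

lemma gauss_smooth_nonneg: "0 \<le> gauss_smooth \<mu> w"
  unfolding gauss_smooth_def by (intro integral_nonneg_AE) (simp add: gauss_nonneg)

lemma gauss_shift_integrable: "integrable \<mu> (\<lambda>y. gauss (w - y))"
proof -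
  obtain B where "\<forall>x::'a. \<bar>gauss x\<bar> \<le> B" using gauss_bounded by blast
  then show ?thesis by (intro integrable_const_bound[where B=B]) auto
qed

lemma nn_integral_gauss_smooth: "(\<integral>\<^sup>+w. ennreal (gauss_smooth \<mu> w) \<partial>lborel) = 1"
proof -
  have "(\<integral>\<^sup>+w. ennreal (gauss_smooth \<mu> w) \<partial>lborel) = (\<integral>\<^sup>+w. (\<integral>\<^sup>+y. ennreal (gauss (w - y)) \<partial>\<mu>) \<partial>lborel)"
    unfolding gauss_smooth_def
    by (intro nn_integral_cong nn_integral_eq_integral[symmetric] gauss_shift_integrable) (simp add: gauss_nonneg)
  also have "\<dots> = (\<integral>\<^sup>+y. (\<integral>\<^sup>+w. ennreal (gauss (w - y)) \<partial>lborel) \<partial>\<mu>)"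
    by (rule Fubini'[symmetric]) measurable
  also have "\<dots> = 1" by (simp add: nn_integral_gauss_shift emeasure_space_1)
  finally show ?thesis .
qed

lemma gauss_smooth_integrable: "integrable lborel (gauss_smooth \<mu>)"
  by (rule integrableI_bounded) (auto simp: gauss_smooth_nonneg nn_integral_gauss_smooth)

text \<open>Fourier inversion for the smoothed law: the Gaussian weight makes the integral over the
  frequencies absolutely convergent, whatever the decay of the characteristic function of
  \<open>\<mu>\<close>.\<close>

lemma gauss_smooth_char:
  "complex_of_real (gauss_smooth \<mu> w)
     = (\<integral>l. (gauss l *\<^sub>R iexp (l \<bullet> w)) * char_vec l \<partial>lborel) / of_real (sqrt (2 * pi) ^ DIM('a))"
  if cv: "\<And>l. char_vec l = (\<integral>y. iexp (- (l \<bullet> y)) \<partial>\<mu>)" for char_vec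
proof -
  let ?c = "complex_of_real (sqrt (2 * pi) ^ DIM('a))"
  have ig: "integrable lborel (gauss :: 'a \<Rightarrow> real)" using has_integral_gauss by (auto simp: has_bochner_integral_iff)
  have "integrable (lborel \<Otimes>\<^sub>M \<mu>) (\<lambda>(l, y). gauss l *\<^sub>R iexp (l \<bullet> (w - y)))"
  proof (rule Fubini_integrable)
    show "integrable lborel (\<lambda>l. \<integral>y. norm (case (l, y) of (l, y) \<Rightarrow> gauss l *\<^sub>R iexp (l \<bullet> (w - y))) \<partial>\<mu>)"
      using ig by (simp add: prob_space gauss_nonneg)
    show "AE l in lborel. integrable \<mu> (\<lambda>y. case (l, y) of (l, y) \<Rightarrow> gauss l *\<^sub>R iexp (l \<bullet> (w - y)))"
    proof (rule AE_I2)
      fix l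
      show "integrable \<mu> (\<lambda>y. case (l, y) of (l, y) \<Rightarrow> gauss l *\<^sub>R iexp (l \<bullet> (w - y)))"
        by (rule integrable_const_bound[where B="gauss l"]) (auto simp: gauss_nonneg)
    qed
  qed measurable
  note F = Fubini_integral[OF this]
  have "complex_of_real (gauss_smooth \<mu> w) = (\<integral>y. complex_of_real (gauss (w - y)) \<partial>\<mu>)"
    unfolding gauss_smooth_def by simp
  also have "\<dots> = (\<integral>y. (\<integral>l. gauss l *\<^sub>R iexp (l \<bullet> (w - y)) \<partial>lborel) \<partial>\<mu>) / ?c"
    by (simp add: gauss_eq_integral_iexp)
  also have "(\<integral>y. (\<integral>l. gauss l *\<^sub>R iexp (l \<bullet> (w - y)) \<partial>lborel) \<partial>\<mu>)
     = (\<integral>l. (\<integral>y. gauss l *\<^sub>R iexp (l \<bullet> (w - y)) \<partial>\<mu>) \<partial>lborel)"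
    using F by simp
  also have "(\<lambda>l. \<integral>y. gauss l *\<^sub>R iexp (l \<bullet> (w - y)) \<partial>\<mu>) = (\<lambda>l. (gauss l *\<^sub>R iexp (l \<bullet> w)) * char_vec l)"
  proof
    fix l
    have "gauss l *\<^sub>R iexp (l \<bullet> (w - y)) = (gauss l *\<^sub>R iexp (l \<bullet> w)) * iexp (- (l \<bullet> y))" for y
      by (simp add: inner_diff_right right_diff_distrib exp_diff exp_minus divide_inverse)
    then show "(\<integral>y. gauss l *\<^sub>R iexp (l \<bullet> (w - y)) \<partial>\<mu>) = (gauss l *\<^sub>R iexp (l \<bullet> w)) * char_vec l"
      unfolding cv by (simp only: integral_mult_right_zero)
  qed
  finally show ?thesis .
qed

lemma integral_gauss_smooth:
  assumes [measurable]: "k \<in> borel_measurable borel" and B: "\<And>x. \<bar>k x\<bar> \<le> B"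
  shows "(\<integral>y. (\<integral>v. k (y + v) * gauss v \<partial>lborel) \<partial>\<mu>) = (\<integral>w. k w * gauss_smooth \<mu> w \<partial>lborel)"
proof -
  have B0: "0 \<le> B" using B[of 0] by linarith
  have "integrable (lborel \<Otimes>\<^sub>M \<mu>) (\<lambda>(w, y). k w * gauss (w - y))"
  proof (rule Fubini_integrable)
    have "(\<integral>y. norm (k w * gauss (w - y)) \<partial>\<mu>) = \<bar>k w\<bar> * gauss_smooth \<mu> w" for w
      unfolding gauss_smooth_def by (simp add: abs_mult gauss_nonneg)
    moreover have "integrable lborel (\<lambda>w. \<bar>k w\<bar> * gauss_smooth \<mu> w)"
      by (rule Bochner_Integration.integrable_bound[OF integrable_mult_right[OF gauss_smooth_integrable, of B]])
        (use B B0 in \<open>auto simp: abs_mult gauss_smooth_nonneg intro!: mult_right_mono\<close>)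
    ultimately show "integrable lborel (\<lambda>w. \<integral>y. norm (case (w, y) of (w, y) \<Rightarrow> k w * gauss (w - y)) \<partial>\<mu>)"
      by simp
  qed (use gauss_shift_integrable in auto)
  from Fubini_integral[OF this] show ?thesis
    by (simp add: integral_gauss_shift gauss_smooth_def)
qed

end

text \<open>By inversion and dominated convergence the smoothed densities converge pointwise. Being
  probability densities, they converge in L1 by Scheffe's lemma, and integrals of the bounded
  \<open>k\<close> follow.\<close>

lemma gauss_smooth_tendsto:
  fixes \<mu> :: "nat \<Rightarrow> 'a::euclidean_space measure"
  assumes mu: "\<And>n. prob_space (\<mu> n)" "\<And>n. sets (\<mu> n) = sets borel"
    and pi: "prob_space \<rho>" "sets \<rho> = sets borel"
    and char: "\<And>l. (\<lambda>n. \<integral>y. iexp (l \<bullet> y) \<partial>\<mu> n) \<longlonglongrightarrow> (\<integral>y. iexp (l \<bullet> y) \<partial>\<rho>)"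
    and k[measurable]: "k \<in> borel_measurable borel" and B: "\<And>x. \<bar>k x\<bar> \<le> B"
  shows "(\<lambda>n. \<integral>y. (\<integral>v. k (y + v) * gauss v \<partial>lborel) \<partial>\<mu> n) \<longlonglongrightarrow> (\<integral>y. (\<integral>v. k (y + v) * gauss v \<partial>lborel) \<partial>\<rho>)"
proof -
  have B0: "0 \<le> B" using B[of 0] by linarith
  let ?p = "\<lambda>n. gauss_smooth (\<mu> n)" and ?q = "gauss_smooth \<rho>"
  note [measurable] = gauss_smooth_borel[OF mu] gauss_smooth_borel[OF pi]
  have ig: "integrable lborel (gauss :: 'a \<Rightarrow> real)" using has_integral_gauss by (auto simp: has_bochner_integral_iff)
  have "(\<lambda>n. ?p n w) \<longlonglongrightarrow> ?q w" for w
  proof -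
    have "(\<lambda>n. complex_of_real (?p n w)) \<longlonglongrightarrow> complex_of_real (?q w)"
      unfolding gauss_smooth_char[OF mu refl] gauss_smooth_char[OF pi refl]
    proof (intro tendsto_divide tendsto_const integral_dominated_convergence[where w=gauss])
      show "AE l in lborel. (\<lambda>n. gauss l *\<^sub>R iexp (l \<bullet> w) * (\<integral>y. iexp (- (l \<bullet> y)) \<partial>\<mu> n))
         \<longlonglongrightarrow> gauss l *\<^sub>R iexp (l \<bullet> w) * (\<integral>y. iexp (- (l \<bullet> y)) \<partial>\<rho>)"
      proof (rule AE_I2, rule tendsto_mult[OF tendsto_const])
        show "(\<lambda>n. \<integral>y. iexp (- (l \<bullet> y)) \<partial>\<mu> n) \<longlonglongrightarrow> (\<integral>y. iexp (- (l \<bullet> y)) \<partial>\<rho>)" for l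
          using char[of "- l"] by simp
      qed
      fix n
      interpret prob_space "\<mu> n" by (rule mu)
      note [measurable_cong] = mu(2)
      have "norm (\<integral>y. iexp (- (l \<bullet> y)) \<partial>\<mu> n) \<le> 1" for l
        using integral_norm_bound[of "\<mu> n" "\<lambda>y. iexp (- (l \<bullet> y))"] by (simp add: prob_space)
      then show "AE l in lborel. norm (gauss l *\<^sub>R iexp (l \<bullet> w) * (\<integral>y. iexp (- (l \<bullet> y)) \<partial>\<mu> n)) \<le> gauss l"
        using mult_left_mono[OF _ gauss_nonneg, of _ 1] by (auto simp: norm_mult gauss_nonneg)
      show "(\<lambda>l. gauss l *\<^sub>R iexp (l \<bullet> w) * (\<integral>y. iexp (- (l \<bullet> y)) \<partial>\<mu> n)) \<in> borel_measurable lborel"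
        by measurable
    next
      interpret prob_space \<rho> by (rule pi)
      note [measurable_cong] = pi(2)
      show "(\<lambda>l. gauss l *\<^sub>R iexp (l \<bullet> w) * (\<integral>y. iexp (- (l \<bullet> y)) \<partial>\<rho>)) \<in> borel_measurable lborel"
        by measurable
    qed (use ig in auto)
    then show ?thesis by (simp only: tendsto_of_real_iff)
  qed
  then have "(\<lambda>n. \<integral>\<^sup>+w. norm (?p n w - ?q w) \<partial>lborel) \<longlonglongrightarrow> 0"
    by (intro Scheffe_lemma2 gauss_smooth_integrable pi)
      (auto simp: gauss_smooth_nonneg[OF mu] gauss_smooth_nonneg[OF pi] nn_integral_gauss_smooth[OF mu] nn_integral_gauss_smooth[OF pi])
  moreover have int: "integrable lborel (\<lambda>w. norm (?p n w - ?q w))" for n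
    by (intro integrable_norm Bochner_Integration.integrable_diff gauss_smooth_integrable mu pi)
  ultimately have "(\<lambda>n. ennreal (\<integral>w. norm (?p n w - ?q w) \<partial>lborel)) \<longlonglongrightarrow> ennreal 0"
    by (simp add: nn_integral_eq_integral)
  then have L1: "(\<lambda>n. \<integral>w. norm (?p n w - ?q w) \<partial>lborel) \<longlonglongrightarrow> 0"
    by (subst (asm) tendsto_ennreal_iff) auto
  have ik: "integrable lborel (\<lambda>w. k w * f w)" if "integrable lborel f" for f :: "'a \<Rightarrow> real"
  proof (rule Bochner_Integration.integrable_bound)
    show "integrable lborel (\<lambda>w. B * f w)" using that by simp
    have "f \<in> borel_measurable lborel" using that by simp
    then show "(\<lambda>w. k w * f w) \<in> borel_measurable lborel" by measurable
  qed (use B B0 in \<open>auto simp: abs_mult intro!: mult_right_mono\<close>)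
  have "(\<lambda>n. (\<integral>w. k w * ?p n w \<partial>lborel) - (\<integral>w. k w * ?q w \<partial>lborel)) \<longlonglongrightarrow> 0"
  proof (rule Lim_null_comparison)
    have "norm ((\<integral>w. k w * ?p n w \<partial>lborel) - (\<integral>w. k w * ?q w \<partial>lborel)) \<le> B * (\<integral>w. norm (?p n w - ?q w) \<partial>lborel)" for n
    proof -
      have "(\<integral>w. k w * ?p n w \<partial>lborel) - (\<integral>w. k w * ?q w \<partial>lborel) = (\<integral>w. k w * (?p n w - ?q w) \<partial>lborel)"
        by (subst Bochner_Integration.integral_diff[symmetric])
          (auto simp: right_diff_distrib intro!: ik gauss_smooth_integrable mu pi)
      also have "norm \<dots> \<le> (\<integral>w. norm (k w * (?p n w - ?q w)) \<partial>lborel)" by (rule integral_norm_bound)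
      also have "\<dots> \<le> (\<integral>w. B * norm (?p n w - ?q w) \<partial>lborel)"
        using B by (intro integral_mono integrable_norm ik integrable_mult_right int Bochner_Integration.integrable_diff gauss_smooth_integrable mu pi)
          (auto simp: abs_mult intro!: mult_right_mono)
      finally show ?thesis by simp
    qed
    then show "\<forall>\<^sub>F n in sequentially. norm ((\<integral>w. k w * ?p n w \<partial>lborel) - (\<integral>w. k w * ?q w \<partial>lborel)) \<le> B * (\<integral>w. norm (?p n w - ?q w) \<partial>lborel)"
      by simp
    show "(\<lambda>n. B * (\<integral>w. norm (?p n w - ?q w) \<partial>lborel)) \<longlonglongrightarrow> 0"
      using tendsto_mult_left[OF L1, of B] by simp
  qed
  then show ?thesis
    unfolding integral_gauss_smooth[OF mu k B] integral_gauss_smooth[OF pi k B] by (simp add: LIM_zero_iff)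
qed

text \<open>Gaussian smoothing at scale \<open>s\<close> changes the integral of \<open>h\<close> by
  at most \<open>\<omega> s\<close> under every law, and for fixed \<open>s\<close> the smoothed
  integrals converge; the uniformity in the law replaces a tightness argument.\<close>

lemma char_tendsto_imp_integral_tendsto:
  fixes \<mu> :: "nat \<Rightarrow> 'a::euclidean_space measure"
  assumes mu: "\<And>n. prob_space (\<mu> n)" "\<And>n. sets (\<mu> n) = sets borel"
    and pi: "prob_space \<rho>" "sets \<rho> = sets borel"
    and char: "\<And>l. (\<lambda>n. \<integral>y. iexp (l \<bullet> y) \<partial>\<mu> n) \<longlonglongrightarrow> (\<integral>y. iexp (l \<bullet> y) \<partial>\<rho>)"
    and h[measurable]: "h \<in> borel_measurable borel" and B: "\<And>x. \<bar>h x\<bar> \<le> B"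
    and lip: "\<And>x y. \<bar>h x - h y\<bar> \<le> norm (x - y)"
  shows "(\<lambda>n. \<integral>y. h y \<partial>\<mu> n) \<longlonglongrightarrow> (\<integral>y. h y \<partial>\<rho>)"
proof -
  have B0: "0 \<le> B" using B[of 0] by linarith
  have ig: "integrable lborel (gauss :: 'a \<Rightarrow> real)" and g1: "(\<integral>v. gauss (v::'a) \<partial>lborel) = 1"
    using has_integral_gauss by (auto simp: has_bochner_integral_iff)
  \<comment> \<open>An increment of \<open>h\<close> over \<open>s *\<^sub>R v\<close> is at most
    \<open>s * norm v\<close> and at most \<open>2 * B\<close>; the second bound provides the
    domination as \<open>s\<close> tends to 0.\<close>
  define \<omega> where "\<omega> = (\<lambda>s::real. \<integral>v. min (s * norm (v :: 'a)) (2 * B) * gauss v \<partial>lborel)"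
  have lim: "(\<lambda>i. \<omega> (1 / real (Suc i))) \<longlonglongrightarrow> (\<integral>v. 0 \<partial>(lborel :: 'a measure))"
    unfolding \<omega>_def
  proof (rule integral_dominated_convergence[where w="\<lambda>v. 2 * B * gauss v"])
    show "AE v::'a in lborel. (\<lambda>i. min (1 / real (Suc i) * norm v) (2 * B) * gauss v) \<longlonglongrightarrow> 0"
    proof (rule AE_I2)
      fix v :: 'a
      have "(\<lambda>i. min (1 / real (Suc i) * norm v) (2 * B) * gauss v) \<longlonglongrightarrow> min (0 * norm v) (2 * B) * gauss v"
        using LIMSEQ_inverse_real_of_nat by (intro tendsto_intros) (simp add: inverse_eq_divide)
      then show "(\<lambda>i. min (1 / real (Suc i) * norm v) (2 * B) * gauss v) \<longlonglongrightarrow> 0" using B0 by simp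
    qed
    show "AE v::'a in lborel. norm (min (1 / real (Suc i) * norm v) (2 * B) * gauss v) \<le> 2 * B * gauss v" for i
      using B0 by (auto simp: abs_mult gauss_nonneg intro!: mult_right_mono)
  qed (use ig in auto)
  have near: "\<bar>(\<integral>v. h (s *\<^sub>R (y + v)) * gauss v \<partial>lborel) - h (s *\<^sub>R y)\<bar> \<le> \<omega> s" if s: "0 < s" for s and y :: 'a
  proof -
    have i1: "integrable lborel (\<lambda>v. h (s *\<^sub>R (y + v)) * gauss v)"
      by (rule Bochner_Integration.integrable_bound[OF integrable_mult_right[OF ig, of B]])
        (use B B0 in \<open>auto simp: abs_mult gauss_nonneg intro!: mult_right_mono\<close>)
    have i3: "integrable lborel (\<lambda>v::'a. min (s * norm v) (2 * B) * gauss v)"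
      by (rule Bochner_Integration.integrable_bound[OF integrable_mult_right[OF ig, of "2 * B"]])
        (use s B0 in \<open>auto simp: abs_mult gauss_nonneg intro!: mult_right_mono\<close>)
    have "(\<integral>v. h (s *\<^sub>R (y + v)) * gauss v \<partial>lborel) - h (s *\<^sub>R y)
      = (\<integral>v. h (s *\<^sub>R (y + v)) * gauss v \<partial>lborel) - (\<integral>v. h (s *\<^sub>R y) * gauss (v :: 'a) \<partial>lborel)"
      by (simp add: g1)
    also have "\<dots> = (\<integral>v. (h (s *\<^sub>R (y + v)) - h (s *\<^sub>R y)) * gauss v \<partial>lborel)"
      unfolding left_diff_distrib by (intro Bochner_Integration.integral_diff[symmetric] i1 integrable_mult_right ig)
    finally have "\<bar>(\<integral>v. h (s *\<^sub>R (y + v)) * gauss v \<partial>lborel) - h (s *\<^sub>R y)\<bar>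
       \<le> (\<integral>v. \<bar>(h (s *\<^sub>R (y + v)) - h (s *\<^sub>R y)) * gauss v\<bar> \<partial>lborel)"
      by (simp add: integral_abs_bound)
    also have "\<dots> \<le> \<omega> s"
      unfolding \<omega>_def
    proof (intro integral_mono integrable_abs i3)
      show "integrable lborel (\<lambda>v. (h (s *\<^sub>R (y + v)) - h (s *\<^sub>R y)) * gauss v)"
        unfolding left_diff_distrib by (intro Bochner_Integration.integrable_diff i1 integrable_mult_right ig)
      fix v :: 'a
      have "\<bar>h (s *\<^sub>R (y + v)) - h (s *\<^sub>R y)\<bar> \<le> s * norm v"
        using lip[of "s *\<^sub>R (y + v)" "s *\<^sub>R y"] s by (simp add: scaleR_add_right)
      moreover have "\<bar>h (s *\<^sub>R (y + v)) - h (s *\<^sub>R y)\<bar> \<le> 2 * B"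
        using B[of "s *\<^sub>R (y + v)"] B[of "s *\<^sub>R y"] by linarith
      ultimately show "\<bar>(h (s *\<^sub>R (y + v)) - h (s *\<^sub>R y)) * gauss v\<bar> \<le> min (s * norm v) (2 * B) * gauss v"
        by (auto simp: abs_mult gauss_nonneg intro!: mult_right_mono)
    qed
    finally show ?thesis .
  qed
  define A where "A = (\<lambda>s (\<kappa> :: 'a measure). \<integral>y. (\<integral>v. h (s *\<^sub>R (y /\<^sub>R s + v)) * gauss v \<partial>lborel) \<partial>\<kappa>)"
  have close: "\<bar>A s \<kappa> - (\<integral>y. h y \<partial>\<kappa>)\<bar> \<le> \<omega> s" if s: "0 < s" and "prob_space \<kappa>" and [measurable_cong]: "sets \<kappa> = sets borel" for s \<kappa>
  proof -
    interpret prob_space \<kappa> by fact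
    have ih: "integrable \<kappa> h" using B by (intro integrable_const_bound[where B=B]) auto
    have n: "\<bar>(\<integral>v. h (s *\<^sub>R (y /\<^sub>R s + v)) * gauss v \<partial>lborel) - h y\<bar> \<le> \<omega> s" for y
      using near[OF s, of "y /\<^sub>R s"] s by simp
    have "\<bar>(\<integral>v. h (s *\<^sub>R (y /\<^sub>R s + v)) * gauss v \<partial>lborel)\<bar> \<le> B + \<omega> s" for y
      using n[of y] B[of y] by linarith
    then have iA: "integrable \<kappa> (\<lambda>y. \<integral>v. h (s *\<^sub>R (y /\<^sub>R s + v)) * gauss v \<partial>lborel)"
      by (intro integrable_const_bound[where B="B + \<omega> s"]) auto
    have "A s \<kappa> - (\<integral>y. h y \<partial>\<kappa>) = (\<integral>y. (\<integral>v. h (s *\<^sub>R (y /\<^sub>R s + v)) * gauss v \<partial>lborel) - h y \<partial>\<kappa>)"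
      unfolding A_def by (intro Bochner_Integration.integral_diff[symmetric] iA ih)
    also have "\<bar>\<dots>\<bar> \<le> (\<integral>y. \<bar>(\<integral>v. h (s *\<^sub>R (y /\<^sub>R s + v)) * gauss v \<partial>lborel) - h y\<bar> \<partial>\<kappa>)"
      by (rule integral_abs_bound)
    also have "\<dots> \<le> (\<integral>y. \<omega> s \<partial>\<kappa>)"
      using n by (intro integral_mono integrable_abs Bochner_Integration.integrable_diff iA ih) auto
    finally show ?thesis by (simp add: prob_space)
  qed
  have conv: "(\<lambda>n. A s (\<mu> n)) \<longlonglongrightarrow> A s \<rho>" if s: "0 < s" for s
  proof -
    \<comment> \<open>Smoothing at scale \<open>s\<close> is unit smoothing of the law dilated by
      \<open>1 / s\<close>, whose characteristic function at \<open>l\<close> is the original one at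
      \<open>l / s\<close>.\<close>
    let ?D = "\<lambda>\<kappa>. distr \<kappa> borel (\<lambda>y::'a. y /\<^sub>R s)"
    have T: "(\<lambda>y::'a. y /\<^sub>R s) \<in> \<kappa> \<rightarrow>\<^sub>M borel" if "sets \<kappa> = sets borel" for \<kappa>
      using that by (simp cong: measurable_cong_sets)
    have [measurable]: "(\<lambda>v. h (s *\<^sub>R v)) \<in> borel_measurable borel" by measurable
    have e: "(\<integral>y. (\<integral>v. h (s *\<^sub>R (y + v)) * gauss v \<partial>lborel) \<partial>?D \<kappa>) = A s \<kappa>" if "sets \<kappa> = sets borel" for \<kappa>
      unfolding A_def by (subst integral_distr[OF T[OF that]]) auto
    have c: "(\<integral>y. iexp (l \<bullet> y) \<partial>?D \<kappa>) = (\<integral>y. iexp ((l /\<^sub>R s) \<bullet> y) \<partial>\<kappa>)" if "sets \<kappa> = sets borel" for \<kappa> l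
      by (subst integral_distr[OF T[OF that]]) auto
    have "(\<lambda>n. \<integral>y. (\<integral>v. h (s *\<^sub>R (y + v)) * gauss v \<partial>lborel) \<partial>?D (\<mu> n))
        \<longlonglongrightarrow> (\<integral>y. (\<integral>v. h (s *\<^sub>R (y + v)) * gauss v \<partial>lborel) \<partial>?D \<rho>)"
    proof (rule gauss_smooth_tendsto[where k="\<lambda>v. h (s *\<^sub>R v)" and B=B])
      show "prob_space (?D (\<mu> n))" for n by (intro prob_space.prob_space_distr mu T)
      show "prob_space (?D \<rho>)" by (intro prob_space.prob_space_distr pi T)
      show "(\<lambda>n. \<integral>y. iexp (l \<bullet> y) \<partial>?D (\<mu> n)) \<longlonglongrightarrow> (\<integral>y. iexp (l \<bullet> y) \<partial>?D \<rho>)" for l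
        unfolding c[OF mu(2)] c[OF pi(2)] by (rule char)
    qed (use B in auto)
    then show ?thesis unfolding e[OF mu(2)] e[OF pi(2)] .
  qed
  show ?thesis
  proof (rule LIMSEQ_I)
    fix r :: real assume r: "0 < r"
    have "eventually (\<lambda>i. \<omega> (1 / real (Suc i)) < r / 3) sequentially"
      using order_tendstoD(2)[OF lim, of "r / 3"] r by simp
    then obtain i where i: "\<omega> (1 / real (Suc i)) < r / 3" by (auto simp: eventually_sequentially)
    let ?s = "1 / real (Suc i)"
    have s: "0 < ?s" by simp
    have "0 < r / 3" using r by simp
    from LIMSEQ_D[OF conv[OF s] this] obtain N where N: "\<And>n. n \<ge> N \<Longrightarrow> norm (A ?s (\<mu> n) - A ?s \<rho>) < r / 3"
      by blast
    have "norm ((\<integral>y. h y \<partial>\<mu> n) - (\<integral>y. h y \<partial>\<rho>)) < r" if "n \<ge> N" for n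
      using N[OF that] close[OF s mu(1,2)[of n]] close[OF s pi] i unfolding real_norm_def by linarith
    then show "\<exists>N. \<forall>n\<ge>N. norm ((\<integral>y. h y \<partial>\<mu> n) - (\<integral>y. h y \<partial>\<rho>)) < r" by blast
  qed
qed

subsection \<open>Rates\<close>

context jump_law
begin

lemma nn_integral_hmod:
  assumes a: "0 < a"
  shows "(\<integral>\<^sup>+y. ennreal (hmod b (a *\<^sub>R y)) \<partial>jump)
    = (\<integral>\<^sup>+u. ennreal (\<alpha> * u powr (-1 - \<alpha>) * indicator {1..} u * min (a * u) ((a * u) powr b)) \<partial>lborel)"
    (is "_ = ?I")
proof -
  interpret n: prob_space \<nu> by (rule prob_nu)
  have "(\<integral>\<^sup>+y. ennreal (hmod b (a *\<^sub>R y)) \<partial>jump)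
      = (\<integral>\<^sup>+\<theta>. (\<integral>\<^sup>+u. ennreal (hmod b (a *\<^sub>R u *\<^sub>R \<theta>)) \<partial>pareto \<alpha> 1) \<partial>\<nu>)"
    by (rule nn_integral_jump) measurable
  also have "\<dots> = (\<integral>\<^sup>+\<theta>. ?I \<partial>\<nu>)"
  proof (rule nn_integral_cong_AE)
    show "AE \<theta> in \<nu>. (\<integral>\<^sup>+u. ennreal (hmod b (a *\<^sub>R u *\<^sub>R \<theta>)) \<partial>pareto \<alpha> 1) = ?I"
      using nu(3)
    proof eventually_elim
      case (elim \<theta>)
      have "(\<integral>\<^sup>+u. ennreal (hmod b (a *\<^sub>R u *\<^sub>R \<theta>)) \<partial>pareto \<alpha> 1)
        = (\<integral>\<^sup>+u. ennreal (\<alpha> * u powr (-1 - \<alpha>) * indicator {1..} u) * ennreal (hmod b (a *\<^sub>R u *\<^sub>R \<theta>)) \<partial>lborel)"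
        unfolding pareto_def by (subst nn_integral_density) auto
      also have "\<dots> = ?I"
        using elim a alpha by (intro nn_integral_cong) (auto simp: ennreal_mult'[symmetric] hmod_def indicator_def)
      finally show ?case .
    qed
  qed
  also have "\<dots> = ?I" by (simp add: n.emeasure_space_1)
  finally show ?thesis .
qed

text \<open>\<open>g\<close> is a majorant of the radial integrand with a known integral. The
  comparison is made for nonnegative integrals, so it yields the integrability as well.\<close>

lemma mean_hmod_le:
  assumes a: "0 < a" and g: "has_bochner_integral lborel g X"
    and le: "\<And>u. 1 \<le> u \<Longrightarrow> \<alpha> * u powr (-1 - \<alpha>) * min (a * u) ((a * u) powr b) \<le> g u"
    and g0: "\<And>u. 0 \<le> g u"
  shows "integrable jump (\<lambda>y. hmod b (a *\<^sub>R y))" "mean_hmod b a \<le> X"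
proof -
  have X: "(\<integral>\<^sup>+u. ennreal (g u) \<partial>lborel) = ennreal X"
    using g g0 by (auto simp: has_bochner_integral_iff nn_integral_eq_integral)
  have X0: "0 \<le> X" using g g0 by (auto simp: has_bochner_integral_iff intro!: integral_nonneg_AE)
  have le: "(\<integral>\<^sup>+y. ennreal (hmod b (a *\<^sub>R y)) \<partial>jump) \<le> ennreal X"
    unfolding nn_integral_hmod[OF a] X[symmetric]
    using le g0 by (intro nn_integral_mono ennreal_leI) (auto simp: indicator_def)
  show int: "integrable jump (\<lambda>y. hmod b (a *\<^sub>R y))"
    using le by (intro integrableI_bounded) (auto simp: hmod_nonneg le_less_trans)
  have "ennreal (mean_hmod b a) = (\<integral>\<^sup>+y. ennreal (hmod b (a *\<^sub>R y)) \<partial>jump)"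
    unfolding mean_hmod_def using int by (intro nn_integral_eq_integral[symmetric]) (auto simp: hmod_nonneg)
  then have "ennreal (mean_hmod b a) \<le> ennreal X" using le by simp
  then show "mean_hmod b a \<le> X" using X0 by simp
qed

lemma mean_hmod_nonneg: "0 \<le> mean_hmod b a"
  unfolding mean_hmod_def by (intro integral_nonneg_AE) (simp add: hmod_nonneg)

text \<open>Keeps only the power \<open>b\<close> of the minimum, which is Pareto-integrable as
  \<open>b < \<alpha>\<close>. With \<open>b = 1\<close> this is already the right order for
  \<open>\<alpha> > 1\<close>.\<close>

lemma mean_hmod_power_le:
  assumes b: "b < \<alpha>" and a: "0 < a"
  shows "integrable jump (\<lambda>y. hmod b (a *\<^sub>R y))" "mean_hmod b a \<le> a powr b * \<alpha> / (\<alpha> - b)"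
proof -
  have 1: "has_bochner_integral lborel (\<lambda>u. (a powr b * \<alpha> / (\<alpha> - b)) * ((\<alpha> - b) * u powr (-1 - (\<alpha> - b)) * indicator {1..} u))
      ((a powr b * \<alpha> / (\<alpha> - b)) * 1 powr - (\<alpha> - b))"
    by (intro has_bochner_integral_mult_right has_integral_pareto) (use b in auto)
  have 2: "\<alpha> * u powr (-1 - \<alpha>) * min (a * u) ((a * u) powr b)
     \<le> (a powr b * \<alpha> / (\<alpha> - b)) * ((\<alpha> - b) * u powr (-1 - (\<alpha> - b)) * indicator {1..} u)" if "1 \<le> u" for u
  proof -
    have "\<alpha> * u powr (-1 - \<alpha>) * min (a * u) ((a * u) powr b) \<le> \<alpha> * u powr (-1 - \<alpha>) * (a * u) powr b"
      using alpha by (intro mult_left_mono) auto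
    also have "\<dots> = \<alpha> * a powr b * (u powr (-1 - \<alpha>) * u powr b)"
      using a that by (simp add: powr_mult)
    also have "u powr (-1 - \<alpha>) * u powr b = u powr (-1 - (\<alpha> - b))"
      unfolding powr_add[symmetric] by (simp add: algebra_simps)
    finally show ?thesis using that b by (simp add: ac_simps)
  qed
  show "integrable jump (\<lambda>y. hmod b (a *\<^sub>R y))"
    by (rule mean_hmod_le(1)[OF a 1 2]) (use b alpha in \<open>auto intro!: divide_nonneg_pos mult_nonneg_nonneg\<close>)
  have "mean_hmod b a \<le> (a powr b * \<alpha> / (\<alpha> - b)) * 1 powr - (\<alpha> - b)"
    by (rule mean_hmod_le(2)[OF a 1 2]) (use b alpha in \<open>auto intro!: divide_nonneg_pos mult_nonneg_nonneg\<close>)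
  then show "mean_hmod b a \<le> a powr b * \<alpha> / (\<alpha> - b)" by simp
qed

lemma hmod_integrable:
  assumes "0 < b" "b < \<alpha>"
  shows "integrable jump (\<lambda>y. hmod b (a *\<^sub>R y))"
proof -
  have "integrable jump (\<lambda>y. hmod b (\<bar>a\<bar> *\<^sub>R y))"
  proof (cases "a = 0")
    case True
    then show ?thesis using assms by (simp add: hmod_def)
  next
    case False
    then show ?thesis using assms by (intro mean_hmod_power_le) auto
  qed
  then show ?thesis by (simp add: hmod_def)
qed

text \<open>Splitting at \<open>U\<close>, where \<open>a * U\<close> is of order one, uses each of the two moduli where it is the smaller one.\<close>

lemma mean_hmod_split_le:
  assumes b: "b < \<alpha>" and a: "0 < a" and U: "1 \<le> U"
    and I: "has_bochner_integral lborel (\<lambda>u. \<alpha> * u powr (- \<alpha>) * indicator {1..U} u) I"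
  shows "mean_hmod b a \<le> a * I + a powr b * \<alpha> / (\<alpha> - b) * U powr (b - \<alpha>)"
proof -
  let ?g = "\<lambda>u. a * (\<alpha> * u powr (- \<alpha>) * indicator {1..U} u) + (a powr b * \<alpha> / (\<alpha> - b)) * ((\<alpha> - b) * u powr (-1 - (\<alpha> - b)) * indicator {U..} u)"
  have 1: "has_bochner_integral lborel ?g (a * I + (a powr b * \<alpha> / (\<alpha> - b)) * U powr - (\<alpha> - b))"
    by (intro has_bochner_integral_add has_bochner_integral_mult_right has_integral_pareto I) (use b U in auto)
  have 2: "\<alpha> * u powr (-1 - \<alpha>) * min (a * u) ((a * u) powr b) \<le> ?g u" if u: "1 \<le> u" for u
  proof (cases "u \<le> U")
    case True
    have "\<alpha> * u powr (-1 - \<alpha>) * min (a * u) ((a * u) powr b) \<le> \<alpha> * u powr (-1 - \<alpha>) * (a * u)"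
      using alpha by (intro mult_left_mono) auto
    also have "\<dots> = a * (\<alpha> * (u powr (-1 - \<alpha>) * u powr 1))" using u by simp
    also have "u powr (-1 - \<alpha>) * u powr 1 = u powr (- \<alpha>)" unfolding powr_add[symmetric] by simp
    also have "a * (\<alpha> * u powr (- \<alpha>)) \<le> ?g u"
      using True u b alpha a by simp
    finally show ?thesis .
  next
    case False
    have "\<alpha> * u powr (-1 - \<alpha>) * min (a * u) ((a * u) powr b) \<le> \<alpha> * u powr (-1 - \<alpha>) * (a * u) powr b"
      using alpha by (intro mult_left_mono) auto
    also have "\<dots> = \<alpha> * a powr b * (u powr (-1 - \<alpha>) * u powr b)"
      using a u by (simp add: powr_mult)
    also have "u powr (-1 - \<alpha>) * u powr b = u powr (-1 - (\<alpha> - b))"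
      unfolding powr_add[symmetric] by (simp add: algebra_simps)
    finally show ?thesis using False u b by (simp add: ac_simps)
  qed
  have "mean_hmod b a \<le> a * I + (a powr b * \<alpha> / (\<alpha> - b)) * U powr - (\<alpha> - b)"
    by (rule mean_hmod_le(2)[OF a 1 2]) (use b alpha a in \<open>auto intro!: add_nonneg_nonneg divide_nonneg_pos mult_nonneg_nonneg\<close>)
  then show ?thesis by simp
qed

lemma has_integral_powr_Icc:
  fixes F :: "real \<Rightarrow> real"
  assumes "1 \<le> U" and "\<And>u. 1 \<le> u \<Longrightarrow> (F has_real_derivative \<alpha> * u powr (- \<alpha>)) (at u)"
  shows "has_bochner_integral lborel (\<lambda>u. \<alpha> * u powr (- \<alpha>) * indicator {1..U} u) (F U - F 1)"
  using assms alpha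
  by (intro has_bochner_integral_FTC_Icc_real) (auto intro!: continuous_intros)

lemma mean_hmod_rate_less_1:
  assumes al: "\<alpha> < 1" and b: "b < \<alpha>" and c: "0 < c"
  obtains K where "0 \<le> K" "\<And>n. 1 \<le> n \<Longrightarrow> mean_hmod b (step_size c n) \<le> K / real n"
proof (rule that)
  let ?K = "c * \<alpha> / (1 - \<alpha>) + c powr b * \<alpha> / (\<alpha> - b)"
  show "0 \<le> ?K" using al b c alpha by (intro add_nonneg_nonneg divide_nonneg_pos) auto
  fix n :: nat assume n: "1 \<le> n"
  \<comment> \<open>With this \<open>U\<close> the product of \<open>U\<close> and the step size is
    \<open>c\<close>, and both pieces of the split are of order \<open>1 / n\<close>.\<close>
  define U where "U = real n powr (1 / \<alpha>)"
  have U: "1 \<le> U" unfolding U_def using n alpha by (intro ge_one_powr_ge_zero) auto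
  have Un: "U powr \<alpha> = real n" unfolding U_def powr_powr using n alpha by simp
  have a: "step_size c n = c / U" unfolding step_size_def U_def by (simp add: powr_minus_divide)
  have "has_bochner_integral lborel (\<lambda>u. \<alpha> * u powr (- \<alpha>) * indicator {1..U} u)
     (\<alpha> / (1 - \<alpha>) * U powr (1 - \<alpha>) - \<alpha> / (1 - \<alpha>) * 1 powr (1 - \<alpha>))"
  proof (rule has_integral_powr_Icc[OF U])
    fix u :: real assume "1 \<le> u"
    then have "((\<lambda>u. \<alpha> / (1 - \<alpha>) * u powr (1 - \<alpha>)) has_real_derivative
        \<alpha> / (1 - \<alpha>) * ((1 - \<alpha>) * u powr (1 - \<alpha> - 1))) (at u)"
      by (intro DERIV_cmult has_real_derivative_powr) simp
    then show "((\<lambda>u. \<alpha> / (1 - \<alpha>) * u powr (1 - \<alpha>)) has_real_derivative \<alpha> * u powr (- \<alpha>)) (at u)"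
      using al by simp
  qed
  from mean_hmod_split_le[OF b _ U this, of "step_size c n"]
  have "mean_hmod b (step_size c n) \<le> c / U * (\<alpha> / (1 - \<alpha>) * U powr (1 - \<alpha>) - \<alpha> / (1 - \<alpha>))
      + (c / U) powr b * \<alpha> / (\<alpha> - b) * U powr (b - \<alpha>)"
    using c U unfolding a by simp
  also have "c / U * (\<alpha> / (1 - \<alpha>) * U powr (1 - \<alpha>) - \<alpha> / (1 - \<alpha>)) \<le> c / U * (\<alpha> / (1 - \<alpha>) * U powr (1 - \<alpha>))"
    using c U al alpha by (intro mult_left_mono) auto
  also have "\<dots> = c * \<alpha> / (1 - \<alpha>) / real n"
    using U by (simp add: Un[symmetric] powr_diff)
  also have "(c / U) powr b * \<alpha> / (\<alpha> - b) * U powr (b - \<alpha>) = c powr b * \<alpha> / (\<alpha> - b) / real n"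
    using U c by (simp add: Un[symmetric] powr_diff powr_divide)
  finally show "mean_hmod b (step_size c n) \<le> ?K / real n" by (simp add: add_divide_distrib)
qed

lemma mean_hmod_rate_eq_1:
  assumes al: "\<alpha> = 1" and b: "b < 1" and c: "0 < c"
  obtains K where "0 \<le> K" "\<And>n. 1 \<le> n \<Longrightarrow> mean_hmod b (step_size c n) \<le> K * (1 + ln (real n)) / real n"
proof (rule that)
  let ?K = "c + c powr b / (1 - b)"
  show "0 \<le> ?K" using b c by (intro add_nonneg_nonneg divide_nonneg_pos) auto
  fix n :: nat assume n: "1 \<le> n"
  have a: "step_size c n = c / real n" unfolding step_size_def using al by (simp add: powr_minus_divide)
  \<comment> \<open>The split is at \<open>n\<close>; the radii below it contribute the integral of
    \<open>1 / u\<close>, which is the source of the logarithm.\<close>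
  have "has_bochner_integral lborel (\<lambda>u. \<alpha> * u powr (- \<alpha>) * indicator {1..real n} u) (ln (real n) - ln 1)"
  proof (rule has_integral_powr_Icc)
    fix u :: real assume "1 \<le> u"
    then show "(ln has_real_derivative \<alpha> * u powr (- \<alpha>)) (at u)"
      using al by (auto intro!: derivative_eq_intros simp: powr_minus_divide)
  qed (use n in simp)
  from mean_hmod_split_le[OF _ _ _ this, of b "step_size c n"]
  have "mean_hmod b (step_size c n) \<le> c / real n * ln (real n)
      + (c / real n) powr b / (1 - b) * real n powr (b - 1)"
    using c n b al unfolding a by simp
  also have "(c / real n) powr b / (1 - b) * real n powr (b - 1) = c powr b / (1 - b) / real n"
    using n c by (simp add: powr_diff powr_divide)
  also have "c / real n * ln (real n) + c powr b / (1 - b) / real n \<le> ?K * (1 + ln (real n)) / real n"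
  proof -
    have "c * ln (real n) + c powr b / (1 - b) * 1 \<le> c * (1 + ln (real n)) + c powr b / (1 - b) * (1 + ln (real n))"
      using c n b by (intro add_mono mult_left_mono) auto
    then have "(c * ln (real n) + c powr b / (1 - b)) / real n \<le> (?K * (1 + ln (real n))) / real n"
      by (intro divide_right_mono) (auto simp: distrib_right)
    then show ?thesis by (simp add: add_divide_distrib)
  qed
  finally show "mean_hmod b (step_size c n) \<le> ?K * (1 + ln (real n)) / real n" .
qed

text \<open>Up to a constant, the cost of passing from \<open>n\<close> to \<open>2 * n\<close>
  jumps. The lemmas below bound it at \<open>2 ^ j * n\<close> by a rate in \<open>n\<close> times a
  sequence in \<open>j\<close> that is summable.\<close>

definition double_err :: "real \<Rightarrow> real \<Rightarrow> nat \<Rightarrow> real" where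
  "double_err b c n = real n * ((mean_hmod b (step_size c (2 * n)))\<^sup>2 + (step_size c n)\<^sup>2)"

text \<open>The mean modulus is of the order of the step size, so the cost is \<open>n\<close> times
  the squared step size, that is, of order \<open>n powr (1 - 2 / \<alpha>)\<close>; doubling
  \<open>n\<close> multiplies this by a fixed ratio.\<close>

lemma double_err_greater_1:
  assumes al: "1 < \<alpha>" and c: "0 < c"
  obtains K where "0 \<le> K"
    "\<And>n j. 1 \<le> n \<Longrightarrow> double_err 1 c (2 ^ j * n) \<le> K * real n powr ((\<alpha> - 2) / \<alpha>) * (2 powr ((\<alpha> - 2) / \<alpha>)) ^ j"
proof (rule that)
  let ?K = "(c * \<alpha> / (\<alpha> - 1))\<^sup>2 + c\<^sup>2"
  show "0 \<le> ?K" by simp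
  have e: "double_err 1 c n \<le> ?K * real n powr ((\<alpha> - 2) / \<alpha>)" if n: "1 \<le> n" for n
  proof -
    have s: "0 < step_size c (2 * n)" "0 < step_size c n" using step_size_pos[OF c] n by auto
    have "mean_hmod 1 (step_size c (2 * n)) \<le> step_size c (2 * n) * \<alpha> / (\<alpha> - 1)"
      using mean_hmod_power_le(2)[of 1 "step_size c (2 * n)"] al s by simp
    also have "\<dots> \<le> step_size c n * \<alpha> / (\<alpha> - 1)"
      using s al halving by (intro divide_right_mono mult_right_mono) (auto simp: step_size_double)
    finally have "(mean_hmod 1 (step_size c (2 * n)))\<^sup>2 \<le> (step_size c n * \<alpha> / (\<alpha> - 1))\<^sup>2"
      by (intro power_mono mean_hmod_nonneg)
    then have "double_err 1 c n \<le> real n * ((step_size c n * \<alpha> / (\<alpha> - 1))\<^sup>2 + (step_size c n)\<^sup>2)"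
      unfolding double_err_def by (intro mult_left_mono) auto
    also have "\<dots> = ?K * (real n powr 1 * (real n powr (-1 / \<alpha>) * real n powr (-1 / \<alpha>)))"
      using n by (simp add: step_size_def power2_eq_square algebra_simps)
    also have "real n powr 1 * (real n powr (-1 / \<alpha>) * real n powr (-1 / \<alpha>)) = real n powr ((\<alpha> - 2) / \<alpha>)"
      unfolding powr_add[symmetric] using alpha by (simp add: field_simps)
    finally show ?thesis .
  qed
  fix n j :: nat assume n: "1 \<le> n"
  have "double_err 1 c (2 ^ j * n) \<le> ?K * real (2 ^ j * n) powr ((\<alpha> - 2) / \<alpha>)"
    using n by (intro e) simp
  also have "real (2 ^ j * n) powr ((\<alpha> - 2) / \<alpha>) = real n powr ((\<alpha> - 2) / \<alpha>) * (2 powr ((\<alpha> - 2) / \<alpha>)) ^ j"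
    by (simp add: powr_mult powr_power mult.commute powr_realpow[symmetric] powr_powr)
  finally show "double_err 1 c (2 ^ j * n) \<le> ?K * real n powr ((\<alpha> - 2) / \<alpha>) * (2 powr ((\<alpha> - 2) / \<alpha>)) ^ j"
    by (simp add: mult.assoc)
qed

lemma step_size_sq_le:
  assumes al: "\<alpha> \<le> 1" and n: "1 \<le> n"
  shows "(step_size c n)\<^sup>2 \<le> (c / real n)\<^sup>2"
proof -
  have "real n powr (-1 / \<alpha>) \<le> real n powr (- 1)"
    using n al alpha by (intro powr_mono) (auto simp: field_simps)
  then have "\<bar>c\<bar> * real n powr (-1 / \<alpha>) \<le> \<bar>c\<bar> * (1 / real n)"
    using n by (intro mult_left_mono) (auto simp: powr_minus_divide)
  then have "\<bar>step_size c n\<bar> \<le> \<bar>c / real n\<bar>"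
    by (simp add: step_size_def abs_mult)
  then show ?thesis by (simp only: abs_le_square_iff)
qed

lemma double_err_less_1:
  assumes al: "\<alpha> < 1" and b: "b < \<alpha>" and c: "0 < c"
  obtains K where "0 \<le> K"
    "\<And>n j. 1 \<le> n \<Longrightarrow> double_err b c (2 ^ j * n) \<le> K * inverse (real n) * (1 / 2) ^ j"
proof -
  obtain K where K: "0 \<le> K" "\<And>n. 1 \<le> n \<Longrightarrow> mean_hmod b (step_size c n) \<le> K / real n"
    by (rule mean_hmod_rate_less_1[OF al b c]) blast
  have e: "double_err b c n \<le> (K\<^sup>2 + c\<^sup>2) * inverse (real n)" if n: "1 \<le> n" for n
  proof -
    have "mean_hmod b (step_size c (2 * n)) \<le> K / real (2 * n)" using n by (intro K) simp
    also have "\<dots> \<le> K / real n" using K(1) n by (intro divide_left_mono) auto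
    finally have "(mean_hmod b (step_size c (2 * n)))\<^sup>2 \<le> (K / real n)\<^sup>2"
      by (intro power_mono mean_hmod_nonneg)
    then have "double_err b c n \<le> real n * ((K / real n)\<^sup>2 + (c / real n)\<^sup>2)"
      unfolding double_err_def using step_size_sq_le[of n c] n al by (intro mult_left_mono add_mono) auto
    also have "\<dots> = (K\<^sup>2 + c\<^sup>2) * inverse (real n)"
      using n by (simp add: power2_eq_square field_simps)
    finally show ?thesis .
  qed
  show ?thesis
  proof (rule that)
    fix n j :: nat assume "1 \<le> n"
    then have "double_err b c (2 ^ j * n) \<le> (K\<^sup>2 + c\<^sup>2) * inverse (real (2 ^ j * n))" by (intro e) simp
    then show "double_err b c (2 ^ j * n) \<le> (K\<^sup>2 + c\<^sup>2) * inverse (real n) * (1 / 2) ^ j"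
      by (simp add: field_simps)
  qed simp
qed

text \<open>Doubling \<open>j\<close> times only adds \<open>j * ln 2\<close> to the logarithm, so
  that a factor quadratic in \<open>j\<close> appears beside \<open>(1 / 2) ^ j\<close>.\<close>

lemma double_err_eq_1:
  assumes al: "\<alpha> = 1" and b: "b < 1" and c: "0 < c"
  obtains K where "0 \<le> K"
    "\<And>n j. 2 \<le> n \<Longrightarrow> double_err b c (2 ^ j * n) \<le> K * (inverse (real n) * (ln (real n))\<^sup>2) * ((real j + 2)\<^sup>2 * (1 / 2) ^ j)"
proof -
  obtain K where K: "0 \<le> K" "\<And>n. 1 \<le> n \<Longrightarrow> mean_hmod b (step_size c n) \<le> K * (1 + ln (real n)) / real n"
    by (rule mean_hmod_rate_eq_1[OF al b c]) blast
  have e: "double_err b c n \<le> (K\<^sup>2 + c\<^sup>2) * ((1 + ln (real n))\<^sup>2 / real n)" if n: "1 \<le> n" for n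
  proof -
    define l where "l = 1 + ln (real n)"
    have l1: "1 \<le> l" using n by (simp add: l_def)
    have "mean_hmod b (step_size c (2 * n)) \<le> K * (1 + ln (real (2 * n))) / real (2 * n)" using n by (intro K) simp
    also have "1 + ln (real (2 * n)) = ln 2 + l" using n by (simp add: l_def ln_mult)
    also have "K * (ln 2 + l) / real (2 * n) \<le> K * (2 * l) / real (2 * n)"
      using K(1) l1 ln_le_minus_one[of 2] by (intro divide_right_mono mult_left_mono) auto
    also have "\<dots> = K * l / real n" by simp
    finally have "(mean_hmod b (step_size c (2 * n)))\<^sup>2 \<le> (K * l / real n)\<^sup>2"
      by (intro power_mono mean_hmod_nonneg)
    moreover have "(step_size c n)\<^sup>2 \<le> (c * l / real n)\<^sup>2"
    proof -
      have "(c / real n)\<^sup>2 * 1 \<le> (c / real n)\<^sup>2 * l\<^sup>2" using l1 by (intro mult_left_mono) auto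
      then show ?thesis using step_size_sq_le[of n c] n al by (simp add: power_mult_distrib power_divide)
    qed
    ultimately have "double_err b c n \<le> real n * ((K * l / real n)\<^sup>2 + (c * l / real n)\<^sup>2)"
      unfolding double_err_def by (intro mult_left_mono add_mono) auto
    also have "\<dots> = (K\<^sup>2 + c\<^sup>2) * (l\<^sup>2 / real n)"
      using n by (simp add: power2_eq_square field_simps)
    finally show ?thesis by (simp add: l_def)
  qed
  \<comment> \<open>Since \<open>n \<ge> 2\<close>, the product \<open>q * ln n\<close> is at least
    1 and absorbs additive constants.\<close>
  define q where "q = 1 / ln (2 :: real)"
  have q: "1 \<le> q" unfolding q_def using ln_le_minus_one[of 2] by simp
  show ?thesis
  proof (rule that)
    show "0 \<le> (K\<^sup>2 + c\<^sup>2) * q\<^sup>2" by simp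
    fix n j :: nat assume n: "2 \<le> n"
    have "ln 2 \<le> ln (real n)" using n by simp
    then have l1: "1 \<le> q * ln (real n)" unfolding q_def by simp
    have "1 + ln (real (2 ^ j * n)) = 1 + real j * ln 2 + ln (real n)"
      using n by (simp add: ln_mult ln_realpow)
    also have "\<dots> \<le> (real j + 2) * (q * ln (real n))"
    proof -
      have "ln (real n) * 1 \<le> ln (real n) * q" using q n by (intro mult_left_mono) auto
      moreover have "real j * ln 2 \<le> real j * (q * ln (real n))"
        using l1 ln_le_minus_one[of 2] by (intro mult_left_mono) auto
      ultimately show ?thesis using l1 by (simp add: algebra_simps)
    qed
    finally have "(1 + ln (real (2 ^ j * n)))\<^sup>2 \<le> ((real j + 2) * (q * ln (real n)))\<^sup>2"
    proof (rule power_mono)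
      have "(1::real) * 1 \<le> 2 ^ j * real n" using n by (intro mult_mono) auto
      then show "0 \<le> 1 + ln (real (2 ^ j * n))" by simp
    qed
    then have "(K\<^sup>2 + c\<^sup>2) * ((1 + ln (real (2 ^ j * n)))\<^sup>2 / real (2 ^ j * n)) \<le> (K\<^sup>2 + c\<^sup>2) * (((real j + 2) * (q * ln (real n)))\<^sup>2 / real (2 ^ j * n))"
      by (intro mult_left_mono divide_right_mono) auto
    moreover have "double_err b c (2 ^ j * n) \<le> (K\<^sup>2 + c\<^sup>2) * ((1 + ln (real (2 ^ j * n)))\<^sup>2 / real (2 ^ j * n))"
      using n by (intro e) (simp add: Suc_leI)
    ultimately have "double_err b c (2 ^ j * n) \<le> (K\<^sup>2 + c\<^sup>2) * (((real j + 2) * (q * ln (real n)))\<^sup>2 / real (2 ^ j * n))"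
      by linarith
    also have "\<dots> = (K\<^sup>2 + c\<^sup>2) * q\<^sup>2 * (inverse (real n) * (ln (real n))\<^sup>2) * ((real j + 2)\<^sup>2 * (1 / 2) ^ j)"
    proof -
      have i: "inverse (real (2 ^ j * n)) = inverse (real n) * (1 / 2) ^ j"
        by (simp add: power_one_over inverse_eq_divide)
      have "A * ((p * (q * l))\<^sup>2 * (i * h)) = A * q\<^sup>2 * (i * l\<^sup>2) * (p\<^sup>2 * h)" for A p l i h :: real
        by (simp add: power_mult_distrib ac_simps)
      then show ?thesis unfolding divide_inverse i by blast
    qed
    finally show "double_err b c (2 ^ j * n) \<le> \<dots>" .
  qed
qed

end

lemma summable_square_half: "summable (\<lambda>j. (real j + 2)\<^sup>2 * (1 / 2) ^ j)"
proof (rule summable_ratio_test[where c="3/4" and N=10])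
  fix j :: nat assume "10 \<le> j"
  then have "10 \<le> real j" by simp
  then have "10 * 10 \<le> real j * real j" by (intro mult_mono) auto
  then have "2 * (real j + 3)\<^sup>2 \<le> 3 * (real j + 2)\<^sup>2"
    by (simp add: power2_eq_square algebra_simps)
  then show "norm ((real (Suc j) + 2)\<^sup>2 * (1 / 2) ^ Suc j) \<le> 3 / 4 * norm ((real j + 2)\<^sup>2 * (1 / 2) ^ j)"
    by (simp add: abs_mult field_simps)
qed simp

subsection \<open>Characteristic functions of the sums\<close>

lemma integrable_powr_0_1:
  assumes "0 < e"
  shows "integrable lborel (\<lambda>r::real. r powr (e - 1) * indicator {0<..1} r)"
proof -
  have "set_integrable lebesgue {0<..1::real} (\<lambda>r. r powr (e - 1))"
    using assms by (intro nonnegative_absolutely_integrable_1 integrable_on_powr_from_0') auto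
  then have "integrable (completion lborel) (\<lambda>r::real. indicator {0<..1} r * r powr (e - 1))"
    by (simp add: set_integrable_def)
  then have "integrable lborel (\<lambda>r::real. indicator {0<..1} r * r powr (e - 1))"
    by (subst (asm) integrable_completion) auto
  then show ?thesis by (simp add: mult.commute)
qed

text \<open>A majorant of the integrand below for \<open>\<bar>s\<bar> \<le> L\<close>. Near 0 the
  numerator is of order \<open>r\<close> without compensation (\<open>\<alpha> < 1\<close>) and of
  order \<open>r\<^sup>2\<close> with it; for large \<open>r\<close> it is bounded where nothing is
  compensated (\<open>\<alpha> \<le> 1\<close>) and of order \<open>r\<close> otherwise.\<close>

definition levy_dom :: "real \<Rightarrow> real \<Rightarrow> real \<Rightarrow> real" where
  "levy_dom \<alpha> L r = (L + L\<^sup>2) * (r powr ((if \<alpha> < 1 then 1 else 2) - \<alpha> - 1) * indicator {0<..1} r)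
    + (2 + L) * (r powr (-1 - (\<alpha> - (if \<alpha> \<le> 1 then 0 else 1))) * indicator {1..} r)"

lemma levy_dom_integrable:
  assumes "0 < \<alpha>" "\<alpha> < 2"
  shows "integrable lborel (levy_dom \<alpha> L)"
proof -
  define e where "e = \<alpha> - (if \<alpha> \<le> 1 then 0 else 1)"
  have e: "0 < e" using assms by (auto simp: e_def)
  have "integrable lborel (\<lambda>r. (e * r powr (-1 - e) * indicator {1..} r) / e)"
    using has_integral_pareto[OF e, of 1] by (intro integrable_divide) (auto simp: has_bochner_integral_iff)
  then have "integrable lborel (\<lambda>r. r powr (-1 - e) * indicator {1..} r)"
    using e by simp
  then show ?thesis
    unfolding levy_dom_def[abs_def] e_def[symmetric]
    using assms by (intro Bochner_Integration.integrable_add integrable_mult_right integrable_powr_0_1) auto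
qed

definition levy_integrand :: "real \<Rightarrow> real \<Rightarrow> real \<Rightarrow> complex" where
  "levy_integrand \<alpha> s r = (exp (\<i> * complex_of_real (r * s)) - 1 - \<i> * complex_of_real ((r * s) * k_trunc \<alpha> r))
      / complex_of_real (r powr (1 + \<alpha>))"

lemma iexp_1_bounds:
  "cmod (iexp x - 1) \<le> \<bar>x\<bar>" "cmod (iexp x - 1) \<le> 2"
  "cmod (iexp x - 1 - \<i> * complex_of_real x) \<le> x\<^sup>2"
  "cmod (iexp x - 1 - \<i> * complex_of_real x) \<le> 2 + \<bar>x\<bar>"
proof -
  show "cmod (iexp x - 1) \<le> \<bar>x\<bar>" using iexp_approx1[of x 0] by simp
  show 2: "cmod (iexp x - 1) \<le> 2" using iexp_approx2[of x 0] by simp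
  have "cmod (iexp x - 1 - \<i> * complex_of_real x) \<le> \<bar>x\<bar>\<^sup>2 / 2"
    using iexp_approx1[of x 1] by (simp add: diff_diff_eq numeral_2_eq_2)
  also have "\<bar>x\<bar>\<^sup>2 / 2 \<le> x\<^sup>2" by simp
  finally show "cmod (iexp x - 1 - \<i> * complex_of_real x) \<le> x\<^sup>2" .
  have "cmod (iexp x - 1 - \<i> * complex_of_real x) \<le> cmod (iexp x - 1) + cmod (\<i> * complex_of_real x)"
    by (rule norm_triangle_ineq4)
  then show "cmod (iexp x - 1 - \<i> * complex_of_real x) \<le> 2 + \<bar>x\<bar>" using 2 by (simp add: norm_mult)
qed

lemma levy_integrand_le:
  assumes al: "0 < \<alpha>" "\<alpha> < 2" and r: "0 < r" and s: "\<bar>s\<bar> \<le> L"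
  shows "cmod (levy_integrand \<alpha> s r) \<le> levy_dom \<alpha> L r"
proof -
  let ?n = "cmod (exp (\<i> * complex_of_real (r * s)) - 1 - \<i> * complex_of_real ((r * s) * k_trunc \<alpha> r))"
  have L: "0 \<le> L" using s by linarith
  have n: "cmod (levy_integrand \<alpha> s r) = ?n * r powr (-1 - \<alpha>)"
  proof -
    have "r powr (-1 - \<alpha>) = inverse (r powr (1 + \<alpha>))" by (simp add: powr_minus[symmetric])
    then show ?thesis
      unfolding levy_integrand_def norm_divide norm_of_real
      by (simp only: abs_of_nonneg[OF powr_ge_zero] divide_inverse)
  qed
  have x: "\<bar>r * s\<bar> \<le> L * r" "(r * s)\<^sup>2 \<le> L\<^sup>2 * r\<^sup>2"
  proof -
    show "\<bar>r * s\<bar> \<le> L * r" using r s by (simp add: abs_mult mult.commute)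
    then have "\<bar>r * s\<bar>\<^sup>2 \<le> (L * r)\<^sup>2" by (intro power_mono) auto
    then show "(r * s)\<^sup>2 \<le> L\<^sup>2 * r\<^sup>2" by (simp add: power_mult_distrib)
  qed
  have pw: "r powr k * r powr (-1 - \<alpha>) = r powr (k - \<alpha> - 1)" for k
    unfolding powr_add[symmetric] by (simp add: algebra_simps)
  have bd: "cmod (levy_integrand \<alpha> s r) \<le> A * r powr (k - \<alpha> - 1)" if "?n \<le> A * r powr k" for A k
  proof -
    have "?n * r powr (-1 - \<alpha>) \<le> (A * r powr k) * r powr (-1 - \<alpha>)" using that by (intro mult_right_mono) auto
    then show ?thesis unfolding n by (simp add: mult.assoc pw)
  qed
  have r2: "r powr 2 = r\<^sup>2" using r powr_realpow[of r 2] by simp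
  show ?thesis
  proof (cases "r \<le> 1")
    case True
    have "?n \<le> (L + L\<^sup>2) * r powr (if \<alpha> < 1 then 1 else 2)"
    proof (cases "\<alpha> < 1")
      case T: True
      have "?n \<le> L * r" using iexp_1_bounds(1)[of "r * s"] x(1) T by (simp add: k_trunc_def)
      also have "\<dots> \<le> (L + L\<^sup>2) * r" using r by (intro mult_right_mono) auto
      finally show ?thesis using T r by simp
    next
      case F: False
      then have "k_trunc \<alpha> r = 1" using True r al by (auto simp: k_trunc_def)
      then have "?n \<le> L\<^sup>2 * r\<^sup>2" using iexp_1_bounds(3)[of "r * s"] x(2) by simp
      also have "\<dots> \<le> (L + L\<^sup>2) * r\<^sup>2" using L by (intro mult_right_mono) auto
      finally show ?thesis using F r2 by simp
    qed
    from bd[OF this] show ?thesis using r True L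
      by (simp add: levy_dom_def add_increasing2)
  next
    case False
    have "?n \<le> (2 + L) * r powr (if \<alpha> \<le> 1 then 0 else 1)"
    proof (cases "\<alpha> \<le> 1")
      case T: True
      then have "k_trunc \<alpha> r = 0" using False by (auto simp: k_trunc_def)
      then have "?n \<le> 2" using iexp_1_bounds(2)[of "r * s"] by simp
      then show ?thesis using T r L by simp
    next
      case F: False
      then have "k_trunc \<alpha> r = 1" using al by (auto simp: k_trunc_def)
      then have "?n \<le> 2 + L * r" using iexp_1_bounds(4)[of "r * s"] x(1) by simp
      also have "\<dots> \<le> (2 + L) * r" using False by (simp add: distrib_right)
      finally show ?thesis using F r by simp
    qed
    note B = bd[OF this]
    have "(if \<alpha> \<le> 1 then 0 else 1) - \<alpha> - 1 = -1 - (\<alpha> - (if \<alpha> \<le> 1 then 0 else 1))" by simp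
    note B[unfolded this]
    then show ?thesis using False unfolding levy_dom_def by simp
  qed
qed

definition levy_exponent :: "real \<Rightarrow> real \<Rightarrow> complex" where
  "levy_exponent \<alpha> s = (LINT r:{0<..}|lborel. levy_integrand \<alpha> s r)"

text \<open>Minus the real part of \<open>levy_exponent\<close>, which is all that survives
  averaging over symmetric directions.\<close>

definition levy_cos :: "real \<Rightarrow> real \<Rightarrow> real" where
  "levy_cos \<alpha> s = (\<integral>r. indicator {0<..} r * ((1 - cos (r * s)) * r powr (-1 - \<alpha>)) \<partial>lborel)"

lemma k_trunc_borel[measurable]: "k_trunc \<alpha> \<in> borel_measurable borel"
  unfolding k_trunc_def[abs_def] by measurable

lemma levy_integrand_borel[measurable]:
  "(\<lambda>(s, r). levy_integrand \<alpha> s r) \<in> borel_measurable (borel \<Otimes>\<^sub>M borel)"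
  unfolding levy_integrand_def[abs_def] by measurable

context
  fixes \<alpha> :: real
  assumes al: "0 < \<alpha>" "\<alpha> < 2"
begin

lemma levy_integrand_integrable: "set_integrable lborel {0<..} (levy_integrand \<alpha> s)"
  unfolding set_integrable_def
proof (rule Bochner_Integration.integrable_bound[OF levy_dom_integrable[OF al, of "\<bar>s\<bar>"]])
  show "AE r in lborel. norm (indicator {0<..} r *\<^sub>R levy_integrand \<alpha> s r) \<le> norm (levy_dom \<alpha> \<bar>s\<bar> r)"
  proof (rule AE_I2)
    fix r
    show "norm (indicator {0<..} r *\<^sub>R levy_integrand \<alpha> s r) \<le> norm (levy_dom \<alpha> \<bar>s\<bar> r)"
      using levy_integrand_le[OF al, of r s "\<bar>s\<bar>"] by (cases "0 < r") auto
  qed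
qed measurable

lemma levy_exponent_borel[measurable]: "levy_exponent \<alpha> \<in> borel_measurable borel"
  unfolding levy_exponent_def[abs_def] set_lebesgue_integral_def by measurable

lemma levy_exponent_bounded: "\<bar>s\<bar> \<le> L \<Longrightarrow> cmod (levy_exponent \<alpha> s) \<le> (\<integral>r. levy_dom \<alpha> L r \<partial>lborel)"
  unfolding levy_exponent_def set_lebesgue_integral_def
proof (rule order_trans[OF integral_norm_bound], rule integral_mono[OF _ levy_dom_integrable[OF al]])
  show "integrable lborel (\<lambda>r. norm (indicator {0<..} r *\<^sub>R levy_integrand \<alpha> s r))"
    using levy_integrand_integrable[of s] unfolding set_integrable_def by (rule integrable_norm)
  assume s: "\<bar>s\<bar> \<le> L"
  fix r
  have "0 \<le> levy_dom \<alpha> L r" using s unfolding levy_dom_def by (intro add_nonneg_nonneg mult_nonneg_nonneg) auto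
  then show "norm (indicator {0<..} r *\<^sub>R levy_integrand \<alpha> s r) \<le> levy_dom \<alpha> L r"
    using levy_integrand_le[OF al, of r s L] s by (cases "0 < r") auto
qed

lemma levy_exponent_uminus: "levy_exponent \<alpha> (- s) = cnj (levy_exponent \<alpha> s)"
proof -
  have "indicator {0<..} r *\<^sub>R levy_integrand \<alpha> (- s) r = cnj (indicator {0<..} r *\<^sub>R levy_integrand \<alpha> s r)" for r
    by (simp add: levy_integrand_def exp_cnj)
  then show ?thesis unfolding levy_exponent_def set_lebesgue_integral_def by (simp only: Bochner_Integration.integral_cnj)
qed

lemma Re_levy_integrand: "Re (levy_integrand \<alpha> s r) = - ((1 - cos (r * s)) * r powr (-1 - \<alpha>))"
proof -
  have e: "r powr (-1 - \<alpha>) = inverse (r powr (1 + \<alpha>))" by (simp add: powr_minus[symmetric])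
  have "Re (exp (\<i> * complex_of_real (r * s)) - 1 - \<i> * complex_of_real ((r * s) * k_trunc \<alpha> r)) = cos (r * s) - 1"
    by (simp add: Re_exp)
  then show ?thesis
    unfolding levy_integrand_def Re_divide_of_real e by (simp only: divide_inverse) (simp add: algebra_simps)
qed

lemma Re_levy_exponent: "Re (levy_exponent \<alpha> s) = - levy_cos \<alpha> s"
proof -
  have "Re (levy_exponent \<alpha> s) = (\<integral>r. Re (indicator {0<..} r *\<^sub>R levy_integrand \<alpha> s r) \<partial>lborel)"
    unfolding levy_exponent_def set_lebesgue_integral_def
    using levy_integrand_integrable[of s] by (subst integral_Re) (auto simp: set_integrable_def)
  also have "\<dots> = (\<integral>r. - (indicator {0<..} r * ((1 - cos (r * s)) * r powr (-1 - \<alpha>))) \<partial>lborel)"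
    by (simp add: Re_levy_integrand)
  finally show ?thesis unfolding levy_cos_def by simp
qed

lemma levy_cos_integrable:
  "integrable lborel (\<lambda>r. indicator {0<..} r * ((1 - cos (r * s)) * r powr (-1 - \<alpha>)))"
  "0 < r \<Longrightarrow> \<bar>s\<bar> \<le> L \<Longrightarrow> (1 - cos (r * s)) * r powr (-1 - \<alpha>) \<le> levy_dom \<alpha> L r"
proof -
  have "integrable lborel (\<lambda>r. - Re (indicator {0<..} r *\<^sub>R levy_integrand \<alpha> s r))"
    using levy_integrand_integrable[of s] unfolding set_integrable_def by (intro integrable_minus integrable_Re)
  then show "integrable lborel (\<lambda>r. indicator {0<..} r * ((1 - cos (r * s)) * r powr (-1 - \<alpha>)))"
    by (simp add: Re_levy_integrand)
  assume "0 < r" "\<bar>s\<bar> \<le> L"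
  then show "(1 - cos (r * s)) * r powr (-1 - \<alpha>) \<le> levy_dom \<alpha> L r"
    using levy_integrand_le[OF al, of r s L] abs_Re_le_cmod[of "levy_integrand \<alpha> s r"] Re_levy_integrand[of s r]
    by linarith
qed

lemma levy_cos_borel[measurable]: "levy_cos \<alpha> \<in> borel_measurable borel"
  unfolding levy_cos_def[abs_def] by measurable

lemma levy_cos_nonneg: "0 \<le> levy_cos \<alpha> s"
  unfolding levy_cos_def by (intro integral_nonneg_AE) auto

end

section \<open>Characteristic functions of symmetric jumps and their limit\<close>

context jump_law
begin

text \<open>For symmetric \<open>\<nu>\<close> the conjugate exponents of opposite directions cancel to the cosine part.\<close>

lemma levy_exponent_integral:
  "(\<integral>\<theta>. levy_exponent \<alpha> (l \<bullet> \<theta>) \<partial>\<nu>) = - complex_of_real (\<integral>\<theta>. levy_cos \<alpha> (l \<bullet> \<theta>) \<partial>\<nu>)"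
proof -
  interpret prob_space \<nu> by (rule prob_nu)
  note [measurable] = levy_exponent_borel[OF alpha]
  let ?J = "\<integral>\<theta>. levy_exponent \<alpha> (l \<bullet> \<theta>) \<partial>\<nu>"
  have int: "integrable \<nu> (\<lambda>\<theta>. levy_exponent \<alpha> (l \<bullet> \<theta>))"
  proof (rule integrable_const_bound)
    show "AE \<theta> in \<nu>. norm (levy_exponent \<alpha> (l \<bullet> \<theta>)) \<le> (\<integral>r. levy_dom \<alpha> (norm l) r \<partial>lborel)"
      using nu(3)
    proof eventually_elim
      case (elim \<theta>)
      then show ?case using levy_exponent_bounded[OF alpha, of "l \<bullet> \<theta>" "norm l"] Cauchy_Schwarz_ineq2[of l \<theta>] by simp
    qed
  qed measurable
  have "?J = (\<integral>\<theta>. levy_exponent \<alpha> (l \<bullet> \<theta>) \<partial>distr \<nu> borel uminus)" by (simp only: nu_sym)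
  also have "\<dots> = (\<integral>\<theta>. levy_exponent \<alpha> (- (l \<bullet> \<theta>)) \<partial>\<nu>)" by (subst integral_distr) auto
  also have "\<dots> = cnj ?J" by (simp add: levy_exponent_uminus[OF alpha])
  finally have "Im ?J = 0" by (metis complex_cnj_cancel_iff cnj.sel(2) neg_equal_zero)
  moreover have "Re ?J = - (\<integral>\<theta>. levy_cos \<alpha> (l \<bullet> \<theta>) \<partial>\<nu>)"
    by (subst integral_Re[OF int, symmetric]) (simp add: Re_levy_exponent[OF alpha])
  ultimately show ?thesis by (simp add: complex_eq_iff)
qed

definition cos_char :: "'a \<Rightarrow> real" where
  "cos_char l = (\<integral>y. cos (l \<bullet> y) \<partial>jump)"

lemma bmf_cos: "bmf (\<lambda>y. cos (l \<bullet> y + t))" and bmf_sin: "bmf (\<lambda>y. sin (l \<bullet> y + t))"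
  unfolding bmf_def by (auto intro!: exI[of _ 1])

text \<open>The sine transform of a symmetric jump vanishes, so phase-shifted cosines are
  eigenfunctions of averaging. The phase is kept because \<open>t = - (pi / 2)\<close> gives the
  sine.\<close>

lemma avg_sjump_cos: "avg (sjump a) (\<lambda>z. cos (l \<bullet> z + t)) = (\<lambda>z. cos_char (a *\<^sub>R l) * cos (l \<bullet> z + t))"
proof
  fix z
  interpret prob_space jump by (rule prob_jump)
  have iS: "integrable jump (\<lambda>y. sin (l \<bullet> (a *\<^sub>R y) + 0))" and iC: "integrable jump (\<lambda>y. cos (l \<bullet> (a *\<^sub>R y) + 0))"
    by (intro bmf_integrable[OF jump_fin_borel(1)] bmf_scale[OF bmf_sin] bmf_scale[OF bmf_cos])+
  have s0: "(\<integral>y. sin (l \<bullet> (a *\<^sub>R y) + 0) \<partial>jump) = 0"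
    using integral_jump_uminus[OF bmf_scale[OF bmf_sin[of l 0], of a]] by simp
  have "avg (sjump a) (\<lambda>z. cos (l \<bullet> z + t)) z = (\<integral>y. cos (l \<bullet> (z + a *\<^sub>R y) + t) \<partial>jump)"
    by (rule avg_sjump[OF bmf_cos])
  also have "\<dots> = (\<integral>y. cos (l \<bullet> z + t) * cos (l \<bullet> (a *\<^sub>R y) + 0) - sin (l \<bullet> z + t) * sin (l \<bullet> (a *\<^sub>R y) + 0) \<partial>jump)"
    by (intro Bochner_Integration.integral_cong refl) (simp add: cos_add[symmetric] inner_add_right algebra_simps)
  also have "\<dots> = cos (l \<bullet> z + t) * (\<integral>y. cos (l \<bullet> (a *\<^sub>R y) + 0) \<partial>jump) - sin (l \<bullet> z + t) * (\<integral>y. sin (l \<bullet> (a *\<^sub>R y) + 0) \<partial>jump)"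
    by (subst Bochner_Integration.integral_diff) (use iS iC in simp_all)
  also have "\<dots> = cos_char (a *\<^sub>R l) * cos (l \<bullet> z + t)"
    unfolding s0 by (simp add: cos_char_def)
  finally show "avg (sjump a) (\<lambda>z. cos (l \<bullet> z + t)) z = cos_char (a *\<^sub>R l) * cos (l \<bullet> z + t)" .
qed

lemma avg_cmult: "avg \<kappa> (\<lambda>z. c * F z) = (\<lambda>z. c * avg \<kappa> F z)"
  unfolding avg_def by simp

lemma avg_pow_sjump_cos:
  "(avg (sjump a) ^^ n) (\<lambda>z. cos (l \<bullet> z + t)) = (\<lambda>z. cos_char (a *\<^sub>R l) ^ n * cos (l \<bullet> z + t))"
  by (induction n) (simp_all add: avg_cmult avg_sjump_cos mult.assoc mult.left_commute)

text \<open>The hypothesis \<open>avg\<close> says that \<open>L\<close> is the law of a sum of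
  \<open>n\<close> jumps scaled by \<open>a\<close>. Testing it on cosines of phase 0 and
  \<open>- (pi / 2)\<close> gives the real and the imaginary part.\<close>

lemma char_of_avg_pow:
  assumes L: "prob_space L" and sL[measurable_cong]: "sets L = sets borel"
    and avg: "\<And>h. bmf h \<Longrightarrow> (\<integral>y. h y \<partial>L) = (avg (sjump a) ^^ n) h 0"
  shows "(\<integral>y. iexp (l \<bullet> y) \<partial>L) = complex_of_real (cos_char (a *\<^sub>R l) ^ n)"
proof -
  interpret prob_space L by fact
  have int: "integrable L (\<lambda>y. iexp (l \<bullet> y))" by (intro integrable_const_bound[where B=1]) auto
  have "Re (\<integral>y. iexp (l \<bullet> y) \<partial>L) = (\<integral>y. cos (l \<bullet> y + 0) \<partial>L)"
    by (subst integral_Re[OF int, symmetric]) (simp add: Re_exp)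
  also have "\<dots> = cos_char (a *\<^sub>R l) ^ n" unfolding avg[OF bmf_cos] avg_pow_sjump_cos by simp
  finally have 1: "Re (\<integral>y. iexp (l \<bullet> y) \<partial>L) = cos_char (a *\<^sub>R l) ^ n" .
  have "Im (\<integral>y. iexp (l \<bullet> y) \<partial>L) = (\<integral>y. cos (l \<bullet> y + - (pi / 2)) \<partial>L)"
    by (subst integral_Im[OF int, symmetric]) (simp add: Im_exp cos_diff)
  also have "\<dots> = 0" unfolding avg[OF bmf_cos] avg_pow_sjump_cos by simp
  finally show ?thesis using 1 by (simp add: complex_eq_iff)
qed

text \<open>The substitution \<open>r = a * u\<close> turns the Pareto density into
  \<open>\<alpha> * a powr \<alpha>\<close> times the Levy density cut off at radius
  \<open>a\<close>.\<close>

lemma one_minus_cos_char: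
  assumes a: "0 < a"
  shows "1 - cos_char (a *\<^sub>R l) = \<alpha> * a powr \<alpha> *
    (\<integral>\<theta>. (\<integral>r. indicator {a..} r * ((1 - cos (r * (l \<bullet> \<theta>))) * r powr (-1 - \<alpha>)) \<partial>lborel) \<partial>\<nu>)"
proof -
  interpret prob_space jump by (rule prob_jump)
  have b: "bmf (\<lambda>y. 1 - cos (a *\<^sub>R l \<bullet> y + 0))"
    by (intro bmf_diff bmf_cos) (auto simp: bmf_def)
  have "1 - cos_char (a *\<^sub>R l) = (\<integral>y. 1 - cos (a *\<^sub>R l \<bullet> y + 0) \<partial>jump)"
    unfolding cos_char_def
    by (subst Bochner_Integration.integral_diff) (use bmf_integrable[OF jump_fin_borel(1) bmf_cos[of "a *\<^sub>R l" 0]] prob_space in auto)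
  also have "\<dots> = (\<integral>\<theta>. (\<integral>u. 1 - cos (a *\<^sub>R l \<bullet> (u *\<^sub>R \<theta>) + 0) \<partial>pareto \<alpha> 1) \<partial>\<nu>)"
    by (rule integral_jump[OF b])
  also have "\<dots> = (\<integral>\<theta>. \<alpha> * a powr \<alpha> * (\<integral>r. indicator {a..} r * ((1 - cos (r * (l \<bullet> \<theta>))) * r powr (-1 - \<alpha>)) \<partial>lborel) \<partial>\<nu>)"
  proof (rule Bochner_Integration.integral_cong[OF refl])
    fix \<theta>
    have "(\<integral>u. 1 - cos (a *\<^sub>R l \<bullet> (u *\<^sub>R \<theta>) + 0) \<partial>pareto \<alpha> 1)
       = (\<integral>u. \<alpha> * u powr (-1 - \<alpha>) * indicator {1..} u * (1 - cos (a * u * (l \<bullet> \<theta>))) \<partial>lborel)"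
      using alpha by (subst integral_pareto) (auto simp: ac_simps)
    also have "\<dots> = (\<integral>r. \<alpha> * (r / a) powr (-1 - \<alpha>) * indicator {1..} (r / a) * (1 - cos (r * (l \<bullet> \<theta>))) / a \<partial>lborel)"
      using a by (subst lborel_integral_real_affine[of "1 / a" _ 0]) (auto simp: abs_if)
    also have "\<dots> = (\<integral>r. \<alpha> * a powr \<alpha> * (indicator {a..} r * ((1 - cos (r * (l \<bullet> \<theta>))) * r powr (-1 - \<alpha>))) \<partial>lborel)"
    proof (rule Bochner_Integration.integral_cong[OF refl])
      fix r
      have "a powr (-1 - \<alpha>) * (a powr 1 * a powr \<alpha>) = 1"
        unfolding powr_add[symmetric] using a by simp
      note e = inverse_unique[OF this]
      have "(r / a) powr (-1 - \<alpha>) = r powr (-1 - \<alpha>) / a powr (-1 - \<alpha>)"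
        by (rule powr_divide)
      also have "\<dots> = r powr (-1 - \<alpha>) * (a powr 1 * a powr \<alpha>)"
        by (simp only: divide_inverse e)
      finally have e: "(r / a) powr (-1 - \<alpha>) = r powr (-1 - \<alpha>) * (a * a powr \<alpha>)" using a by simp
      have i: "indicator {1..} (r / a) = (indicator {a..} r :: real)" using a by (auto simp: indicator_def field_simps)
      show "\<alpha> * (r / a) powr (-1 - \<alpha>) * indicator {1..} (r / a) * (1 - cos (r * (l \<bullet> \<theta>))) / a
        = \<alpha> * a powr \<alpha> * (indicator {a..} r * ((1 - cos (r * (l \<bullet> \<theta>))) * r powr (-1 - \<alpha>)))"
        unfolding e i using a by simp
    qed
    finally show "(\<integral>u. 1 - cos (a *\<^sub>R l \<bullet> (u *\<^sub>R \<theta>) + 0) \<partial>pareto \<alpha> 1)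
       = \<alpha> * a powr \<alpha> * (\<integral>r. indicator {a..} r * ((1 - cos (r * (l \<bullet> \<theta>))) * r powr (-1 - \<alpha>)) \<partial>lborel)"
      by simp
  qed
  finally show ?thesis by simp
qed

lemma cos_char_tendsto:
  assumes c: "0 < c"
  shows "(\<lambda>n. real n * (1 - cos_char (step_size c n *\<^sub>R l))) \<longlonglongrightarrow> \<alpha> * c powr \<alpha> * (\<integral>\<theta>. levy_cos \<alpha> (l \<bullet> \<theta>) \<partial>\<nu>)"
proof -
  interpret prob_space \<nu> by (rule prob_nu)
  note [measurable] = levy_cos_borel[OF alpha]
  let ?f = "\<lambda>r \<theta>. (1 - cos (r * (l \<bullet> \<theta>))) * r powr (-1 - \<alpha>)"
  have step0: "(\<lambda>n. step_size c n) \<longlonglongrightarrow> 0"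
  proof -
    have "(\<lambda>n. real n powr (-1 / \<alpha>)) \<longlonglongrightarrow> 0"
      using tendsto_neg_powr[OF _ filterlim_real_sequentially, of "-1/\<alpha>"] alpha by simp
    from tendsto_mult_left[OF this, of c] show ?thesis by (simp add: step_size_def[abs_def])
  qed
  have D: "norm (indicator {step_size c n..} r * ?f r \<theta>) \<le> levy_dom \<alpha> (norm l) r"
    if th: "norm \<theta> = 1" and n: "1 \<le> n" for n r \<theta>
  proof (cases "step_size c n \<le> r")
    case True
    then have r: "0 < r" using step_size_pos[OF c n] by linarith
    have "\<bar>l \<bullet> \<theta>\<bar> \<le> norm l" using Cauchy_Schwarz_ineq2[of l \<theta>] th by simp
    from levy_cos_integrable(2)[OF alpha r this] show ?thesis using True by (simp add: abs_mult)
  next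
    case False
    have "0 \<le> levy_dom \<alpha> (norm l) r" unfolding levy_dom_def by (intro add_nonneg_nonneg mult_nonneg_nonneg) auto
    then show ?thesis using False by simp
  qed
  have inner: "(\<lambda>n. \<integral>r. indicator {step_size c (Suc n)..} r * ?f r \<theta> \<partial>lborel) \<longlonglongrightarrow> levy_cos \<alpha> (l \<bullet> \<theta>)"
    if th: "norm \<theta> = 1" for \<theta>
    unfolding levy_cos_def
  proof (rule integral_dominated_convergence[where w="levy_dom \<alpha> (norm l)"])
    show "AE r in lborel. (\<lambda>n. indicator {step_size c (Suc n)..} r * ?f r \<theta>) \<longlonglongrightarrow> indicator {0<..} r * ?f r \<theta>"
    proof (rule AE_I2, rule tendsto_mult[OF _ tendsto_const])
      fix r :: real
      show "(\<lambda>n. indicat_real {step_size c (Suc n)..} r) \<longlonglongrightarrow> indicator {0<..} r"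
      proof (cases "0 < r")
        case True
        have "eventually (\<lambda>n. step_size c (Suc n) < r) sequentially"
          using order_tendstoD(2)[OF LIMSEQ_Suc[OF step0] True] .
        then have "eventually (\<lambda>n. indicat_real {step_size c (Suc n)..} r = indicator {0<..} r) sequentially"
          by eventually_elim (use True in auto)
        then show ?thesis by (rule tendsto_eventually)
      next
        case False
        then have "indicat_real {step_size c (Suc n)..} r = indicator {0<..} r" for n
          using step_size_pos[OF c, of "Suc n"] by auto
        then show ?thesis by simp
      qed
    qed
  qed (use D[OF th] levy_dom_integrable[OF alpha] in auto)
  have outer: "(\<lambda>n. \<integral>\<theta>. (\<integral>r. indicator {step_size c (Suc n)..} r * ?f r \<theta> \<partial>lborel) \<partial>\<nu>) \<longlonglongrightarrow> (\<integral>\<theta>. levy_cos \<alpha> (l \<bullet> \<theta>) \<partial>\<nu>)"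
  proof (rule integral_dominated_convergence[where w="\<lambda>_. \<integral>r. levy_dom \<alpha> (norm l) r \<partial>lborel"])
    show "AE \<theta> in \<nu>. (\<lambda>n. \<integral>r. indicator {step_size c (Suc n)..} r * ?f r \<theta> \<partial>lborel) \<longlonglongrightarrow> levy_cos \<alpha> (l \<bullet> \<theta>)"
      using nu(3) by eventually_elim (rule inner)
    show "AE \<theta> in \<nu>. norm (\<integral>r. indicator {step_size c (Suc n)..} r * ?f r \<theta> \<partial>lborel) \<le> (\<integral>r. levy_dom \<alpha> (norm l) r \<partial>lborel)" for n
      using nu(3)
    proof eventually_elim
      case (elim \<theta>)
      show ?case
        using integral_abs_le[OF levy_dom_integrable[OF alpha], of "\<lambda>r. indicator {step_size c (Suc n)..} r * ?f r \<theta>" "norm l"] D[OF elim, of "Suc n"] by simp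
    qed
  qed measurable
  have "real n * (1 - cos_char (step_size c n *\<^sub>R l)) = \<alpha> * c powr \<alpha> * (\<integral>\<theta>. (\<integral>r. indicator {step_size c n..} r * ?f r \<theta> \<partial>lborel) \<partial>\<nu>)"
    if n: "1 \<le> n" for n
  proof -
    \<comment> \<open>The normalisation makes the prefactor independent of \<open>n\<close>; only
      the cutoff radius still depends on \<open>n\<close>, and it tends to 0.\<close>
    have "real n * step_size c n powr \<alpha> = c powr \<alpha>"
    proof -
      have "(real n powr (-1 / \<alpha>)) powr \<alpha> = 1 / real n"
        unfolding powr_powr using n alpha by (simp add: powr_minus_divide)
      moreover have "step_size c n powr \<alpha> = c powr \<alpha> * (real n powr (-1 / \<alpha>)) powr \<alpha>"
        unfolding step_size_def by (rule powr_mult)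
      ultimately show ?thesis using n by simp
    qed
    then show ?thesis unfolding one_minus_cos_char[OF step_size_pos[OF c n]]
      by (metis (no_types, lifting) mult.assoc mult.left_commute)
  qed
  then have "(\<lambda>n. real (Suc n) * (1 - cos_char (step_size c (Suc n) *\<^sub>R l))) = (\<lambda>n. \<alpha> * c powr \<alpha> * (\<integral>\<theta>. (\<integral>r. indicator {step_size c (Suc n)..} r * ?f r \<theta> \<partial>lborel) \<partial>\<nu>))"
    by (intro ext) (simp del: of_nat_Suc)
  with tendsto_mult_left[OF outer, of "\<alpha> * c powr \<alpha>"]
  have "(\<lambda>n. real (Suc n) * (1 - cos_char (step_size c (Suc n) *\<^sub>R l))) \<longlonglongrightarrow> \<alpha> * c powr \<alpha> * (\<integral>\<theta>. levy_cos \<alpha> (l \<bullet> \<theta>) \<partial>\<nu>)"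
    by simp
  then show ?thesis by (rule LIMSEQ_imp_Suc)
qed

lemma abs_cos_char_le: "\<bar>cos_char l\<bar> \<le> 1"
  using integral_abs_le_const[of jump 1 "\<lambda>y. cos (l \<bullet> y)"] fin_borelD[OF jump_fin_borel(1)] jump_fin_borel(2)
  unfolding cos_char_def by simp

text \<open>Comparison with \<open>(1 - x / n) ^ n\<close>: for bases of modulus at most 1, the
  \<open>n\<close>-th powers differ by at most \<open>n\<close> times the difference of the
  bases.\<close>

lemma cos_char_pow_tendsto:
  assumes c: "0 < c"
  shows "(\<lambda>n. cos_char (step_size c n *\<^sub>R l) ^ n) \<longlonglongrightarrow> exp (- (\<alpha> * c powr \<alpha> * (\<integral>\<theta>. levy_cos \<alpha> (l \<bullet> \<theta>) \<partial>\<nu>)))"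
proof -
  define x where "x = \<alpha> * c powr \<alpha> * (\<integral>\<theta>. levy_cos \<alpha> (l \<bullet> \<theta>) \<partial>\<nu>)"
  have x0: "0 \<le> x" unfolding x_def using alpha levy_cos_nonneg[OF alpha] by (intro mult_nonneg_nonneg integral_nonneg_AE) auto
  let ?p = "\<lambda>n. cos_char (step_size c n *\<^sub>R l)"
  have lim: "(\<lambda>n. real n * (1 - ?p n)) \<longlonglongrightarrow> x" unfolding x_def by (rule cos_char_tendsto[OF c])
  have "(\<lambda>n. ?p n ^ n - (1 + (- x) / real n) ^ n) \<longlonglongrightarrow> 0"
  proof (rule Lim_null_comparison)
    show "(\<lambda>n. \<bar>real n * (1 - ?p n) - x\<bar>) \<longlonglongrightarrow> 0"
      using tendsto_rabs[OF LIM_zero[OF lim]] by simp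
    \<comment> \<open>Keeps the comparison base \<open>1 - x / n\<close> between 0 and 1.\<close>
    have "eventually (\<lambda>n. x < real n) sequentially"
      using filterlim_real_sequentially by (auto simp: filterlim_at_top_dense)
    then show "eventually (\<lambda>n. norm (?p n ^ n - (1 + (- x) / real n) ^ n) \<le> \<bar>real n * (1 - ?p n) - x\<bar>) sequentially"
    proof eventually_elim
      case (elim n)
      have n: "0 < real n" using x0 elim by linarith
      have "norm (1 + (- x) / real n) \<le> 1" using x0 elim n by (simp add: abs_le_iff field_simps)
      then have "norm (?p n ^ n - (1 + (- x) / real n) ^ n) \<le> n * norm (?p n - (1 + (- x) / real n))"
        using abs_cos_char_le by (intro norm_power_diff) auto
      also have "\<dots> = \<bar>real n * (?p n - (1 + (- x) / real n))\<bar>" by (simp add: abs_mult)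
      also have "real n * (?p n - (1 + (- x) / real n)) = - (real n * (1 - ?p n) - x)"
        using n by (simp add: field_simps)
      finally show ?case by simp
    qed
  qed
  from tendsto_add[OF this tendsto_exp_limit_sequentially[of "- x"]] show ?thesis by (simp add: x_def)
qed

end

subsection \<open>Test functions and laws\<close>

text \<open>If the value were 1, then \<open>l \<bullet> x\<close> would almost surely be an integer
  multiple of \<open>2 * pi\<close>, so \<open>\<pi>\<close> would live on countably many
  hyperplanes, a Lebesgue null set. This serves both for the nondegeneracy of \<open>\<nu>\<close>
  and for the positivity of \<open>d_const \<alpha>\<close>.\<close>

lemma char_density_ne_1:
  fixes \<pi> :: "'a::euclidean_space measure"
  assumes pi: "prob_space \<pi>" "sets \<pi> = sets borel" and dens: "has_density \<pi>" and l: "l \<noteq> 0"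
  shows "(\<integral>x. iexp (l \<bullet> x) \<partial>\<pi>) \<noteq> 1"
proof
  assume 1: "(\<integral>x. iexp (l \<bullet> x) \<partial>\<pi>) = 1"
  interpret prob_space \<pi> by fact
  note [measurable_cong] = pi(2)
  have ie: "integrable \<pi> (\<lambda>x. iexp (l \<bullet> x))" by (intro integrable_const_bound[where B=1]) auto
  have ic: "integrable \<pi> (\<lambda>x. cos (l \<bullet> x))" by (intro integrable_const_bound[where B=1]) auto
  have "(\<integral>x. cos (l \<bullet> x) \<partial>\<pi>) = Re (\<integral>x. iexp (l \<bullet> x) \<partial>\<pi>)"
    by (subst integral_Re[OF ie, symmetric]) (simp add: Re_exp)
  then have "(\<integral>x. 1 - cos (l \<bullet> x) \<partial>\<pi>) = 0"
    using ic 1 by (simp add: prob_space)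
  then have AE1: "AE x in \<pi>. cos (l \<bullet> x) = 1"
    using ic by (subst (asm) integral_nonneg_eq_0_iff_AE) auto
  obtain p where p: "p \<in> borel_measurable lborel" "\<pi> = density lborel p"
    using dens unfolding has_density_def by blast
  have "AE x in lborel. \<forall>k::int. l \<bullet> x \<noteq> of_int k * 2 * pi"
    unfolding AE_all_countable
  proof
    fix k :: int
    have "negligible {x. l \<bullet> x = of_int k * 2 * pi}" using l by (intro negligible_hyperplane) auto
    then have "{x. l \<bullet> x = of_int k * 2 * pi} \<in> null_sets lborel"
      unfolding negligible_iff_null_sets by (subst (asm) null_sets_completion_iff) auto
    from AE_not_in[OF this] show "AE x in lborel. l \<bullet> x \<noteq> of_int k * 2 * pi" by simp
  qed
  then have "AE x in \<pi>. \<forall>k::int. l \<bullet> x \<noteq> of_int k * 2 * pi"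
    unfolding p(2) using p(1) by (subst AE_density) (auto elim: eventually_mono)
  with AE1 have "AE x in \<pi>. False"
    by eventually_elim (auto simp: cos_one_2pi_int)
  then show False by simp
qed

text \<open>The function \<open>min t (t powr b)\<close> is increasing and equals \<open>t\<close>
  times a nonincreasing function, which makes it subadditive.\<close>

lemma hmod_add_le:
  assumes b: "0 < b" "b \<le> 1"
  shows "hmod b (x + y) \<le> hmod b x + hmod b y"
proof -
  define \<phi> where "\<phi> = (\<lambda>t::real. min t (t powr b))"
  define \<rho> where "\<rho> = (\<lambda>t::real. min 1 (t powr (b - 1)))"
  have eq: "\<phi> t = t * \<rho> t" if "0 \<le> t" for t
  proof (cases "t = 0")
    case False
    then have t: "0 < t" using that by simp
    have "t powr b = t powr 1 * t powr (b - 1)" unfolding powr_add[symmetric] by simp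
    then show ?thesis using t unfolding \<phi>_def \<rho>_def by (simp add: min_mult_distrib_left)
  qed (simp add: \<phi>_def)
  have anti: "\<rho> t \<le> \<rho> s" if "0 < s" "s \<le> t" for s t
    using powr_mono2'[of "b - 1" s t] that b unfolding \<rho>_def by (auto simp: min_le_iff_disj)
  have mono: "\<phi> s \<le> \<phi> t" if "0 \<le> s" "s \<le> t" for s t
    using powr_mono2[of b s t] that b unfolding \<phi>_def by (intro min.mono) auto
  have sub: "\<phi> (s + t) \<le> \<phi> s + \<phi> t" if "0 \<le> s" "0 \<le> t" for s t
  proof (cases "s = 0 \<or> t = 0")
    case True
    then show ?thesis by (auto simp: \<phi>_def)
  next
    case False
    then have "0 < s" "0 < t" using that by auto
    then have "s * \<rho> (s + t) + t * \<rho> (s + t) \<le> s * \<rho> s + t * \<rho> t"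
      by (intro add_mono mult_left_mono anti) auto
    then show ?thesis using that by (simp add: eq distrib_right)
  qed
  have "hmod b (x + y) = \<phi> (norm (x + y))" by (simp add: hmod_def \<phi>_def)
  also have "\<dots> \<le> \<phi> (norm x + norm y)" by (intro mono norm_triangle_ineq) simp
  also have "\<dots> \<le> \<phi> (norm x) + \<phi> (norm y)" by (intro sub) auto
  finally show ?thesis by (simp add: hmod_def \<phi>_def)
qed

lemma H_class_iff: "h \<in> H_class b \<longleftrightarrow> (\<forall>x y. \<bar>h x - h y\<bar> \<le> hmod b (x - y))"
  unfolding H_class_def hmod_def by simp

text \<open>As the modulus is itself a test function, bounds for test functions can transfer its
  integrability from the sums to \<open>\<pi>\<close>.\<close>

lemma hmod_H_class:
  assumes b: "0 < b" "b \<le> 1"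
  shows "hmod b \<in> H_class b"
  unfolding H_class_iff
proof (intro allI)
  fix x y :: 'a
  have "hmod b x \<le> hmod b (x - y) + hmod b y" using hmod_add_le[OF b, of "x - y" y] by simp
  moreover have "hmod b y \<le> hmod b (x - y) + hmod b x"
    using hmod_add_le[OF b, of "y - x" x] hmod_uminus[of b "x - y"] by simp
  ultimately show "\<bar>hmod b x - hmod b y\<bar> \<le> hmod b (x - y)" by linarith
qed

lemma H_class_truncate:
  assumes "h \<in> H_class b"
  shows "(\<lambda>x. max (- R) (min R (h x))) \<in> H_class b"
  unfolding H_class_iff
proof (intro allI)
  fix x y :: 'a
  have "\<bar>max (- R) (min R (h x)) - max (- R) (min R (h y))\<bar> \<le> \<bar>h x - h y\<bar>" by linarith
  then show "\<bar>max (- R) (min R (h x)) - max (- R) (min R (h y))\<bar> \<le> hmod b (x - y)"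
    using assms unfolding H_class_iff by (meson order_trans)
qed

lemma H_class_borel:
  assumes "h \<in> H_class b" shows "h \<in> borel_measurable borel"
proof -
  have "1-lipschitz_on UNIV h"
    using assms unfolding H_class_iff
    by (intro lipschitz_onI) (auto simp: dist_norm intro: order_trans[OF _ hmod_le_norm])
  then show ?thesis by (intro borel_measurable_continuous_onI lipschitz_on_continuous_on)
qed

lemma bmf_truncate:
  assumes "h \<in> H_class b" shows "bmf (\<lambda>x. max (- R) (min R (h x)))"
proof -
  note [measurable] = H_class_borel[OF assms]
  have "\<bar>max (- R) (min R (h x))\<bar> \<le> \<bar>R\<bar>" for x by linarith
  then show ?thesis unfolding bmf_def by (intro conjI exI[of _ "\<bar>R\<bar>"] allI) measurable
qed

text \<open>An estimate for bounded test functions carries over by truncation; applied to truncations of \<open>hmod\<close>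
  it also yields the integrability under \<open>\<pi>\<close>.\<close>

lemma ipm_H_class_le:
  fixes L \<pi> :: "'a::euclidean_space measure"
  assumes b: "0 < b" "b \<le> 1"
    and L: "prob_space L" "sets L = sets borel" and pi: "prob_space \<pi>" "sets \<pi> = sets borel"
    and int: "integrable L (hmod b)"
    and bd: "\<And>h. bmf h \<Longrightarrow> h \<in> H_class b \<Longrightarrow> \<bar>(\<integral>x. h x \<partial>L) - (\<integral>x. h x \<partial>\<pi>)\<bar> \<le> r"
  shows "ipm (H_class b) L \<pi> \<le> ennreal r"
proof -
  interpret L: prob_space L by fact
  interpret P: prob_space \<pi> by fact
  note [measurable_cong] = L(2) pi(2)
  let ?t = "\<lambda>h R x. max (- R) (min R (h x))"
  have fL: "fin_borel L" and fP: "fin_borel \<pi>"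
    unfolding fin_borel_def using L.finite_measure_axioms P.finite_measure_axioms L(2) pi(2) by auto
  have bdt: "\<bar>(\<integral>x. ?t h R x \<partial>L) - (\<integral>x. ?t h R x \<partial>\<pi>)\<bar> \<le> r" if "h \<in> H_class b" for h R
    using that by (intro bd bmf_truncate H_class_truncate)
  have lim: "(\<lambda>n. ?t h (real n) x) \<longlonglongrightarrow> h x" for h :: "'a \<Rightarrow> real" and x
  proof (rule tendsto_eventually)
    have "eventually (\<lambda>n. \<bar>h x\<bar> < real n) sequentially"
      using filterlim_real_sequentially by (auto simp: filterlim_at_top_dense)
    then show "eventually (\<lambda>n. ?t h (real n) x = h x) sequentially"
      by eventually_elim auto
  qed
  have intP: "integrable \<pi> (hmod b)"
  proof (rule integrableI_bounded)
    let ?K = "(\<integral>x. hmod b x \<partial>L) + r"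
    have K: "(\<integral>\<^sup>+x. ennreal (?t (hmod b) (real n) x) \<partial>\<pi>) \<le> ennreal ?K" for n
    proof -
      have t: "?t (hmod b) (real n) x = min (real n) (hmod b x)" for x :: 'a using hmod_nonneg[of b x] by simp
      have iL: "integrable L (?t (hmod b) (real n))" and iP: "integrable \<pi> (?t (hmod b) (real n))"
        using bmf_integrable fL fP bmf_truncate[OF hmod_H_class[OF b]] by blast+
      have "(\<integral>x. ?t (hmod b) (real n) x \<partial>L) \<le> (\<integral>x. hmod b x \<partial>L)"
        using iL int t by (intro integral_mono) auto
      then have "(\<integral>x. ?t (hmod b) (real n) x \<partial>\<pi>) \<le> ?K"
        using bdt[OF hmod_H_class[OF b], of "real n"] by linarith
      then show ?thesis
        using iP hmod_nonneg[of b] by (subst nn_integral_eq_integral) (auto intro!: ennreal_leI simp: t)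
    qed
    have "(\<integral>\<^sup>+x. ennreal (norm (hmod b x)) \<partial>\<pi>) = (\<integral>\<^sup>+x. (SUP n. ennreal (?t (hmod b) (real n) x)) \<partial>\<pi>)"
    proof (rule nn_integral_cong)
      fix x :: 'a
      have "incseq (\<lambda>n. ennreal (?t (hmod b) (real n) x))"
        using hmod_nonneg[of b x] by (intro incseq_SucI ennreal_leI) auto
      then have "(\<lambda>n. ennreal (?t (hmod b) (real n) x)) \<longlonglongrightarrow> (SUP n. ennreal (?t (hmod b) (real n) x))"
        by (rule LIMSEQ_SUP)
      moreover have "(\<lambda>n. ennreal (?t (hmod b) (real n) x)) \<longlonglongrightarrow> ennreal (hmod b x)"
        using lim[of "hmod b" x] by (rule tendsto_ennrealI)
      ultimately show "ennreal (norm (hmod b x)) = (SUP n. ennreal (?t (hmod b) (real n) x))"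
        using hmod_nonneg[of b x] by (auto dest: LIMSEQ_unique)
    qed
    also have "\<dots> = (SUP n. \<integral>\<^sup>+x. ennreal (?t (hmod b) (real n) x) \<partial>\<pi>)"
    proof (rule nn_integral_monotone_convergence_SUP)
      show "incseq (\<lambda>n x. ennreal (?t (hmod b) (real n) (x::'a)))"
      proof (intro incseq_SucI le_funI ennreal_leI)
        show "?t (hmod b) (real n) x \<le> ?t (hmod b) (real (Suc n)) x" for n and x :: 'a
          using hmod_nonneg[of b x] by auto
      qed
    qed measurable
    also have "\<dots> \<le> ennreal ?K" by (intro SUP_least K)
    also have "\<dots> < \<infinity>" by simp
    finally show "(\<integral>\<^sup>+x. ennreal (norm (hmod b x)) \<partial>\<pi>) < \<infinity>" .
  qed measurable
  have main: "integrable L h \<and> integrable \<pi> h \<and> \<bar>(\<integral>x. h x \<partial>L) - (\<integral>x. h x \<partial>\<pi>)\<bar> \<le> r"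
    if h: "h \<in> H_class b" for h
  proof -
    note [measurable] = H_class_borel[OF h]
    have le: "\<bar>h x\<bar> \<le> \<bar>h 0\<bar> + hmod b x" for x
    proof -
      have "\<bar>h x - h 0\<bar> \<le> hmod b (x - 0)" using h unfolding H_class_iff by blast
      then show ?thesis by simp
    qed
    have ih: "integrable \<kappa> h" if "prob_space \<kappa>" "integrable \<kappa> (hmod b)" and [measurable_cong]: "sets \<kappa> = sets borel" for \<kappa>
    proof (rule Bochner_Integration.integrable_bound)
      interpret prob_space \<kappa> by fact
      show "integrable \<kappa> (\<lambda>x. \<bar>h 0\<bar> + hmod b x)" using that(2) by simp
      show "AE x in \<kappa>. norm (h x) \<le> norm (\<bar>h 0\<bar> + hmod b x)"
      proof (rule AE_I2)
        fix x
        show "norm (h x) \<le> norm (\<bar>h 0\<bar> + hmod b x)"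
          using le[of x] abs_ge_self[of "\<bar>h 0\<bar> + hmod b x"] unfolding real_norm_def by linarith
      qed
    qed measurable
    have conv: "(\<lambda>n. \<integral>x. ?t h (real n) x \<partial>\<kappa>) \<longlonglongrightarrow> (\<integral>x. h x \<partial>\<kappa>)"
      if "integrable \<kappa> h" and [measurable_cong]: "sets \<kappa> = sets borel" for \<kappa>
    proof (rule integral_dominated_convergence[where w="\<lambda>x. \<bar>h x\<bar>"])
      show "AE x in \<kappa>. norm (?t h (real n) x) \<le> \<bar>h x\<bar>" for n by (rule AE_I2) auto
    qed (use that lim in auto)
    have 1: "integrable L h" "integrable \<pi> h" using ih[OF L(1) int L(2)] ih[OF pi(1) intP pi(2)] by auto
    have "(\<lambda>n. \<bar>(\<integral>x. ?t h (real n) x \<partial>L) - (\<integral>x. ?t h (real n) x \<partial>\<pi>)\<bar>) \<longlonglongrightarrow> \<bar>(\<integral>x. h x \<partial>L) - (\<integral>x. h x \<partial>\<pi>)\<bar>"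
      by (intro tendsto_rabs tendsto_diff conv 1 L pi)
    then have "\<bar>(\<integral>x. h x \<partial>L) - (\<integral>x. h x \<partial>\<pi>)\<bar> \<le> r"
      by (rule LIMSEQ_le_const2) (use bdt[OF h] in blast)
    then show ?thesis using 1 by simp
  qed
  show ?thesis unfolding ipm_def
    by (rule SUP_least) (use main in \<open>auto intro!: ennreal_leI\<close>)
qed

section \<open>Laws of Paretian vectors and of their sums\<close>

lemma Int_sphere_borel: "A \<in> sets borel \<Longrightarrow> A \<inter> sphere 0 1 \<in> sets sphere_borel"
  unfolding sphere_borel_def sets_restrict_space by (rule image_eqI[of _ _ A]) (simp_all add: Int_commute)

text \<open>Independence of the two generated sigma-algebras makes the joint law of radius and
  direction a product measure, which is checked on rectangles. \<open>\<nu>\<close> lives on the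
  sphere and is therefore pushed to the whole space.\<close>

lemma paretian_distr:
  fixes \<nu> :: "'a::euclidean_space measure"
  assumes al: "0 < \<alpha>" and par: "paretian \<alpha> \<nu> M \<tau>"
  shows "distr M borel \<tau> = distr (pareto \<alpha> 1 \<Otimes>\<^sub>M distr \<nu> borel (\<lambda>x. x)) borel (\<lambda>(u, \<theta>). u *\<^sub>R \<theta>)"
proof -
  obtain N :: "(real \<times> 'a) measure" and \<xi> \<epsilon> where
    N: "prob_space N" and xi: "distributed N lborel \<xi> (\<lambda>u. ennreal (\<alpha> * u powr (-1 - \<alpha>) * indicator {1..} u))"
    and eps: "\<epsilon> \<in> measurable N sphere_borel" "distr N sphere_borel \<epsilon> = \<nu>"
    and ind: "prob_space.indep_set N (sets (vimage_algebra (space N) \<xi> borel)) (sets (vimage_algebra (space N) \<epsilon> sphere_borel))"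
    and law: "distr M borel \<tau> = distr N borel (\<lambda>\<omega>. \<xi> \<omega> *\<^sub>R \<epsilon> \<omega>)"
    using par unfolding paretian_def by blast
  interpret prob_space N by fact
  have mx[measurable]: "\<xi> \<in> N \<rightarrow>\<^sub>M borel" using distributed_measurable[OF xi] by simp
  have id: "(\<lambda>x. x) \<in> sphere_borel \<rightarrow>\<^sub>M (borel :: 'a measure)"
    unfolding sphere_borel_def by (intro measurable_restrict_space1) simp
  have me[measurable]: "\<epsilon> \<in> N \<rightarrow>\<^sub>M borel" using measurable_compose[OF eps(1) id] by simp
  have dx: "pareto \<alpha> 1 = distr N borel \<xi>"
    using distributed_distr_eq_density[OF xi] unfolding pareto_def
    by (metis distr_cong sets_lborel)
  have de: "distr \<nu> borel (\<lambda>x. x) = distr N borel \<epsilon>"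
    unfolding eps(2)[symmetric] by (subst distr_distr[OF id eps(1)]) (simp add: comp_def)
  interpret X: prob_space "distr N borel \<xi>" by (rule prob_space_distr) simp
  interpret E: prob_space "distr N borel \<epsilon>" by (rule prob_space_distr) simp
  have "distr N borel \<xi> \<Otimes>\<^sub>M distr N borel \<epsilon> = distr N (borel \<Otimes>\<^sub>M borel) (\<lambda>\<omega>. (\<xi> \<omega>, \<epsilon> \<omega>))"
  proof (rule pair_measure_eqI)
    show "sigma_finite_measure (distr N borel \<xi>)" "sigma_finite_measure (distr N borel \<epsilon>)" by unfold_locales
    show "sets (distr N borel \<xi> \<Otimes>\<^sub>M distr N borel \<epsilon>) = sets (distr N (borel \<Otimes>\<^sub>M borel) (\<lambda>\<omega>. (\<xi> \<omega>, \<epsilon> \<omega>)))"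
      by (simp cong: sets_pair_measure_cong)
    fix A B assume AB: "A \<in> sets (distr N borel \<xi>)" "B \<in> sets (distr N borel \<epsilon>)"
    then have [measurable]: "A \<in> sets borel" "B \<in> sets borel" by auto
    have a: "\<xi> -` A \<inter> space N \<in> sets (vimage_algebra (space N) \<xi> borel)"
      by (rule in_vimage_algebra) simp
    \<comment> \<open>\<open>\<epsilon>\<close> takes values in the sphere, so \<open>B\<close> may
      be replaced by its trace, which belongs to the sigma-algebra used in the independence
      assumption.\<close>
    have eB: "\<epsilon> -` B \<inter> space N = \<epsilon> -` (B \<inter> sphere 0 1) \<inter> space N"
      using measurable_space[OF eps(1)] by (auto simp: sphere_borel_def space_restrict_space)
    have "B \<inter> sphere 0 1 \<in> sets sphere_borel"
      using AB by (intro Int_sphere_borel) simp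
    then have b: "\<epsilon> -` B \<inter> space N \<in> sets (vimage_algebra (space N) \<epsilon> sphere_borel)"
      unfolding eB by (rule in_vimage_algebra)
    have "(\<lambda>\<omega>. (\<xi> \<omega>, \<epsilon> \<omega>)) -` (A \<times> B) \<inter> space N = (\<xi> -` A \<inter> space N) \<inter> (\<epsilon> -` B \<inter> space N)" by auto
    then show "emeasure (distr N borel \<xi>) A * emeasure (distr N borel \<epsilon>) B
        = emeasure (distr N (borel \<Otimes>\<^sub>M borel) (\<lambda>\<omega>. (\<xi> \<omega>, \<epsilon> \<omega>))) (A \<times> B)"
      using indep_setD[OF ind a b]
      by (simp add: emeasure_distr emeasure_eq_measure ennreal_mult')
  qed
  then have "distr (pareto \<alpha> 1 \<Otimes>\<^sub>M distr \<nu> borel (\<lambda>x. x)) borel (\<lambda>(u, \<theta>). u *\<^sub>R \<theta>)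
     = distr (distr N (borel \<Otimes>\<^sub>M borel) (\<lambda>\<omega>. (\<xi> \<omega>, \<epsilon> \<omega>))) borel (\<lambda>(u, \<theta>). u *\<^sub>R \<theta>)"
    unfolding dx de by simp
  also have "\<dots> = distr N borel (\<lambda>\<omega>. \<xi> \<omega> *\<^sub>R \<epsilon> \<omega>)"
    by (subst distr_distr) (auto simp: comp_def)
  finally show ?thesis using law by simp
qed

context jump_law
begin

lemma jump_uminus: "distr jump borel uminus = jump"
proof (rule measure_eqI)
  interpret prob_space jump by (rule prob_jump)
  fix A assume "A \<in> sets (distr jump borel uminus)"
  then have A[measurable]: "A \<in> sets borel" by simp
  have "bmf (indicator A)" unfolding bmf_def by (auto intro!: exI[of _ 1] simp: indicator_def)
  from integral_jump_uminus[OF this]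
  have "(\<integral>y. indicat_real (uminus -` A) y \<partial>jump) = (\<integral>y. indicat_real A y \<partial>jump)" by (simp add: indicator_def)
  moreover have [measurable]: "uminus -` A \<in> sets borel" using measurable_sets[of uminus borel borel A] by simp
  ultimately have "prob (uminus -` A) = prob A" using sets_jump fin_borelD(3)[OF jump_fin_borel(1)] by simp
  then show "emeasure (distr jump borel uminus) A = emeasure jump A"
    using fin_borelD(3)[OF jump_fin_borel(1)] by (simp add: emeasure_distr emeasure_eq_measure)
qed (simp add: jump_def)

text \<open>Both kinds of centering, full and truncated, are integrals of odd functions. The change
  of variables holds for the Bochner integral with its default value 0 as well.\<close>

lemma integral_jump_odd:
  fixes f :: "'a \<Rightarrow> 'c::euclidean_space"
  assumes [measurable]: "f \<in> borel_measurable borel" and odd: "\<And>y. f (- y) = - f y"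
  shows "(\<integral>y. f y \<partial>jump) = 0"
proof -
  have "(\<integral>y. f y \<partial>jump) = (\<integral>y. f y \<partial>distr jump borel uminus)" by (simp only: jump_uminus)
  also have "\<dots> = - (\<integral>y. f y \<partial>jump)" by (subst integral_distr) (auto simp: odd)
  finally have "(\<integral>y. f y \<partial>jump) + (\<integral>y. f y \<partial>jump) = 0" by (simp only: eq_neg_iff_add_eq_0)
  then show ?thesis by (simp only: scaleR_2[symmetric]) simp
qed

text \<open>The bridge from random sums to operator powers: integrating out one coordinate replaces
  \<open>h\<close> by \<open>avg (sjump a) h\<close>.\<close>

lemma integral_PiM_jump_sum:
  fixes I :: "'i set"
  assumes "finite I" "bmf h"
  shows "(\<integral>x. h (z + (\<Sum>i\<in>I. a *\<^sub>R x i)) \<partial>(\<Pi>\<^sub>M i\<in>I. jump)) = (avg (sjump a) ^^ card I) h z"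
  using assms
proof (induction I arbitrary: h rule: finite_induct)
  case empty
  then show ?case by (simp add: PiM_empty)
next
  case (insert i I)
  interpret prob_space jump by (rule prob_jump)
  interpret product_prob_space "\<lambda>_. jump" by unfold_locales
  interpret PI: prob_space "\<Pi>\<^sub>M i\<in>insert i I. jump" by (rule prob_space_PiM) (rule prob_jump)
  have [measurable]: "h \<in> borel_measurable borel" using insert.prems unfolding bmf_def by simp
  obtain B where B: "\<And>x. \<bar>h x\<bar> \<le> B" using insert.prems unfolding bmf_def by auto
  let ?f = "\<lambda>x. h (z + (\<Sum>i\<in>insert i I. a *\<^sub>R x i))"
  have "integrable (\<Pi>\<^sub>M i\<in>insert i I. jump) ?f"
    using B by (intro PI.integrable_const_bound[where B=B]) auto
  then have "(\<integral>x. ?f x \<partial>(\<Pi>\<^sub>M i\<in>insert i I. jump)) = (\<integral>x. (\<integral>y. ?f (x(i := y)) \<partial>jump) \<partial>(\<Pi>\<^sub>M i\<in>I. jump))"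
    using insert.hyps by (intro product_integral_insert) auto
  also have "\<dots> = (\<integral>x. avg (sjump a) h (z + (\<Sum>i\<in>I. a *\<^sub>R x i)) \<partial>(\<Pi>\<^sub>M i\<in>I. jump))"
  proof (rule Bochner_Integration.integral_cong[OF refl])
    fix x :: "'i \<Rightarrow> 'a"
    have "(\<Sum>j\<in>insert i I. a *\<^sub>R (x(i := y)) j) = (\<Sum>j\<in>I. a *\<^sub>R x j) + a *\<^sub>R y" for y
    proof -
      have "(\<Sum>j\<in>I. a *\<^sub>R (x(i := y)) j) = (\<Sum>j\<in>I. a *\<^sub>R x j)"
        using insert.hyps by (intro sum.cong) auto
      then show ?thesis using insert.hyps by (simp add: add.commute)
    qed
    then show "(\<integral>y. ?f (x(i := y)) \<partial>jump) = avg (sjump a) h (z + (\<Sum>i\<in>I. a *\<^sub>R x i))"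
      using insert.prems by (simp add: avg_sjump add.assoc)
  qed
  also have "\<dots> = (avg (sjump a) ^^ card I) (avg (sjump a) h) z"
    by (intro insert.IH bmf_avg sjump_fin_borel insert.prems)
  finally show ?case using insert.hyps by (simp add: funpow_swap1)
qed

lemma integral_jump_sum:
  assumes M: "prob_space M" and ind: "prob_space.indep_vars M (\<lambda>_. borel) \<tau> {1..n}"
    and law: "\<And>i. i \<in> {1..n} \<Longrightarrow> distr M borel (\<tau> i) = jump" and n: "1 \<le> n" and h: "bmf h"
  shows "(\<integral>\<omega>. h (\<Sum>i=1..n. a *\<^sub>R \<tau> i \<omega>) \<partial>M) = (avg (sjump a) ^^ n) h 0"
proof -
  interpret prob_space M by fact
  let ?I = "{1..n}"
  have [measurable]: "h \<in> borel_measurable borel" using h unfolding bmf_def by simp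
  have m: "\<tau> i \<in> M \<rightarrow>\<^sub>M borel" if "i \<in> ?I" for i using ind that unfolding indep_vars_def by blast
  have "distr M (\<Pi>\<^sub>M i\<in>?I. borel) (\<lambda>\<omega>. \<lambda>i\<in>?I. \<tau> i \<omega>) = (\<Pi>\<^sub>M i\<in>?I. distr M borel (\<tau> i))"
    using indep_vars_iff_distr_eq_PiM'[of ?I \<tau> "\<lambda>_. borel"] ind m n by auto
  also have "\<dots> = (\<Pi>\<^sub>M i\<in>?I. jump)" by (intro PiM_cong law) auto
  finally have D: "distr M (\<Pi>\<^sub>M i\<in>?I. borel) (\<lambda>\<omega>. \<lambda>i\<in>?I. \<tau> i \<omega>) = (\<Pi>\<^sub>M i\<in>?I. jump)" .
  have "(avg (sjump a) ^^ n) h 0 = (\<integral>x. h (0 + (\<Sum>i\<in>?I. a *\<^sub>R x i)) \<partial>(\<Pi>\<^sub>M i\<in>?I. jump))"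
    using integral_PiM_jump_sum[OF _ h, of ?I 0 a] by simp
  also have "\<dots> = (\<integral>\<omega>. h (0 + (\<Sum>i\<in>?I. a *\<^sub>R (\<lambda>i\<in>?I. \<tau> i \<omega>) i)) \<partial>M)"
    unfolding D[symmetric] by (rule integral_distr) (use m in measurable)
  also have "\<dots> = (\<integral>\<omega>. h (\<Sum>i=1..n. a *\<^sub>R \<tau> i \<omega>) \<partial>M)" by simp
  finally show ?thesis by simp
qed

text \<open>Subadditivity of the modulus reduces a sum to its single jumps.\<close>

lemma hmod_sum_integrable:
  assumes b: "0 < b" "b \<le> 1" "b < \<alpha>" and I: "finite I"
    and m: "\<And>i. i \<in> I \<Longrightarrow> \<tau> i \<in> M \<rightarrow>\<^sub>M borel" and law: "\<And>i. i \<in> I \<Longrightarrow> distr M borel (\<tau> i) = jump"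
  shows "integrable M (\<lambda>\<omega>. hmod b (\<Sum>i\<in>I. a *\<^sub>R \<tau> i \<omega>))"
  using I m law
proof (induction I rule: finite_induct)
  case empty
  then show ?case by (simp add: hmod_def)
next
  case (insert i I)
  have [measurable]: "(\<lambda>\<omega>. \<Sum>j\<in>I. a *\<^sub>R \<tau> j \<omega>) \<in> M \<rightarrow>\<^sub>M borel" "\<tau> i \<in> M \<rightarrow>\<^sub>M borel"
    using insert.prems by (auto intro!: borel_measurable_sum borel_measurable_scaleR)
  have "integrable (distr M borel (\<tau> i)) (\<lambda>y. hmod b (a *\<^sub>R y))"
    using insert.prems hmod_integrable[of b a] b by simp
  then have 1: "integrable M (\<lambda>\<omega>. hmod b (a *\<^sub>R \<tau> i \<omega>))"
    by (subst (asm) integrable_distr_eq) auto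
  have 2: "integrable M (\<lambda>\<omega>. hmod b (\<Sum>j\<in>I. a *\<^sub>R \<tau> j \<omega>))" using insert by auto
  show ?case
  proof (rule Bochner_Integration.integrable_bound[OF Bochner_Integration.integrable_add[OF 1 2]])
    show "AE \<omega> in M. norm (hmod b (\<Sum>j\<in>insert i I. a *\<^sub>R \<tau> j \<omega>)) \<le> norm (hmod b (a *\<^sub>R \<tau> i \<omega>) + hmod b (\<Sum>j\<in>I. a *\<^sub>R \<tau> j \<omega>))"
      using insert.hyps by (simp add: hmod_nonneg abs_of_nonneg add_nonneg_nonneg hmod_add_le[OF b(1,2)])
  qed (use insert.hyps in simp)
qed

text \<open>Adding up the doubling costs compares \<open>L n\<close> with all
  \<open>L (2 ^ k * n)\<close>, and these tend to \<open>\<pi>\<close> by the continuity theorem.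
  \<open>R\<close> and \<open>\<sigma>\<close> are kept abstract so that one argument serves every
  regime of \<open>\<alpha>\<close>.\<close>

lemma ipm_rate:
  fixes L :: "nat \<Rightarrow> 'a measure"
  assumes b: "0 < b" "b \<le> 1" "b < \<alpha>" and c: "0 < c"
    and L: "\<And>n. 1 \<le> n \<Longrightarrow> prob_space (L n)" "\<And>n. 1 \<le> n \<Longrightarrow> sets (L n) = sets borel"
    and avg: "\<And>n h. 1 \<le> n \<Longrightarrow> bmf h \<Longrightarrow> (\<integral>y. h y \<partial>L n) = (avg (sjump (step_size c n)) ^^ n) h 0"
    and int: "\<And>n. 1 \<le> n \<Longrightarrow> integrable (L n) (hmod b)"
    and pi: "prob_space \<pi>" "sets \<pi> = sets borel"
    and char: "\<And>l. (\<integral>y. iexp (l \<bullet> y) \<partial>\<pi>) = complex_of_real (exp (- (\<alpha> * c powr \<alpha> * (\<integral>\<theta>. levy_cos \<alpha> (l \<bullet> \<theta>) \<partial>\<nu>))))"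
    and n0: "1 \<le> n0" and K: "0 \<le> K" and R: "\<And>n. 0 \<le> R n" and \<sigma>: "summable \<sigma>" "\<And>j. 0 \<le> \<sigma> j"
    and err: "\<And>n j. n0 \<le> n \<Longrightarrow> double_err b c (2 ^ j * n) \<le> K * R n * \<sigma> j"
  shows "\<exists>C>0. \<forall>n\<ge>n0. ipm (H_class b) (L n) \<pi> \<le> ennreal (C * R n)"
proof -
  obtain C where C: "0 < C"
    "\<And>h n z. bmf h \<Longrightarrow> h \<in> H_class b \<Longrightarrow> 1 \<le> n \<Longrightarrow>
      \<bar>(avg (sjump (step_size c n)) ^^ n) h z - (avg (sjump (step_size c (2 * n))) ^^ (2 * n)) h z\<bar>
        \<le> C * double_err b c n"
    by (rule avg_pow_double_diff[OF b(1,2) c hmod_integrable[OF b(1,3)]]) (auto simp: double_err_def)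
  \<comment> \<open>The summand 1 makes the constant positive even when \<open>K\<close> or the sum
    of \<open>\<sigma>\<close> is 0.\<close>
  have bound: "\<bar>(\<integral>y. h y \<partial>L n) - (\<integral>y. h y \<partial>\<pi>)\<bar> \<le> (C * K * suminf \<sigma> + 1) * R n"
    if h: "bmf h" "h \<in> H_class b" and n: "n0 \<le> n" for h n
  proof -
    have n1: "1 \<le> 2 ^ k * n" for k using n n0 by (simp add: Suc_leI)
    let ?e = "\<lambda>k. \<integral>y. h y \<partial>L (2 ^ k * n)"
    have step: "\<bar>?e k - ?e (Suc k)\<bar> \<le> C * (K * R n * \<sigma> k)" for k
    proof -
      have "\<bar>?e k - ?e (Suc k)\<bar> \<le> C * double_err b c (2 ^ k * n)"
        using C(2)[OF h n1[of k], of 0] avg[OF n1[of k] h(1)] avg[OF n1[of "Suc k"] h(1)] by (simp add: mult.assoc)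
      also have "\<dots> \<le> C * (K * R n * \<sigma> k)" using C(1) err[OF n] by (intro mult_left_mono) auto
      finally show ?thesis .
    qed
    have tele: "\<bar>?e 0 - ?e k\<bar> \<le> (C * K * suminf \<sigma> + 1) * R n" for k
    proof -
      have "\<bar>?e 0 - ?e k\<bar> \<le> (\<Sum>j<k. C * (K * R n * \<sigma> j))"
      proof (induction k)
        case (Suc k)
        then show ?case using step[of k] by simp
      qed simp
      also have "\<dots> = C * K * R n * (\<Sum>j<k. \<sigma> j)" by (simp add: sum_distrib_left mult.assoc)
      also have "\<dots> \<le> C * K * R n * suminf \<sigma>"
        using C(1) K R \<sigma> by (intro mult_left_mono sum_le_suminf) auto
      also have "\<dots> \<le> (C * K * suminf \<sigma> + 1) * R n" using R[of n] by (simp add: algebra_simps)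
      finally show ?thesis .
    qed
    have "(\<lambda>k. ?e k) \<longlonglongrightarrow> (\<integral>y. h y \<partial>\<pi>)"
    proof -
      obtain B where B: "\<And>x. \<bar>h x\<bar> \<le> B" using h unfolding bmf_def by auto
      have sm: "strict_mono (\<lambda>k. 2 ^ k * n)" using n n0 by (auto simp: strict_mono_Suc_iff)
      show ?thesis
      proof (rule char_tendsto_imp_integral_tendsto[where B=B])
        fix l
        have "(\<integral>y. iexp (l \<bullet> y) \<partial>L (2 ^ k * n)) = complex_of_real (cos_char (step_size c (2 ^ k * n) *\<^sub>R l) ^ (2 ^ k * n))" for k
          by (rule char_of_avg_pow) (use L[OF n1] avg[OF n1] in auto)
        moreover have "(\<lambda>k. cos_char (step_size c (2 ^ k * n) *\<^sub>R l) ^ (2 ^ k * n)) \<longlonglongrightarrow> exp (- (\<alpha> * c powr \<alpha> * (\<integral>\<theta>. levy_cos \<alpha> (l \<bullet> \<theta>) \<partial>\<nu>)))"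
          using LIMSEQ_subseq_LIMSEQ[OF cos_char_pow_tendsto[OF c] sm] by (simp add: comp_def)
        ultimately show "(\<lambda>k. \<integral>y. iexp (l \<bullet> y) \<partial>L (2 ^ k * n)) \<longlonglongrightarrow> (\<integral>y. iexp (l \<bullet> y) \<partial>\<pi>)"
          unfolding char by (simp only: tendsto_of_real_iff)
        show "\<bar>h x - h y\<bar> \<le> norm (x - y)" for x y
          using h(2) hmod_le_norm[of b "x - y"] unfolding H_class_iff by (meson order_trans)
      qed (use L[OF n1] pi h(1) B in \<open>auto simp: bmf_def\<close>)
    qed
    then have "(\<lambda>k. \<bar>?e 0 - ?e k\<bar>) \<longlonglongrightarrow> \<bar>?e 0 - (\<integral>y. h y \<partial>\<pi>)\<bar>" by (intro tendsto_intros)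
    then have "\<bar>?e 0 - (\<integral>y. h y \<partial>\<pi>)\<bar> \<le> (C * K * suminf \<sigma> + 1) * R n"
      by (rule LIMSEQ_le_const2) (use tele in blast)
    then show ?thesis by simp
  qed
  show ?thesis
  proof (intro exI[of _ "C * K * suminf \<sigma> + 1"] conjI allI impI)
    have "0 \<le> suminf \<sigma>" using \<sigma> by (intro suminf_nonneg) auto
    then show "0 < C * K * suminf \<sigma> + 1" using C(1) K by (intro add_nonneg_pos mult_nonneg_nonneg) auto
    fix n assume n: "n0 \<le> n"
    then have "1 \<le> n" using n0 by simp
    then show "ipm (H_class b) (L n) \<pi> \<le> ennreal ((C * K * suminf \<sigma> + 1) * R n)"
      by (intro ipm_H_class_le b L pi int bound n)
  qed
qed

end

lemma d_const_nonneg: "0 \<le> d_const \<alpha>"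
proof -
  have "0 \<le> (LINT y:{0<..}|lborel. (1 - cos y) * y powr (-1 - \<alpha>))"
    unfolding set_lebesgue_integral_def by (intro integral_nonneg_AE) (auto simp: indicator_def)
  then show ?thesis unfolding d_const_def by simp
qed

text \<open>With exponent 1 both terms of the minimum are the norm; so the case
  \<open>\<alpha> > 1\<close> is the instance \<open>b = 1\<close> of the general estimates.\<close>

lemma Lip1_eq_H_class: "Lip1 = H_class 1"
proof -
  have "1-lipschitz_on UNIV h \<longleftrightarrow> h \<in> H_class 1" for h :: "'a \<Rightarrow> real"
    by (auto simp: H_class_def lipschitz_on_def dist_norm)
  then show ?thesis unfolding Lip1_def by blast
qed

theorem theorem16:
  fixes \<alpha> \<gamma> :: real
    and \<nu> \<pi> :: "(real ^ 'n) measure"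
    and M :: "'b measure"
    and \<tau> :: "nat \<Rightarrow> 'b \<Rightarrow> real ^ 'n"
  assumes dim: "CARD('n) \<ge> 2"
    and alpha: "0 < \<alpha>" "\<alpha> < 2"
    and nu_prob: "prob_space \<nu>"
    and nu_sets: "sets \<nu> = sets sphere_borel"
    and nu_centred: "\<alpha> = 1 \<Longrightarrow> (LINT \<theta>|\<nu>. \<theta>) = 0"
    and pi_stable: "stable_law \<alpha> \<nu> \<pi>"
    and pi_density: "has_density \<pi>"
    and nu_symmetric: "sphere_symmetric \<nu>"
    and gamma: "1 \<le> \<gamma>" "\<gamma> \<le> real CARD('n)" "\<gamma> > real CARD('n) - \<alpha>"
    and mu_gamma: "gamma_measure \<gamma> (levy_measure \<alpha> \<nu>)"
    and M_prob: "prob_space M"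
    and tau_indep: "prob_space.indep_vars M (\<lambda>_. borel) \<tau> {1..}"
    and tau_paretian: "\<And>i. i \<ge> 1 \<Longrightarrow> paretian \<alpha> \<nu> M (\<tau> i)"
  shows "(\<alpha> > 1 \<longrightarrow>
           (\<exists>C>0. \<forall>n\<ge>1. d_W (distr M borel (S_sum \<alpha> M \<tau> n)) \<pi>
              \<le> ennreal (C * real n powr ((\<alpha> - 2) / \<alpha>)))) \<and>
         (\<alpha> = 1 \<longrightarrow>
           (\<forall>\<beta>. 0 < \<beta> \<and> \<beta> < \<alpha> \<longrightarrow>
             (\<exists>C>0. \<forall>n\<ge>2. d_W_beta \<beta> (distr M borel (S_sum \<alpha> M \<tau> n)) \<pi>
                \<le> ennreal (C * (inverse (real n) * (ln (real n))\<^sup>2))))) \<and>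
         (1 / 2 < \<alpha> \<and> \<alpha> < 1 \<longrightarrow>
           (\<forall>\<beta>. 0 < \<beta> \<and> \<beta> < \<alpha> \<longrightarrow>
             (\<exists>C>0. \<forall>n\<ge>1. d_W_beta \<beta> (distr M borel (S_sum \<alpha> M \<tau> n)) \<pi>
                \<le> ennreal (C * (inverse (real n)
                     + norm (LINT \<theta>|\<nu>. \<theta>) * real n powr ((\<alpha> - 1) / \<alpha>)))))) \<and>
         (\<alpha> \<le> 1 / 2 \<longrightarrow>
           (\<forall>\<beta>. 0 < \<beta> \<and> \<beta> < \<alpha> \<longrightarrow>
             (\<exists>C>0. \<forall>n\<ge>1. ipm (H_class \<beta> \<inter> F_class \<beta>) (distr M borel (S_sum \<alpha> M \<tau> n)) \<pi>
                \<le> ennreal (C * (inverse (real n)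
                     + norm (LINT \<theta>|\<nu>. \<theta>) * real n powr ((\<alpha> - 1) / \<alpha>))))))"
proof -
  interpret Nu: prob_space \<nu> by (rule nu_prob)
  interpret M: prob_space M by (rule M_prob)
  have pi: "prob_space \<pi>" "sets \<pi> = sets borel"
    using pi_stable unfolding stable_law_def by auto
  have sp: "space \<nu> = sphere 0 1"
    using sets_eq_imp_space_eq[OF nu_sets] by (simp add: sphere_borel_def space_restrict_space)
  have id[measurable]: "(\<lambda>x. x) \<in> \<nu> \<rightarrow>\<^sub>M borel"
    unfolding measurable_cong_sets[OF nu_sets refl] sphere_borel_def by (intro measurable_restrict_space1) simp
  \<comment> \<open>The image of the sphere measure on the whole space, as \<open>jump_law\<close>
    requires.\<close>
  define \<nu>' where "\<nu>' = distr \<nu> borel (\<lambda>x. x)"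
  interpret Nu': prob_space \<nu>' unfolding \<nu>'_def by (rule Nu.prob_space_distr) (rule id)
  have bm: "f \<in> \<nu> \<rightarrow>\<^sub>M borel" if "f \<in> borel_measurable borel" for f :: "real ^ 'n \<Rightarrow> 'c::topological_space"
    using measurable_compose[OF id that] .
  have sphere: "AE \<theta> in \<nu>'. norm \<theta> = 1"
    unfolding \<nu>'_def by (subst AE_distr_iff[OF id]) (auto simp: sp)
  have sym: "distr \<nu>' borel uminus = \<nu>'"
  proof (rule measure_eqI)
    fix A assume "A \<in> sets (distr \<nu>' borel uminus)"
    then have A[measurable]: "A \<in> sets borel" by simp
    have mA: "uminus -` A \<in> sets borel" using measurable_sets[of uminus borel borel A] by simp
    have B: "A \<inter> sphere 0 1 \<in> sets sphere_borel" by (rule Int_sphere_borel[OF A])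
    have "emeasure (distr \<nu>' borel uminus) A = emeasure \<nu>' (uminus -` A)"
      by (subst emeasure_distr) (auto simp: \<nu>'_def)
    also have "\<dots> = emeasure \<nu> (uminus -` A \<inter> sphere 0 1)"
      unfolding \<nu>'_def using mA by (subst emeasure_distr) (auto simp: sp)
    also have "uminus -` A \<inter> sphere 0 1 = uminus ` (A \<inter> sphere 0 1)"
    proof (intro equalityI subsetI)
      fix x assume "x \<in> uminus -` A \<inter> sphere 0 1"
      then show "x \<in> uminus ` (A \<inter> sphere 0 1)" by (intro image_eqI[of _ _ "- x"]) simp_all
    qed auto
    also have "emeasure \<nu> \<dots> = emeasure \<nu> (A \<inter> sphere 0 1)"
      using nu_symmetric B unfolding sphere_symmetric_def by metis
    also have "\<dots> = emeasure \<nu>' A"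
      unfolding \<nu>'_def by (subst emeasure_distr) (auto simp: sp)
    finally show "emeasure (distr \<nu>' borel uminus) A = emeasure \<nu>' A" .
  qed (simp add: \<nu>'_def)
  define J where "J = (\<lambda>l. \<integral>\<theta>. levy_exponent \<alpha> (l \<bullet> \<theta>) \<partial>\<nu>')"
  have char: "(\<integral>x. iexp (l \<bullet> x) \<partial>\<pi>) = exp (complex_of_real (d_const \<alpha>) * J l)" for l
  proof -
    have m: "(\<lambda>\<theta>. levy_exponent \<alpha> (l \<bullet> \<theta>)) \<in> borel_measurable borel"
      using levy_exponent_borel[OF alpha] by measurable
    have "J l = (\<integral>\<theta>. levy_exponent \<alpha> (l \<bullet> \<theta>) \<partial>\<nu>)"
      unfolding J_def \<nu>'_def by (rule integral_distr[OF id m])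
    then show ?thesis
      using pi_stable unfolding stable_law_def levy_exponent_def levy_integrand_def
      by (simp only: inner_scaleR_right)
  qed
  \<comment> \<open>If \<open>\<nu>'\<close> were carried by the hyperplane orthogonal to
    \<open>l\<close>, the exponent at \<open>l\<close> would vanish and the characteristic function
    of \<open>\<pi>\<close> would be 1 there.\<close>
  have nondeg: "\<not> (AE \<theta> in \<nu>'. l \<bullet> \<theta> = 0)" if l: "l \<noteq> 0" for l
  proof
    assume "AE \<theta> in \<nu>'. l \<bullet> \<theta> = 0"
    moreover have "levy_exponent \<alpha> 0 = 0"
      by (simp add: levy_exponent_def levy_integrand_def set_lebesgue_integral_def)
    ultimately have "J l = (\<integral>\<theta>. 0 \<partial>\<nu>')"
      unfolding J_def using levy_exponent_borel[OF alpha]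
      by (intro integral_cong_AE) (auto simp: \<nu>'_def elim!: eventually_mono)
    then show False using char[of l] char_density_ne_1[OF pi pi_density l] by simp
  qed
  interpret jump_law \<alpha> \<nu>'
  proof
    show "fin_borel \<nu>'" unfolding fin_borel_def using Nu'.finite_measure_axioms by (simp add: \<nu>'_def)
    show "measure \<nu>' UNIV = 1" using Nu'.prob_space by (simp add: \<nu>'_def)
  qed (fact alpha sphere sym nondeg)+
  \<comment> \<open>If the constant were 0, the characteristic function of \<open>\<pi>\<close>
    would be 1 everywhere; so positivity follows without evaluating the defining integral.\<close>
  have d0: "0 < d_const \<alpha>"
  proof (rule ccontr)
    assume "\<not> 0 < d_const \<alpha>"
    then have "d_const \<alpha> = 0" using d_const_nonneg[of \<alpha>] by linarith
    moreover obtain l :: "real ^ 'n" where "l \<in> Basis" using nonempty_Basis by blast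
    ultimately show False using char[of l] char_density_ne_1[OF pi pi_density nonzero_Basis] by simp
  qed
  \<comment> \<open>The factor in \<open>zeta\<close>; it satisfies
    \<open>\<alpha> * c powr \<alpha> = d_const \<alpha>\<close>, which matches the limit of the
    characteristic functions to that of \<open>\<pi>\<close>.\<close>
  define c where "c = (\<alpha> / d_const \<alpha>) powr (- 1 / \<alpha>)"
  have c: "0 < c" unfolding c_def using alpha d0 by simp
  have "c powr \<alpha> = (\<alpha> / d_const \<alpha>) powr (- 1)"
    unfolding c_def powr_powr using alpha by simp
  then have dc: "\<alpha> * c powr \<alpha> = d_const \<alpha>" using alpha d0 by (simp add: powr_minus_divide)
  have char': "(\<integral>x. iexp (l \<bullet> x) \<partial>\<pi>) = complex_of_real (exp (- (\<alpha> * c powr \<alpha> * (\<integral>\<theta>. levy_cos \<alpha> (l \<bullet> \<theta>) \<partial>\<nu>'))))" for l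
    unfolding char dc J_def levy_exponent_integral by (simp add: exp_of_real[symmetric])
  have law: "distr M borel (\<tau> i) = jump" if "1 \<le> i" for i
    unfolding jump_def unfolding \<nu>'_def by (rule paretian_distr[OF alpha(1) tau_paretian[OF that]])
  have tm: "\<tau> i \<in> M \<rightarrow>\<^sub>M borel" if "1 \<le> i" for i
    using tau_paretian[OF that] by (simp add: paretian_def)
  have zeta: "zeta \<alpha> \<tau> n i \<omega> = step_size c n *\<^sub>R \<tau> i \<omega>" for n i \<omega>
    by (simp add: zeta_def step_size_def c_def powr_minus)
  have mean0: "(\<integral>\<omega>. f (\<tau> i \<omega>) \<partial>M) = 0"
    if "1 \<le> i" "f \<in> borel_measurable borel" "\<And>y. f (- y) = - f y" for i and f :: "real ^ 'n \<Rightarrow> real ^ 'n"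
    using integral_distr[OF tm[OF that(1)] that(2)] integral_jump_odd[OF that(2,3)] law[OF that(1)] by simp
  have S: "S_sum \<alpha> M \<tau> n = (\<lambda>\<omega>. \<Sum>i=1..n. step_size c n *\<^sub>R \<tau> i \<omega>)" for n
  proof
    fix \<omega>
    have 1: "(\<integral>\<omega>. step_size c n *\<^sub>R \<tau> i \<omega> \<partial>M) = 0" if "1 \<le> i" for i
      by (rule mean0[OF that]) auto
    have 2: "(\<integral>\<omega>. indicator {0<..1} (norm (step_size c n *\<^sub>R \<tau> i \<omega>)) *\<^sub>R step_size c n *\<^sub>R \<tau> i \<omega> \<partial>M) = 0" if "1 \<le> i" for i
      by (rule mean0[OF that, of "\<lambda>y. indicator {0<..1} (norm (step_size c n *\<^sub>R y)) *\<^sub>R step_size c n *\<^sub>R y"]) auto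
    show "S_sum \<alpha> M \<tau> n \<omega> = (\<Sum>i=1..n. step_size c n *\<^sub>R \<tau> i \<omega>)"
      unfolding S_sum_def zeta using 1 2 by (auto intro!: sum.cong)
  qed
  define L where "L = (\<lambda>n. distr M borel (S_sum \<alpha> M \<tau> n))"
  have Sm: "S_sum \<alpha> M \<tau> n \<in> M \<rightarrow>\<^sub>M borel" for n
    unfolding S using tm by (intro borel_measurable_sum borel_measurable_scaleR) auto
  have L: "prob_space (L n)" "sets (L n) = sets borel" for n
    unfolding L_def using M.prob_space_distr[OF Sm] by auto
  have avg: "(\<integral>y. h y \<partial>L n) = (avg (sjump (step_size c n)) ^^ n) h 0" if n: "1 \<le> n" and h: "bmf h" for n h
  proof -
    have "h \<in> borel_measurable borel" using h by (simp add: bmf_def)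
    then have "(\<integral>y. h y \<partial>L n) = (\<integral>\<omega>. h (\<Sum>i=1..n. step_size c n *\<^sub>R \<tau> i \<omega>) \<partial>M)"
      unfolding L_def by (subst integral_distr[OF Sm]) (simp_all add: S)
    also have "\<dots> = (avg (sjump (step_size c n)) ^^ n) h 0"
      using M.indep_vars_subset[OF tau_indep, of "{1..n}"] law
      by (intro integral_jump_sum M_prob n h) auto
    finally show ?thesis .
  qed
  have int: "integrable (L n) (hmod b)" if b: "0 < b" "b \<le> 1" "b < \<alpha>" for b n
    unfolding L_def using hmod_sum_integrable[OF b, of "{1..n}" \<tau> M "step_size c n"] tm law
    by (subst integrable_distr_eq[OF Sm]) (auto simp: S)
  have "\<exists>C>0. \<forall>n\<ge>1. ipm (H_class 1) (L n) \<pi> \<le> ennreal (C * real n powr ((\<alpha> - 2) / \<alpha>))" if al: "1 < \<alpha>"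
  proof -
    obtain K where K: "0 \<le> K" "\<And>n j. 1 \<le> n \<Longrightarrow> double_err 1 c (2 ^ j * n)
        \<le> K * real n powr ((\<alpha> - 2) / \<alpha>) * (2 powr ((\<alpha> - 2) / \<alpha>)) ^ j"
      by (rule double_err_greater_1[OF al c]) blast
    \<comment> \<open>The geometric ratio is below 1 because \<open>\<alpha> < 2\<close>.\<close>
    have "2 powr ((\<alpha> - 2) / \<alpha>) < 2 powr 0"
      using alpha by (intro powr_less_mono) (auto simp: divide_neg_pos)
    then have sg: "summable (\<lambda>j. (2 powr ((\<alpha> - 2) / \<alpha>)) ^ j)" by (intro summable_geometric) simp
    show ?thesis
      by (rule ipm_rate[OF _ _ _ c L avg int pi char' _ K(1) _ sg _ K(2)]) (use al in auto)
  qed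
  moreover have "\<exists>C>0. \<forall>n\<ge>2. ipm (H_class \<beta>) (L n) \<pi> \<le> ennreal (C * (inverse (real n) * (ln (real n))\<^sup>2))"
    if al: "\<alpha> = 1" and b: "0 < \<beta>" "\<beta> < \<alpha>" for \<beta>
  proof -
    have b1: "\<beta> < 1" using b al by simp
    obtain K where K: "0 \<le> K" "\<And>n j. 2 \<le> n \<Longrightarrow> double_err \<beta> c (2 ^ j * n)
        \<le> K * (inverse (real n) * (ln (real n))\<^sup>2) * ((real j + 2)\<^sup>2 * (1 / 2) ^ j)"
      by (rule double_err_eq_1[OF al b1 c]) blast
    show ?thesis
      by (rule ipm_rate[OF _ _ _ c L avg int pi char' _ K(1) _ summable_square_half _ K(2)]) (use b b1 in auto)
  qed
  moreover have less_1: "\<exists>C>0. \<forall>n\<ge>1. ipm (H_class \<beta>) (L n) \<pi> \<le> ennreal (C * (inverse (real n)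
       + norm (LINT \<theta>|\<nu>. \<theta>) * real n powr ((\<alpha> - 1) / \<alpha>)))"
    if al: "\<alpha> < 1" and b: "0 < \<beta>" "\<beta> < \<alpha>" for \<beta>
  proof -
    obtain K where K: "0 \<le> K" "\<And>n j. 1 \<le> n \<Longrightarrow> double_err \<beta> c (2 ^ j * n) \<le> K * inverse (real n) * (1 / 2) ^ j"
      by (rule double_err_less_1[OF al b(2) c]) blast
    have sg: "summable (\<lambda>j. (1 / 2 :: real) ^ j)" by (intro summable_geometric) simp
    have "\<exists>C>0. \<forall>n\<ge>1. ipm (H_class \<beta>) (L n) \<pi> \<le> ennreal (C * inverse (real n))"
      by (rule ipm_rate[OF _ _ _ c L avg int pi char' _ K(1) _ sg _ K(2)]) (use b al in auto)
    then obtain C where C: "0 < C" "\<And>n. 1 \<le> n \<Longrightarrow> ipm (H_class \<beta>) (L n) \<pi> \<le> ennreal (C * inverse (real n))"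
      by blast
    \<comment> \<open>The added mean term is nonnegative, so the bound by \<open>C / n\<close>
      implies the stated one.\<close>
    have "ennreal (C * inverse (real n)) \<le> ennreal (C * (inverse (real n) + norm (LINT \<theta>|\<nu>. \<theta>) * real n powr ((\<alpha> - 1) / \<alpha>)))" for n
      using C(1) by (intro ennreal_leI mult_left_mono) auto
    then show ?thesis using C by (meson order_trans)
  qed
  moreover have "\<exists>C>0. \<forall>n\<ge>1. ipm (H_class \<beta> \<inter> F_class \<beta>) (L n) \<pi> \<le> ennreal (C * (inverse (real n)
       + norm (LINT \<theta>|\<nu>. \<theta>) * real n powr ((\<alpha> - 1) / \<alpha>)))"
    if al: "\<alpha> \<le> 1 / 2" and b: "0 < \<beta>" "\<beta> < \<alpha>" for \<beta>
  proof -
    \<comment> \<open>A smaller class of test functions gives a smaller supremum, so the estimate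
      for \<open>\<alpha> < 1\<close> covers this case.\<close>
    have "ipm (H_class \<beta> \<inter> F_class \<beta>) (L n) \<pi> \<le> ipm (H_class \<beta>) (L n) \<pi>" for n
      unfolding ipm_def by (intro SUP_subset_mono) auto
    moreover have "\<alpha> < 1" using al by simp
    ultimately show ?thesis using less_1[OF _ b] by (meson order_trans)
  qed
  ultimately show ?thesis
    unfolding d_W_def d_W_beta_def Lip1_eq_H_class L_def by blast
qed

end
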